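(* Let $n\ge 1$ be an integer, let $\sigma\ge 1$ and $2\delta\in(0,\sigma)$ be real numbers, let $m\in(1,2)$, and assume $n>\frac{2m\delta}{m-1}$. Then there is a constant $C>0$, independent of $t$ and of the data $u_0,u_1$, such that the solution $u$ of the Cauchy problem $$\partial_t^2u+(-\Delta)^{\sigma}u+(-\Delta)^{\delta}\partial_tu=0,\qquad u(0,x)=u_0(x),\quad \partial_tu(0,x)=u_1(x),\qquad t\ge 0,\ x\in\mathbb{R}^n,$$ satisfies, for all $t\ge 0$ and all data for which the norms on the respective right-hand side are finite, the following $(L^m\cap L^2)-L^2$ estimates: $$\|u(t,\cdot)\|_{L^2(\mathbb{R}^n)}\le C(1+t)^{-\frac{n}{2(\sigma-\delta)}\left(\frac1m-\frac12\right)-\frac{\delta}{\sigma-\delta}}\|u_0\|_{L^{2\delta,m}(\mathbb{R}^n)\cap L^2(\mathbb{R}^n)}+C(1+t)^{-\frac{n}{2(\sigma-\delta)}\left(\frac1m-\frac12\right)}\|u_1\|_{L^{2\delta,m}(\mathbb{R}^n)\cap L^2(\mathbb{R}^n)},$$ $$\|(-\Delta)^{\sigma/2}u(t,\cdot)\|_{L^2(\mathbb{R}^n)}\le C(1+t)^{-\frac{n}{2(\sigma-\delta)}\left(\frac1m-\frac12\right)-\frac{\sigma+2\delta}{2(\sigma-\delta)}}\|u_0\|_{L^{2\delta,m}(\mathbb{R}^n)\cap H^\sigma(\mathbb{R}^n)}+C(1+t)^{-\frac{n}{2(\sigma-\delta)}\left(\frac1m-\frac12\right)-\frac{\sigma}{2(\sigma-\delta)}}\|u_1\|_{L^{2\delta,m}(\mathbb{R}^n)\cap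 L^2(\mathbb{R}^n)},$$ $$\|\partial_tu(t,\cdot)\|_{L^2(\mathbb{R}^n)}\le C(1+t)^{-\frac{n}{2(\sigma-\delta)}\left(\frac1m-\frac12\right)-1-\frac{\delta}{\sigma-\delta}}\|u_0\|_{L^{2\delta,m}(\mathbb{R}^n)\cap H^\sigma(\mathbb{R}^n)}+C(1+t)^{-\frac{n}{2(\sigma-\delta)}\left(\frac1m-\frac12\right)-1}\|u_1\|_{L^{2\delta,m}(\mathbb{R}^n)\cap L^2(\mathbb{R}^n)}.$$ In particular, the following $L^2-L^2$ estimates hold (again for all $t\ge0$ and all data for which the respective right-hand side is finite): $$\|u(t,\cdot)\|_{L^2(\mathbb{R}^n)}\le C(1+t)^{-\frac{\delta}{\sigma-\delta}}\|u_0\|_{L^{2\delta,2}(\mathbb{R}^n)\cap L^2(\mathbb{R}^n)}+C\|u_1\|_{L^{2\delta,2}(\mathbb{R}^n)\cap L^2(\mathbb{R}^n)},$$ $$\|(-\Delta)^{\sigma/2}u(t,\cdot)\|_{L^2(\mathbb{R}^n)}\le C(1+t)^{-\frac{\sigma+2\delta}{2(\sigma-\delta)}}\|u_0\|_{L^{2\delta,2}(\mathbb{R}^n)\cap H^\sigma(\mathbb{R}^n)}+C(1+t)^{-\frac{\sigma}{2(\sigma-\delta)}}\|u_1\|_{L^{2\delta,2}(\mathbb{R}^n)\cap L^2(\mathbb{R}^n)},$$ $$\|\partial_tu(t,\cdot)\|_{L^2(\mathbb{R}^n)}\le C(1+t)^{-1-\frac{\delta}{\sigma-\delta}}\|u_0\|_{L^{2\delta,2}(\mathbb{R}^n)\cap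 H^\sigma(\mathbb{R}^n)}+C(1+t)^{-1}\|u_1\|_{L^{2\delta,2}(\mathbb{R}^n)\cap L^2(\mathbb{R}^n)}.$$
   Context: $\mathcal F$ (also written $\hat{\ }$) is the Fourier transform in $x\in\mathbb{R}^n$, and $|\cdot|$ is the Euclidean norm. The fractional Laplacian is defined by $\mathcal F((-\Delta)^a f)(\xi)=|\xi|^{2a}\mathcal F(f)(\xi)$. For $s\ge 0$, $\|f\|_{H^s(\mathbb{R}^n)}=\|(1+|\xi|^2)^{s/2}\mathcal F(f)\|_{L^2(\mathbb{R}^n)}$. For $m\in(1,2]$ and $\rho\ge0$, the weighted space $L^{\rho,m}(\mathbb{R}^n)$ consists of the functions $g$ with $\|g\|_{L^{\rho,m}(\mathbb{R}^n)}:=\||x|^\rho g\|_{L^m(\mathbb{R}^n)}=\left(\int_{\mathbb{R}^n}|x|^{\rho m}|g(x)|^m\,dx\right)^{1/m}<\infty$. The norm of an intersection is the sum of the norms: $\|f\|_{X\cap Y}=\|f\|_X+\|f\|_Y$. The solution $u$ is understood through its partial Fourier transform: for a.e. $\xi$, $\hat u(\cdot,\xi)$ is the solution of the ordinary differential equation $\partial_t^2\hat u+|\xi|^{2\delta}\partial_t\hat u+|\xi|^{2\sigma}\hat u=0$ with $\hat u(0,\xi)=\hat u_0(\xi)$, $\partial_t\hat u(0,\xi)=\hat u_1(\xi)$. Equivalently, with $\lambda_{1,2}(\xi)=\frac12\left(-|\xi|^{2\delta}\pm\sqrt{|\xi|^{4\delta}-4|\xi|^{2\sigma}}\right)$ and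 $\lambda_1\ne\lambda_2$, $$\hat u(t,\xi)=\frac{\lambda_1e^{\lambda_2t}-\lambda_2e^{\lambda_1t}}{\lambda_1-\lambda_2}\hat u_0(\xi)+\frac{e^{\lambda_1t}-e^{\lambda_2t}}{\lambda_1-\lambda_2}\hat u_1(\xi).$$ *)

theory Defs
  imports "HOL-Analysis.Analysis"
begin

text \<open>Functions on a Euclidean space are complex-valued and Borel measurable; every class
  modulo null sets has such a representative.\<close>

definition Lp_space :: "real \<Rightarrow> ('a::euclidean_space \<Rightarrow> complex) set" where
  "Lp_space p = {f \<in> borel_measurable lborel. integrable lborel (\<lambda>x. norm (f x) powr p)}"

definition Lp_norm :: "real \<Rightarrow> ('a::euclidean_space \<Rightarrow> complex) \<Rightarrow> real" where
  "Lp_norm p f = (LINT x|lborel. norm (f x) powr p) powr (1 / p)"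

definition weighted_Lp_space :: "real \<Rightarrow> real \<Rightarrow> ('a::euclidean_space \<Rightarrow> complex) set" where
  "weighted_Lp_space \<rho> p =
     {g \<in> borel_measurable lborel. (\<lambda>x. (norm x powr \<rho>) *\<^sub>R g x) \<in> Lp_space p}"

definition weighted_Lp_norm :: "real \<Rightarrow> real \<Rightarrow> ('a::euclidean_space \<Rightarrow> complex) \<Rightarrow> real" where
  "weighted_Lp_norm \<rho> p g = Lp_norm p (\<lambda>x. (norm x powr \<rho>) *\<^sub>R g x)"

text \<open>Fourier transform on \<open>L\<^sup>2\<close>, with kernel \<open>exp (- i x \<bullet> \<xi>)\<close> (so that the symbol of
  \<open>-\<Delta>\<close> is the square of \<open>norm \<xi>\<close>) and normalised to be unitary.  A function in \<open>L\<^sup>2\<close> need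
  not be integrable, so the integral is taken over balls of radius \<open>R\<close> and the transform is
  the limit in \<open>L\<^sup>2\<close> for \<open>R\<close> tending to infinity.  By Plancherel's theorem the limit exists for
  every \<open>f\<close> in \<open>L\<^sup>2\<close>; it is unique up to null sets.\<close>

definition truncated_fourier ::
    "real \<Rightarrow> ('a::euclidean_space \<Rightarrow> complex) \<Rightarrow> 'a \<Rightarrow> complex" where
  "truncated_fourier R f \<xi> =
     ((2 * pi) powr (- real DIM('a) / 2)) *\<^sub>R
       (LINT x:cball 0 R|lborel. cis (- (x \<bullet> \<xi>)) * f x)"

definition is_fourier_transform ::
    "('a::euclidean_space \<Rightarrow> complex) \<Rightarrow> ('a \<Rightarrow> complex) \<Rightarrow> bool" where
  "is_fourier_transform f F \<longleftrightarrow> f \<in> Lp_space 2 \<and> F \<in> Lp_space 2 \<and>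
     ((\<lambda>R. \<integral>\<^sup>+\<xi>. ennreal ((norm (truncated_fourier R f \<xi> - F \<xi>))\<^sup>2) \<partial>lborel) \<longlongrightarrow> 0) at_top"

definition fourier_transform :: "('a::euclidean_space \<Rightarrow> complex) \<Rightarrow> 'a \<Rightarrow> complex" where
  "fourier_transform f = (SOME F. is_fourier_transform f F)"

definition Sobolev_space :: "real \<Rightarrow> ('a::euclidean_space \<Rightarrow> complex) set" where
  "Sobolev_space s =
     {f \<in> Lp_space 2. (\<lambda>\<xi>. ((1 + (norm \<xi>)\<^sup>2) powr (s / 2)) *\<^sub>R fourier_transform f \<xi>) \<in> Lp_space 2}"

definition Sobolev_norm :: "real \<Rightarrow> ('a::euclidean_space \<Rightarrow> complex) \<Rightarrow> real" where
  "Sobolev_norm s f = Lp_norm 2 (\<lambda>\<xi>. ((1 + (norm \<xi>)\<^sup>2) powr (s / 2)) *\<^sub>R fourier_transform f \<xi>)"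

text \<open>\<open>g\<close> represents \<open>(-\<Delta>)\<^sup>a f\<close>, as an element of \<open>L\<^sup>2\<close>.\<close>

definition is_fractional_Laplacian ::
    "real \<Rightarrow> ('a::euclidean_space \<Rightarrow> complex) \<Rightarrow> ('a \<Rightarrow> complex) \<Rightarrow> bool" where
  "is_fractional_Laplacian a f g \<longleftrightarrow> f \<in> Lp_space 2 \<and> g \<in> Lp_space 2 \<and>
     (AE \<xi> in lborel. fourier_transform g \<xi> = (norm \<xi> powr (2 * a)) *\<^sub>R fourier_transform f \<xi>)"

text \<open>\<open>U\<close> represents the partial Fourier transform of \<open>u\<close>.  For each \<open>t\<close> the transform of \<open>u t\<close>
  is determined only almost everywhere, so a family \<open>U\<close> of representatives is needed before
  \<open>U t \<xi>\<close> can be differentiated in \<open>t\<close> for fixed \<open>\<xi>\<close>.\<close>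

definition is_partial_fourier ::
    "(real \<Rightarrow> 'a::euclidean_space \<Rightarrow> complex) \<Rightarrow> (real \<Rightarrow> 'a \<Rightarrow> complex) \<Rightarrow> bool" where
  "is_partial_fourier u U \<longleftrightarrow>
     (\<forall>t\<ge>0. u t \<in> Lp_space 2 \<and> (AE \<xi> in lborel. fourier_transform (u t) \<xi> = U t \<xi>))"

text \<open>\<open>w\<close> represents \<open>\<partial>\<^sub>t u(t, \<cdot>)\<close>, as an element of \<open>L\<^sup>2\<close>.  Since \<open>U\<close> is differentiable, hence
  continuous, in time for almost every \<open>\<xi>\<close>, two choices of \<open>U\<close> agree at all times for almost
  every \<open>\<xi>\<close>, so \<open>w\<close> is unique up to null sets.\<close>

definition is_time_derivative ::
    "(real \<Rightarrow> 'a::euclidean_space \<Rightarrow> complex) \<Rightarrow> real \<Rightarrow> ('a \<Rightarrow> complex) \<Rightarrow> bool" where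
  "is_time_derivative u t w \<longleftrightarrow> w \<in> Lp_space 2 \<and>
     (\<exists>U. is_partial_fourier u U \<and>
        (AE \<xi> in lborel. \<forall>s\<ge>0. (\<lambda>r. U r \<xi>) differentiable (at s within {0..})) \<and>
        (AE \<xi> in lborel.
           ((\<lambda>r. U r \<xi>) has_vector_derivative fourier_transform w \<xi>) (at t within {0..})))"

definition solves_damped_ode ::
    "real \<Rightarrow> real \<Rightarrow> real \<Rightarrow> complex \<Rightarrow> complex \<Rightarrow> (real \<Rightarrow> complex) \<Rightarrow> bool" where
  "solves_damped_ode \<sigma> \<delta> r a b y \<longleftrightarrow>
     (\<exists>y'. y 0 = a \<and> y' 0 = b \<and>
        (\<forall>t\<ge>0. (y has_vector_derivative y' t) (at t within {0..}) \<and>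
           (\<exists>y''. (y' has_vector_derivative y'') (at t within {0..}) \<and>
              y'' + (r powr (2 * \<delta>)) *\<^sub>R y' t + (r powr (2 * \<sigma>)) *\<^sub>R y t = 0)))"

definition is_Cauchy_solution ::
    "real \<Rightarrow> real \<Rightarrow> ('a::euclidean_space \<Rightarrow> complex) \<Rightarrow> ('a \<Rightarrow> complex) \<Rightarrow>
     (real \<Rightarrow> 'a \<Rightarrow> complex) \<Rightarrow> bool" where
  "is_Cauchy_solution \<sigma> \<delta> u0 u1 u \<longleftrightarrow> u0 \<in> Lp_space 2 \<and> u1 \<in> Lp_space 2 \<and>
     (\<exists>U. is_partial_fourier u U \<and>
        (AE \<xi> in lborel. solves_damped_ode \<sigma> \<delta> (norm \<xi>)
           (fourier_transform u0 \<xi>) (fourier_transform u1 \<xi>) (\<lambda>t. U t \<xi>)))"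

end

(* For each frequency the equation is a damped oscillator.  With T = (1 + t) powr (1 / (2 (sigma - delta))),
   its propagators at low frequencies are bounded by a power of T times |xi|^(-2 delta) and a factor that
   decays in T |xi|; at high frequencies a Lyapunov functional gives exponential decay.

   The singular weight is absorbed by the weighted norm of the data: its square is a superposition of
   Gaussians, and the Gaussian weighted energy of the Fourier transform of f is estimated in physical space,
   through the L^1 norm of f on a ball and through Young's convolution inequality outside.  The
   assumption n > 2 m delta / (m - 1) makes |x|^(-2 delta) locally integrable to the power m / (m - 1).

   The Fourier transform on L^2 is bounded by Gaussian summation.  All constants are generous: norm bounds
   with a factor 2 replace Plancherel's identity.  Preimages under the transform come from Fourier
   inversion, proved by convolution with the heat kernel. *)
theory Submission
  imports Defs "HOL-Probability.Characteristic_Functions" "HOL-Real_Asymp.Real_Asymp"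
begin

section \<open>Gaussians\<close>

text \<open>The obstacle is that the data live in a weighted \<open>L^m\<close> space, while the
  propagators act on the Fourier side and are singular at frequency zero. A Gaussian weight on that
  side turns into a positive Gaussian kernel on the other, so absolute values may be taken there and
  only weighted integrals of the data enter. The rates are a matter of scaling. The L^2 norm of
  |xi|^(-2 delta) min(1, (T |xi|)^(-kappa)) times the transform of f is at most a constant times
  T^(-nu) times the weighted norm of f, with nu = n (1/m - 1/2); this decay is common to all
  estimates. A further factor |xi|^j in a propagator is worth T^(-j), because powers of T |xi| are
  absorbed by the exponential. The propagator of u0 has no singularity; written against the singular
  weight it carries |xi|^(2 delta), whence the extra decay of the u0 terms. The derivatives in the
  statement are functions and not multipliers, and a solution has to exist; both require the
  transform on L^2 to be onto.\<close>

definition gauss :: "real \<Rightarrow> 'a::euclidean_space \<Rightarrow> real" where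
  "gauss l x = exp (- (l * (norm x)\<^sup>2 / 2))"

lemma gauss_pos [simp]: "0 < gauss l x" "0 \<le> gauss l x"
  by (auto simp: gauss_def)

lemma gauss_le_1: "0 \<le> l \<Longrightarrow> gauss l x \<le> 1"
  by (simp add: gauss_def)

lemma borel_measurable_gauss [measurable]: "gauss l \<in> borel_measurable borel"
  unfolding gauss_def by measurable

lemma gauss_prod: "gauss l (x :: 'a::euclidean_space) = (\<Prod>b\<in>Basis. exp (- (l * (x \<bullet> b)\<^sup>2 / 2)))"
proof -
  have "(norm x)\<^sup>2 = (\<Sum>b\<in>Basis. (x \<bullet> b)\<^sup>2)"
    unfolding power2_norm_eq_inner euclidean_inner[of x x] by (simp add: power2_eq_square)
  then show ?thesis
    by (simp add: gauss_def exp_sum[symmetric] sum_distrib_left sum_negf sum_divide_distrib)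
qed

lemma borel_measurable_cis [measurable]: "cis \<in> borel_measurable borel"
  by (intro borel_measurable_continuous_onI continuous_intros)

text \<open>The characteristic function of the standard normal law, rescaled by
  \<open>s = sqrt l\<close>.\<close>

lemma fourier_gauss_real:
  fixes t :: real
  assumes "0 < l"
  shows "integrable lborel (\<lambda>x. exp (- (l * x\<^sup>2 / 2)))"
    and "(LINT x|lborel. cis (x * t) * of_real (exp (- (l * x\<^sup>2 / 2)))) =
         of_real (sqrt (2 * pi / l) * exp (- (t\<^sup>2 / (2 * l))))"
proof -
  define s where "s = sqrt l"
  have s: "0 < s" "s * s = l" using assms by (auto simp: s_def)
  have sl: "(s * x)\<^sup>2 = l * x\<^sup>2" for x using s by (simp add: power2_eq_square)
  have den: "std_normal_density x = exp (- (x\<^sup>2 / 2)) / sqrt (2 * pi)" for x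
    by (simp add: normal_density_def)
  have "integrable lborel (\<lambda>x. sqrt (2 * pi) * std_normal_density x)"
    by simp
  then have "integrable lborel (\<lambda>x::real. exp (- (x\<^sup>2 / 2)))"
    by (simp add: den)
  then have "integrable lborel (\<lambda>x::real. exp (- ((0 + s * x)\<^sup>2 / 2)))"
    by (rule lborel_integrable_real_affine) (use s in auto)
  then show "integrable lborel (\<lambda>x. exp (- (l * x\<^sup>2 / 2)))"
    by (simp add: sl)
  have "char std_normal_distribution (t / s) =
      (LINT x|lborel. std_normal_density x *\<^sub>R iexp (t / s * x))"
    unfolding char_def by (subst integral_density) auto
  also have "\<dots> = (LINT x|lborel. (1 / sqrt (2 * pi)) *\<^sub>R (cis (t / s * x) * of_real (exp (- (x\<^sup>2 / 2)))))"
    by (intro Bochner_Integration.integral_cong) (auto simp: den cis_conv_exp scaleR_conv_of_real)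
  also have "\<dots> = (1 / sqrt (2 * pi)) *\<^sub>R (LINT x|lborel. cis (t / s * x) * of_real (exp (- (x\<^sup>2 / 2))))"
    by simp
  also have "(LINT x|lborel. cis (t / s * x) * of_real (exp (- (x\<^sup>2 / 2)))) =
      s *\<^sub>R (LINT x|lborel. cis (t / s * (0 + s * x)) * of_real (exp (- ((0 + s * x)\<^sup>2 / 2))))"
    using s by (subst lborel_integral_real_affine[where c = s and t = 0]) auto
  also have "\<dots> = s *\<^sub>R (LINT x|lborel. cis (x * t) * of_real (exp (- (l * x\<^sup>2 / 2))))"
    using s by (simp add: sl mult.commute[of t])
  finally have "(LINT x|lborel. cis (x * t) * of_real (exp (- (l * x\<^sup>2 / 2)))) =
      (sqrt (2 * pi) / s) *\<^sub>R char std_normal_distribution (t / s)"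
    using s by simp
  also have "\<dots> = of_real (sqrt (2 * pi / l) * exp (- (t\<^sup>2 / (2 * l))))"
  proof -
    have "(t / s)\<^sup>2 = t\<^sup>2 / l" using s by (simp add: power2_eq_square)
    then show ?thesis
      by (simp add: char_std_normal_distribution s_def real_sqrt_divide scaleR_conv_of_real mult.commute)
  qed
  finally show "(LINT x|lborel. cis (x * t) * of_real (exp (- (l * x\<^sup>2 / 2)))) =
         of_real (sqrt (2 * pi / l) * exp (- (t\<^sup>2 / (2 * l))))" .
qed

text \<open>Lebesgue measure is the image of the product measure indexed by \<open>Basis\<close>
  under the coordinate map, so Fubini for finite products applies.\<close>

lemma integral_lborel_prod:
  fixes f :: "'a::euclidean_space \<Rightarrow> real \<Rightarrow> 'b::{real_normed_field,banach,second_countable_topology}"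
  assumes "\<And>b. b \<in> Basis \<Longrightarrow> integrable lborel (f b)"
  shows "integrable lborel (\<lambda>x::'a. \<Prod>b\<in>Basis. f b (x \<bullet> b))"
    and "(LINT x|lborel. (\<Prod>b\<in>Basis. f b ((x::'a) \<bullet> b))) = (\<Prod>b\<in>Basis. (LINT x|lborel. f b x))"
proof -
  interpret product_sigma_finite "\<lambda>_::'a. lborel :: real measure" ..
  have [measurable]: "f b \<in> borel_measurable borel" if "b \<in> Basis" for b
    using borel_measurable_integrable[OF assms[OF that]] by simp
  have M: "(\<lambda>g. \<Sum>b\<in>Basis. g b *\<^sub>R b) \<in> (\<Pi>\<^sub>M b\<in>(Basis::'a set). lborel) \<rightarrow>\<^sub>M borel"
    by measurable
  have F: "(\<lambda>x::'a. \<Prod>b\<in>Basis. f b (x \<bullet> b)) \<in> borel_measurable borel"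
    by measurable
  have *: "(\<Prod>b\<in>Basis. f b ((\<Sum>b\<in>Basis. g b *\<^sub>R b) \<bullet> b)) = (\<Prod>b\<in>Basis. f b (g b))" for g :: "'a \<Rightarrow> real"
    by (intro prod.cong) (auto simp: inner_sum_left inner_Basis if_distrib[of "\<lambda>x. _ * x"] sum.delta cong: if_cong)
  show "integrable lborel (\<lambda>x::'a. \<Prod>b\<in>Basis. f b (x \<bullet> b))"
    by (subst lborel_eq) (unfold integrable_distr_eq[OF M F] *, intro product_integrable_prod, use assms in auto)
  show "(LINT x|lborel. (\<Prod>b\<in>Basis. f b ((x::'a) \<bullet> b))) = (\<Prod>b\<in>Basis. (LINT x|lborel. f b x))"
    by (subst lborel_eq) (unfold integral_distr[OF M F] *, intro product_integral_prod, use assms in auto)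
qed

lemma integrable_gauss: "0 < l \<Longrightarrow> integrable lborel (gauss l :: 'a::euclidean_space \<Rightarrow> real)"
  unfolding gauss_prod[abs_def]
  by (rule integral_lborel_prod(1)[where f = "\<lambda>_ x. exp (- (l * x\<^sup>2 / 2))"]) (rule fourier_gauss_real(1))

text \<open>Character and Gaussian both factor over the basis, which reduces the claim to one
  dimension.\<close>

lemma fourier_gauss:
  fixes z :: "'a::euclidean_space"
  assumes "0 < l"
  shows "(LINT x|lborel. cis (x \<bullet> z) * of_real (gauss l x)) =
         of_real ((2 * pi / l) powr (DIM('a) / 2) * gauss (1 / l) z)"
proof -
  have i: "integrable lborel (\<lambda>x. cis (x * (z \<bullet> b)) * of_real (exp (- (l * x\<^sup>2 / 2))))" for b
    by (rule Bochner_Integration.integrable_bound[OF fourier_gauss_real(1)[OF assms]])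
       (auto simp: norm_mult)
  have c: "cis (x \<bullet> z) = (\<Prod>b\<in>Basis. cis ((x \<bullet> b) * (z \<bullet> b)))" for x
    unfolding euclidean_inner[of x z] cis_conv_exp of_real_sum sum_distrib_left
    by (rule exp_sum) simp
  have "(LINT x|lborel. cis (x \<bullet> z) * of_real (gauss l x)) =
      (LINT x|lborel. (\<Prod>b\<in>Basis. cis ((x \<bullet> b) * (z \<bullet> b)) * of_real (exp (- (l * (x \<bullet> b)\<^sup>2 / 2)))))"
    by (simp add: gauss_prod c prod.distrib)
  also have "\<dots> = (\<Prod>b\<in>Basis. of_real (sqrt (2 * pi / l) * exp (- ((z \<bullet> b)\<^sup>2 / (2 * l)))))"
    using integral_lborel_prod(2)[where f = "\<lambda>b x. cis (x * (z \<bullet> b)) * of_real (exp (- (l * x\<^sup>2 / 2)))", OF i]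
    by (simp only: fourier_gauss_real(2)[OF assms])
  also have "\<dots> = of_real (sqrt (2 * pi / l) ^ DIM('a) * (\<Prod>b\<in>Basis. exp (- ((z \<bullet> b)\<^sup>2 / (2 * l)))))"
    by (simp add: prod.distrib)
  also have "(\<Prod>b\<in>Basis. exp (- ((z \<bullet> b)\<^sup>2 / (2 * l)))) = gauss (1 / l) z"
    by (simp add: gauss_prod mult.commute)
  also have "sqrt (2 * pi / l) ^ DIM('a) = (2 * pi / l) powr (DIM('a) / 2)"
  proof -
    have p: "0 < 2 * pi / l" using assms by simp
    have "sqrt (2 * pi / l) ^ DIM('a) = ((2 * pi / l) powr (1 / 2)) ^ DIM('a)"
      using p by (simp only: powr_half_sqrt[OF less_imp_le])
    also have "\<dots> = (2 * pi / l) powr (DIM('a) * (1 / 2))"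
      by (rule powr_power) (use p in linarith)
    finally show ?thesis by simp
  qed
  finally show ?thesis .
qed

lemma nn_integral_gauss:
  assumes "0 < l"
  shows "(\<integral>\<^sup>+x. ennreal (gauss l (x::'a::euclidean_space)) \<partial>lborel) = ennreal ((2 * pi / l) powr (DIM('a) / 2))"
proof -
  have "complex_of_real (LINT x|lborel. gauss l (x::'a)) = of_real ((2 * pi / l) powr (DIM('a) / 2))"
    using fourier_gauss[OF assms, of "0::'a"] by (simp add: gauss_def)
  then have "(LINT x|lborel. gauss l (x::'a)) = (2 * pi / l) powr (DIM('a) / 2)"
    by (simp only: of_real_eq_iff)
  then show ?thesis
    using integrable_gauss[OF assms] by (subst nn_integral_eq_integral) auto
qed

lemma nn_integral_reflect:
  fixes x :: "'a::euclidean_space"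
  assumes [measurable]: "f \<in> borel_measurable borel"
  shows "(\<integral>\<^sup>+y. f (x - y) \<partial>lborel) = (\<integral>\<^sup>+y. f y \<partial>lborel)"
proof -
  have "(\<integral>\<^sup>+y. f y \<partial>lborel) = (\<integral>\<^sup>+y. f y \<partial>(density (distr lborel borel (\<lambda>y. x + (-1) *\<^sub>R y)) (\<lambda>_. ennreal (\<bar>-1\<bar>^DIM('a)))))"
    by (rule arg_cong[where f = "\<lambda>M. nn_integral M f", OF lborel_affine]) simp
  also have "\<dots> = (\<integral>\<^sup>+y. f (x - y) \<partial>lborel)"
    by (simp add: nn_integral_density nn_integral_distr)
  finally show ?thesis by simp
qed

lemma AE_reflect:
  assumes "AE x in lborel. P (x::'a::euclidean_space)"
  shows "AE x in lborel. P (- x)"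
proof -
  have d: "distr lborel borel (uminus::'a \<Rightarrow> 'a) = lborel"
    using lborel_affine[of "-1" "0::'a"] by (simp add: density_1 one_ennreal_def[symmetric])
  obtain N where N: "{x. \<not> P x} \<subseteq> N" "N \<in> null_sets lborel"
    using AE_E[OF assms] by (auto simp: null_sets_def)
  have "AE x in distr lborel borel (uminus::'a \<Rightarrow> 'a). x \<notin> N"
    unfolding d using N(2) by (rule AE_not_in)
  then have "AE x in lborel. - x \<notin> N"
    by (subst (asm) AE_distr_iff) (use N(2) in auto)
  then show ?thesis using N by (auto elim!: eventually_mono)
qed

section \<open>Fourier integrals with Gaussian weights\<close>

abbreviation ennsq :: "complex \<Rightarrow> ennreal" where
  "ennsq z \<equiv> ennreal ((norm z)\<^sup>2)"

abbreviation gauss_energy :: "real \<Rightarrow> ('a::euclidean_space \<Rightarrow> complex) \<Rightarrow> ennreal" where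
  "gauss_energy l F \<equiv> \<integral>\<^sup>+\<xi>. ennreal (gauss l \<xi>) * ennsq (F \<xi>) \<partial>lborel"

text \<open>The squared L^2 norm as an extended real. Unlike \<open>Lp_norm\<close>, whose Bochner
  integral is 0 for a non-integrable integrand, it is infinite outside L^2, so estimates of
  \<open>sqint\<close> also prove membership in \<open>Lp_space 2\<close>.\<close>

definition sqint :: "('a::euclidean_space \<Rightarrow> complex) \<Rightarrow> ennreal" where
  "sqint f = (\<integral>\<^sup>+x. ennsq (f x) \<partial>lborel)"

lemma Lp_space_2_iff: "f \<in> Lp_space 2 \<longleftrightarrow> f \<in> borel_measurable borel \<and> sqint f < \<infinity>"
  by (auto simp: Lp_space_def sqint_def integrable_iff_bounded)

lemma sqint_Lp_norm: "f \<in> Lp_space 2 \<Longrightarrow> sqint f = ennreal ((Lp_norm 2 f)\<^sup>2)"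
  unfolding sqint_def Lp_space_def Lp_norm_def
  by (auto simp: nn_integral_eq_integral powr_half_sqrt integral_nonneg_AE)

lemma Lp_norm_nonneg [simp]: "0 \<le> Lp_norm p f"
  by (simp add: Lp_norm_def)

lemma norm_add_square_le:
  fixes x y :: "'b::real_normed_vector"
  shows "(norm (x + y))\<^sup>2 \<le> 2 * (norm x)\<^sup>2 + 2 * (norm y)\<^sup>2"
proof -
  have "(norm (x + y))\<^sup>2 \<le> (norm x + norm y)\<^sup>2"
    by (intro power_mono norm_triangle_ineq) auto
  also have "\<dots> \<le> 2 * (norm x)\<^sup>2 + 2 * (norm y)\<^sup>2"
    using sum_squares_bound[of "norm x" "norm y"] by (simp add: power2_sum)
  finally show ?thesis .
qed

lemma weighted_sqint_add_le:
  assumes [measurable]: "f \<in> borel_measurable borel" "g \<in> borel_measurable borel" "w \<in> borel_measurable borel"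
  shows "(\<integral>\<^sup>+x. w x * ennsq (f x + g x :: complex) \<partial>lborel) \<le>
    2 * (\<integral>\<^sup>+x. w x * ennsq (f x) \<partial>lborel) + 2 * (\<integral>\<^sup>+x. w x * ennsq (g x) \<partial>lborel)"
proof -
  have *: "ennsq (f x + g x) \<le> 2 * ennsq (f x) + 2 * ennsq (g x)" for x
    using ennreal_leI[OF norm_add_square_le[of "f x" "g x"]]
    by (simp add: ennreal_plus ennreal_mult')
  have "(\<integral>\<^sup>+x. w x * ennsq (f x + g x) \<partial>lborel) \<le>
      (\<integral>\<^sup>+x. 2 * (w x * ennsq (f x)) + 2 * (w x * ennsq (g x)) \<partial>lborel)"
  proof (rule nn_integral_mono)
    fix x show "w x * ennsq (f x + g x) \<le>
      2 * (w x * ennsq (f x)) + 2 * (w x * ennsq (g x))"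
      using mult_left_mono[OF *[of x], of "w x"] by (simp add: distrib_left mult.left_commute)
  qed
  then show ?thesis by (simp add: nn_integral_add nn_integral_cmult)
qed

lemma sqint_add_le:
  assumes [measurable]: "f \<in> borel_measurable borel" "g \<in> borel_measurable borel"
  shows "sqint (\<lambda>x. f x + g x) \<le> 2 * sqint f + 2 * sqint g"
  using weighted_sqint_add_le[OF assms, of "\<lambda>_. 1"] by (simp add: sqint_def)

lemma sqint_diff_commute: "sqint (\<lambda>x. f x - g x) = sqint (\<lambda>x. g x - f x)"
  by (simp add: sqint_def norm_minus_commute)

lemma sqint_triangle:
  assumes [measurable]: "f \<in> borel_measurable borel" "g \<in> borel_measurable borel" "h \<in> borel_measurable borel"
  shows "sqint (\<lambda>x. f x - h x) \<le> 2 * sqint (\<lambda>x. f x - g x) + 2 * sqint (\<lambda>x. g x - h x)"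
  using sqint_add_le[of "\<lambda>x. f x - g x" "\<lambda>x. g x - h x"] by simp

lemma sqint_mono:
  "(\<And>x. norm (f x) \<le> norm (g x)) \<Longrightarrow> sqint f \<le> sqint g"
  unfolding sqint_def by (intro nn_integral_mono ennreal_leI power_mono) auto

lemma sqint_uminus_arg:
  assumes [measurable]: "f \<in> borel_measurable borel"
  shows "sqint (\<lambda>x. f (- x)) = sqint f"
  unfolding sqint_def
  using nn_integral_reflect[of "\<lambda>x. ennsq (f x)" 0] by simp

lemma sqint_0_iff:
  assumes [measurable]: "f \<in> borel_measurable borel"
  shows "sqint f = 0 \<longleftrightarrow> (AE x in lborel. f x = 0)"
  unfolding sqint_def by (subst nn_integral_0_iff_AE) auto

definition fourier_integral :: "('a::euclidean_space \<Rightarrow> complex) \<Rightarrow> 'a \<Rightarrow> complex" where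
  "fourier_integral g \<xi> = (LINT x|lborel. cis (- (x \<bullet> \<xi>)) * g x)"

lemma integrable_cis_mult:
  assumes "integrable lborel g" "h \<in> borel_measurable borel"
  shows "integrable lborel (\<lambda>x. cis (h x) * g x)"
proof -
  have [measurable]: "g \<in> borel_measurable borel" "h \<in> borel_measurable borel"
    using assms borel_measurable_integrable[OF assms(1)] by auto
  show ?thesis
    by (rule Bochner_Integration.integrable_bound[OF assms(1)]) (auto simp: norm_mult)
qed

lemma borel_measurable_fourier_integral [measurable]:
  assumes [measurable]: "g \<in> borel_measurable borel"
  shows "fourier_integral g \<in> borel_measurable borel"
  unfolding fourier_integral_def[abs_def] by measurable

lemma fourier_integral_add:
  assumes "integrable lborel g" "integrable lborel h"
  shows "fourier_integral (\<lambda>x. g x + h x) \<xi> = fourier_integral g \<xi> + fourier_integral h \<xi>"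
  unfolding fourier_integral_def distrib_left
  by (intro Bochner_Integration.integral_add integrable_cis_mult assms) auto

lemma norm_fourier_integral_le:
  assumes "integrable lborel g"
  shows "norm (fourier_integral g \<xi>) \<le> (LINT x|lborel. norm (g x))"
  unfolding fourier_integral_def
  by (rule order_trans[OF integral_norm_bound]) (simp add: norm_mult)

text \<open>Both sides are the double integral of the symmetric kernel
  \<open>cis (- (y \<bullet> x))\<close> against \<open>g\<close> and \<open>h\<close>. The kernel
  has modulus one, so integrability of \<open>g\<close> and \<open>h\<close> justifies
  Fubini.\<close>

lemma fourier_multiplication:
  assumes g: "integrable lborel g" and h: "integrable lborel h"
  shows "(LINT x|lborel. fourier_integral g x * h x) = (LINT x|lborel. g x * fourier_integral h x)"
proof -
  have [measurable]: "g \<in> borel_measurable borel" "h \<in> borel_measurable borel"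
    using g h borel_measurable_integrable by auto

  have int: "integrable (lborel \<Otimes>\<^sub>M lborel) (\<lambda>(x, y). cis (- (y \<bullet> x)) * g y * h x)"
  proof (rule lborel_pair.Fubini_integrable)
    show "(\<lambda>(x, y). cis (- (y \<bullet> x)) * g y * h x) \<in> borel_measurable (lborel \<Otimes>\<^sub>M lborel)"
      by measurable
    show "integrable lborel (\<lambda>x. LINT y|lborel. norm (case (x, y) of (x, y) \<Rightarrow> cis (- (y \<bullet> x)) * g y * h x))"
      using h by (simp add: norm_mult)
    show "AE x in lborel. integrable lborel (\<lambda>y. case (x, y) of (x, y) \<Rightarrow> cis (- (y \<bullet> x)) * g y * h x)"
      using integrable_cis_mult[OF g] by simp
  qed
  have "(LINT x|lborel. fourier_integral g x * h x) = (LINT x|lborel. (LINT y|lborel. cis (- (y \<bullet> x)) * g y * h x))"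
    by (simp add: fourier_integral_def)
  also have "\<dots> = (LINT y|lborel. (LINT x|lborel. cis (- (y \<bullet> x)) * g y * h x))"
    using lborel_pair.Fubini_integral[OF int] by simp
  also have "\<dots> = (LINT y|lborel. g y * fourier_integral h y)"
  proof (rule Bochner_Integration.integral_cong)
    fix y
    have "(LINT x|lborel. cis (- (y \<bullet> x)) * g y * h x) = (LINT x|lborel. g y * (cis (- (x \<bullet> y)) * h x))"
      by (intro Bochner_Integration.integral_cong) (auto simp: inner_commute mult_ac)
    then show "(LINT x|lborel. cis (- (y \<bullet> x)) * g y * h x) = g y * fourier_integral h y"
      by (simp add: fourier_integral_def)
  qed simp
  finally show ?thesis .
qed

lemma integrable_gauss_mult:
  assumes "0 < l" "f \<in> borel_measurable borel" "\<And>x. norm (f x) \<le> B"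
  shows "integrable lborel (\<lambda>x::'a::euclidean_space. complex_of_real (gauss l x) * f x)"
proof -
  have [measurable]: "f \<in> borel_measurable borel" by fact
  have "0 \<le> B" using assms(3)[of 0] norm_ge_zero order_trans by blast
  then show ?thesis
    by (intro Bochner_Integration.integrable_bound[OF integrable_mult_right[OF integrable_gauss[OF assms(1)], of B]])
       (auto simp: norm_mult assms mult.commute mult_right_mono)
qed

text \<open>The multiplication formula is applied to \<open>g\<close> and the modulated Gaussian
  \<open>cis (x \<bullet> \<xi>) * gauss l \<xi>\<close>, whose transform is a Gaussian centred at
  \<open>x\<close>. As l tends to 0 the kernel on the right is (2 pi)^n times an approximate
  identity.\<close>

lemma gauss_fourier_inversion:
  fixes g :: "'a::euclidean_space \<Rightarrow> complex"
  assumes "0 < l" "integrable lborel g"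
  shows "fourier_integral (\<lambda>\<xi>. of_real (gauss l \<xi>) * fourier_integral g \<xi>) (- x) =
    (LINT y|lborel. g y * of_real ((2 * pi / l) powr (DIM('a) / 2) * gauss (1 / l) (x - y)))"
proof -
  have h: "integrable lborel (\<lambda>\<xi>. cis (x \<bullet> \<xi>) * complex_of_real (gauss l \<xi>))"
    using assms(1) by (intro integrable_cis_mult integrable_of_real integrable_gauss) auto
  have "fourier_integral (\<lambda>\<xi>. cis (x \<bullet> \<xi>) * complex_of_real (gauss l \<xi>)) y =
      of_real ((2 * pi / l) powr (DIM('a) / 2) * gauss (1 / l) (x - y))" for y
    unfolding fourier_gauss[OF assms(1), symmetric] fourier_integral_def
    by (intro Bochner_Integration.integral_cong)
       (auto simp: inner_diff_right inner_commute cis_mult mult.assoc[symmetric])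
  then have "(LINT y|lborel. g y * of_real ((2 * pi / l) powr (DIM('a) / 2) * gauss (1 / l) (x - y))) =
      (LINT \<xi>|lborel. fourier_integral g \<xi> * (cis (x \<bullet> \<xi>) * of_real (gauss l \<xi>)))"
    by (simp only: fourier_multiplication[OF assms(2) h])
  then show ?thesis
    by (simp add: fourier_integral_def[of _ "- x"] inner_commute mult_ac)
qed

lemma norm_integral_le_nn_integral:
  fixes f :: "'b \<Rightarrow> 'c::{banach, second_countable_topology}"
  shows "ennreal (norm (integral\<^sup>L M f)) \<le> (\<integral>\<^sup>+x. ennreal (norm (f x)) \<partial>M)"
  by (cases "integrable M f") (auto simp: integral_norm_bound_ennreal not_integrable_integral_eq)

lemma borel_measurable_cnj [measurable]: "cnj \<in> borel_measurable borel"
  by (intro borel_measurable_continuous_onI continuous_intros)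

text \<open>The weighted energy is the integral of the transform of \<open>g\<close> against
  \<open>k\<close>, the weight times its conjugate. The multiplication formula moves the transform
  from \<open>g\<close> to \<open>k\<close>, where Gaussian inversion gives the conjugate of
  \<open>g\<close> convolved with a positive kernel. Only now are absolute values taken; the
  oscillation has already been used.\<close>

lemma gauss_fourier_square_le:
  fixes g :: "'a::euclidean_space \<Rightarrow> complex"
  assumes l: "0 < l" and g: "integrable lborel g"
  shows "(\<integral>\<^sup>+\<xi>. ennreal (gauss l \<xi>) * ennsq (fourier_integral g \<xi>) \<partial>lborel) \<le>
    ennreal ((2 * pi / l) powr (DIM('a) / 2)) *
      (\<integral>\<^sup>+x. \<integral>\<^sup>+y. ennreal (norm (g x) * norm (g y) * gauss (1 / l) (x - y)) \<partial>lborel \<partial>lborel)"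
proof -
  have [measurable]: "g \<in> borel_measurable borel"
    using g borel_measurable_integrable by auto
  define K where "K = (2 * pi / l) powr (DIM('a) / 2)"
  have K: "0 \<le> K" by (simp add: K_def)
  define k where "k \<xi> = of_real (gauss l \<xi>) * cnj (fourier_integral g \<xi>)" for \<xi>
  have k: "integrable lborel k"
    unfolding k_def using norm_fourier_integral_le[OF g] l
    by (intro integrable_gauss_mult) auto
  have "fourier_integral k x = cnj (LINT y|lborel. g y * of_real (K * gauss (1 / l) (x - y)))" for x
    unfolding K_def gauss_fourier_inversion[OF l g, symmetric] fourier_integral_def[of _ "- x"] fourier_integral_def[of k]
    by (subst Bochner_Integration.integral_cnj[symmetric]) (simp add: k_def cis_cnj)
  then have nk: "ennreal (norm (fourier_integral k x)) \<le> (\<integral>\<^sup>+y. ennreal (K * (norm (g y) * gauss (1 / l) (x - y))) \<partial>lborel)" for x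
    using norm_integral_le_nn_integral[of lborel "\<lambda>y. g y * of_real (K * gauss (1 / l) (x - y))"] K
    by (simp add: norm_mult mult_ac)
  have "integrable lborel (\<lambda>\<xi>. fourier_integral g \<xi> * k \<xi>)"
  proof -
    have "integrable lborel (\<lambda>\<xi>. of_real (gauss l \<xi>) * (fourier_integral g \<xi> * cnj (fourier_integral g \<xi>)))"
      using l mult_mono'[OF norm_fourier_integral_le[OF g] norm_fourier_integral_le[OF g]]
      by (intro integrable_gauss_mult) (auto simp: norm_mult)
    then show ?thesis by (simp add: k_def mult_ac)
  qed
  moreover have eq: "fourier_integral g \<xi> * k \<xi> = of_real (gauss l \<xi> * (norm (fourier_integral g \<xi>))\<^sup>2)" for \<xi>
    unfolding of_real_mult complex_norm_square k_def by (simp add: mult_ac)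
  ultimately have int: "integrable lborel (\<lambda>\<xi>. gauss l \<xi> * (norm (fourier_integral g \<xi>))\<^sup>2)"
    using integrable_norm[of lborel "\<lambda>\<xi>. fourier_integral g \<xi> * k \<xi>"] by (simp add: norm_mult abs_mult norm_power)
  have "(\<integral>\<^sup>+\<xi>. ennreal (gauss l \<xi>) * ennsq (fourier_integral g \<xi>) \<partial>lborel) =
      ennreal (LINT \<xi>|lborel. gauss l \<xi> * (norm (fourier_integral g \<xi>))\<^sup>2)"
    using int by (simp add: nn_integral_eq_integral ennreal_mult'[symmetric])
  also have "(LINT \<xi>|lborel. gauss l \<xi> * (norm (fourier_integral g \<xi>))\<^sup>2) =
      norm (LINT \<xi>|lborel. fourier_integral g \<xi> * k \<xi>)"
    unfolding eq integral_complex_of_real norm_of_real by (subst abs_of_nonneg) (auto intro!: integral_nonneg_AE)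
  also have "(LINT \<xi>|lborel. fourier_integral g \<xi> * k \<xi>) = (LINT x|lborel. g x * fourier_integral k x)"
    by (rule fourier_multiplication[OF g k])
  also have "ennreal (norm (LINT x|lborel. g x * fourier_integral k x)) \<le>
      (\<integral>\<^sup>+x. ennreal (norm (g x * fourier_integral k x)) \<partial>lborel)"
    by (rule norm_integral_le_nn_integral)
  also have "\<dots> \<le> (\<integral>\<^sup>+x. ennreal K * (\<integral>\<^sup>+y. ennreal (norm (g x) * norm (g y) * gauss (1 / l) (x - y)) \<partial>lborel) \<partial>lborel)"
  proof (rule nn_integral_mono)
    fix x
    have "ennreal (norm (g x * fourier_integral k x)) = ennreal (norm (g x)) * ennreal (norm (fourier_integral k x))"
      by (simp add: norm_mult ennreal_mult')
    also have "\<dots> \<le> ennreal (norm (g x)) * (\<integral>\<^sup>+y. ennreal (K * (norm (g y) * gauss (1 / l) (x - y))) \<partial>lborel)"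
      by (intro mult_left_mono nk) auto
    also have "\<dots> = (\<integral>\<^sup>+y. ennreal (norm (g x)) * ennreal (K * (norm (g y) * gauss (1 / l) (x - y))) \<partial>lborel)"
      by (subst nn_integral_cmult) auto
    also have "\<dots> = (\<integral>\<^sup>+y. ennreal K * ennreal (norm (g x) * norm (g y) * gauss (1 / l) (x - y)) \<partial>lborel)"
      using K by (intro nn_integral_cong) (simp add: ennreal_mult'[symmetric] mult_ac)
    also have "\<dots> = ennreal K * (\<integral>\<^sup>+y. ennreal (norm (g x) * norm (g y) * gauss (1 / l) (x - y)) \<partial>lborel)"
      by (subst nn_integral_cmult) auto
    finally show "ennreal (norm (g x * fourier_integral k x)) \<le>
      ennreal K * (\<integral>\<^sup>+y. ennreal (norm (g x) * norm (g y) * gauss (1 / l) (x - y)) \<partial>lborel)" .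
  qed
  also have "\<dots> = ennreal K * (\<integral>\<^sup>+x. \<integral>\<^sup>+y. ennreal (norm (g x) * norm (g y) * gauss (1 / l) (x - y)) \<partial>lborel \<partial>lborel)"
    by (subst nn_integral_cmult) auto
  finally show ?thesis by (simp add: K_def)
qed

text \<open>The two-term inequality is applied to \<open>p\<close> and the geometric mean of
  \<open>q\<close> and \<open>s\<close>, with weights \<alpha> and 2 \<beta>, and then to that
  mean.\<close>

lemma young_three_le:
  fixes p q s :: real
  assumes "0 \<le> \<alpha>" "0 \<le> \<beta>" "\<alpha> + 2 * \<beta> = 1" "0 < p" "0 < q" "0 < s"
  shows "p powr \<alpha> * (q powr \<beta> * s powr \<beta>) \<le> \<alpha> * p + \<beta> * q + \<beta> * s"
proof -
  have "q powr \<beta> * s powr \<beta> = (q powr (1/2) * s powr (1/2)) powr (2 * \<beta>)"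
    using assms by (simp add: powr_mult powr_powr)
  then have "p powr \<alpha> * (q powr \<beta> * s powr \<beta>) \<le> \<alpha> * p + 2 * \<beta> * (q powr (1/2) * s powr (1/2))"
    using Youngs_inequality_0[of \<alpha> "2 * \<beta>" p "q powr (1/2) * s powr (1/2)"] assms by simp
  also have "\<dots> \<le> \<alpha> * p + 2 * \<beta> * ((1/2) * q + (1/2) * s)"
    using assms by (intro add_left_mono mult_left_mono Youngs_inequality_0) auto
  finally show ?thesis by (simp add: algebra_simps)
qed

text \<open>Young's convolution inequality \<open>L\<^sup>m * L\<^sup>r \<subseteq> L\<^sup>m\<^sup>'\<close> paired with \<open>L\<^sup>m\<close>: the integrand is, after
  normalisation, a weighted geometric mean of \<open>h\<^sup>m(x) h\<^sup>m(y)\<close>, \<open>h\<^sup>m(x) w\<^sup>r\<close> and \<open>h\<^sup>m(y) w\<^sup>r\<close>.\<close>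

lemma gauss_convolution_le:
  fixes h :: "'a::euclidean_space \<Rightarrow> real" and l m A :: real
  assumes [measurable]: "h \<in> borel_measurable borel" and h: "\<And>x. 0 \<le> h x"
    and l: "0 < l" and m: "1 < m" "m \<le> 2" and A: "0 < A"
    and hA: "(\<integral>\<^sup>+x. ennreal (h x powr m) \<partial>lborel) \<le> ennreal A"
  shows "(\<integral>\<^sup>+x. \<integral>\<^sup>+y. ennreal (h x * h y * gauss l (x - y)) \<partial>lborel \<partial>lborel) \<le>
    ennreal ((4 * pi * (m - 1) / (l * m)) powr (DIM('a) * (m - 1) / m) * A powr (2 / m))"
proof -
  \<comment> \<open>The exponents are forced: \<beta> is the reciprocal of the conjugate exponent of
    m, each factor \<open>h\<close> must occur to the power m (\<alpha> + \<beta>) = 1 and the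
    Gaussian to the power 2 \<beta> r = 1. The condition m <= 2 is what makes \<alpha> nonnegative.
    \<open>D\<close> normalises: the three terms integrate to at most \<alpha>, \<beta> and \<beta>,
    whose sum is 1.\<close>
  define \<beta> where "\<beta> = (m - 1) / m"
  define \<alpha> where "\<alpha> = 1 - 2 * \<beta>"
  define r where "r = 1 / (2 * \<beta>)"
  define B where "B = (2 * pi / (l * r)) powr (DIM('a) / 2)"
  define D where "D = A powr (2 / m) * B powr (2 * \<beta>)"
  have \<beta>: "0 < \<beta>" using m by (simp add: \<beta>_def)
  have \<alpha>: "0 \<le> \<alpha>" using m by (simp add: \<alpha>_def \<beta>_def field_simps)
  have r: "0 < r" "2 * \<beta> * r = 1" "r * \<beta> = 1 / 2" using \<beta> by (auto simp: r_def)
  have \<alpha>\<beta>: "m * (\<alpha> + \<beta>) = 1" "\<alpha> + \<beta> = 1 / m" using m by (auto simp: \<alpha>_def \<beta>_def field_simps)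
  have B: "0 < B" using l r by (simp add: B_def)
  have D: "0 < D" using A B by (simp add: D_def)
  have gB: "(\<integral>\<^sup>+y. ennreal (gauss (l * r) (x - y)) \<partial>lborel) = ennreal B" for x :: 'a
    using nn_integral_reflect[of "\<lambda>y. ennreal (gauss (l * r) y)" x] nn_integral_gauss[of "l * r", where 'a='a] l r
    by (simp add: B_def)
  have gB': "(\<integral>\<^sup>+x. ennreal (gauss (l * r) (x - y)) \<partial>lborel) = ennreal B" for y :: 'a
    using gB[of y] by (simp add: gauss_def norm_minus_commute)
  define H where "H x = ennreal (h x powr m)" for x
  define W where "W x = ennreal (gauss (l * r) x)" for x :: 'a
  have [measurable]: "H \<in> borel_measurable borel" "W \<in> borel_measurable borel"
    by (auto simp: H_def[abs_def] W_def[abs_def])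
  have pw: "h x * h y * gauss l z \<le> D * (\<alpha> / A\<^sup>2 * (h x powr m * h y powr m) +
      \<beta> / (A * B) * (h x powr m * gauss (l * r) z) + \<beta> / (A * B) * (h y powr m * gauss (l * r) z))" for x y z
  proof (cases "h x = 0 \<or> h y = 0")
    case True
    then show ?thesis using \<alpha> \<beta> A B D h by auto
  next
    case False
    define u v w where "u = h x" and "v = h y" and "w = gauss l z"
    have uvw: "0 < u" "0 < v" "0 < w" using False h[of x] h[of y] by (auto simp: u_def v_def w_def)
    have wr: "gauss (l * r) z = w powr r"
      by (simp add: w_def gauss_def powr_def algebra_simps)
    define p q s where "p = u powr m * v powr m / A\<^sup>2" and "q = u powr m * w powr r / (A * B)"
      and "s = v powr m * w powr r / (A * B)"
    have "0 < p" "0 < q" "0 < s" using uvw A B by (auto simp: p_def q_def s_def)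
    then have 1: "p powr \<alpha> * (q powr \<beta> * s powr \<beta>) \<le> \<alpha> * p + \<beta> * q + \<beta> * s"
      using \<alpha> \<beta> by (intro young_three_le) (auto simp: \<alpha>_def)
    have lnD: "ln D = 2 / m * ln A + 2 * \<beta> * ln B"
      using A B by (simp add: D_def ln_mult ln_powr)
    \<comment> \<open>The weighted geometric mean is the integrand divided by \<open>D\<close>; with
      logarithms this becomes a linear identity in the exponents.\<close>
    have "ln (p powr \<alpha> * (q powr \<beta> * s powr \<beta>)) =
        \<alpha> * (m * ln u + m * ln v - 2 * ln A) + (\<beta> * (m * ln u + r * ln w - (ln A + ln B)) +
        \<beta> * (m * ln v + r * ln w - (ln A + ln B)))"
      using uvw A B \<open>0 < p\<close> \<open>0 < q\<close> \<open>0 < s\<close>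
      by (simp add: ln_mult ln_powr p_def q_def s_def ln_div ln_realpow)
    also have "\<dots> = (m * (\<alpha> + \<beta>)) * ln u + (m * (\<alpha> + \<beta>)) * ln v + (2 * \<beta> * r) * ln w - 2 * (\<alpha> + \<beta>) * ln A - 2 * \<beta> * ln B"
      by (simp add: algebra_simps)
    also have "\<dots> = ln u + ln v + ln w - ln D"
      unfolding r \<alpha>\<beta> lnD using m by simp
    also have "\<dots> = ln (u * v * w / D)"
      using uvw D by (simp add: ln_mult ln_div)
    finally have "p powr \<alpha> * (q powr \<beta> * s powr \<beta>) = u * v * w / D"
      using uvw D \<open>0 < p\<close> \<open>0 < q\<close> \<open>0 < s\<close> by (subst (asm) ln_inj_iff) auto
    with 1 D have "u * v * w \<le> D * (\<alpha> * p + \<beta> * q + \<beta> * s)"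
      by (simp add: field_simps)
    then show ?thesis by (simp add: u_def v_def w_def p_def q_def s_def wr[unfolded w_def])
  qed
  have E: "ennreal (D * (a * (x * y) + b * (x * w) + b * (y * w))) = ennreal D * (ennreal a * (ennreal x * ennreal y) +
      ennreal b * (ennreal x * ennreal w) + ennreal b * (ennreal y * ennreal w))"
    if "0 \<le> a" "0 \<le> b" "0 \<le> x" "0 \<le> y" "0 \<le> w" for a b x y w
    using that D by (simp add: ennreal_mult ennreal_plus)
  have "(\<integral>\<^sup>+x. \<integral>\<^sup>+y. ennreal (h x * h y * gauss l (x - y)) \<partial>lborel \<partial>lborel) \<le>
      (\<integral>\<^sup>+x. \<integral>\<^sup>+y. ennreal D * (ennreal (\<alpha> / A\<^sup>2) * (H x * H y) + ennreal (\<beta> / (A * B)) * (H x * W (x - y)) +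
        ennreal (\<beta> / (A * B)) * (H y * W (x - y))) \<partial>lborel \<partial>lborel)"
  proof (intro nn_integral_mono)
    fix x y
    show "ennreal (h x * h y * gauss l (x - y)) \<le> ennreal D * (ennreal (\<alpha> / A\<^sup>2) * (H x * H y) +
        ennreal (\<beta> / (A * B)) * (H x * W (x - y)) + ennreal (\<beta> / (A * B)) * (H y * W (x - y)))"
      unfolding H_def W_def by (subst E[symmetric]) (use pw[of x y "x - y"] D \<alpha> \<beta> A B in \<open>auto intro!: ennreal_leI\<close>)
  qed
  also have "\<dots> = ennreal D * (ennreal (\<alpha> / A\<^sup>2) * (\<integral>\<^sup>+x. \<integral>\<^sup>+y. H x * H y \<partial>lborel \<partial>lborel) +
      ennreal (\<beta> / (A * B)) * (\<integral>\<^sup>+x. \<integral>\<^sup>+y. H x * W (x - y) \<partial>lborel \<partial>lborel) +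
      ennreal (\<beta> / (A * B)) * (\<integral>\<^sup>+x. \<integral>\<^sup>+y. H y * W (x - y) \<partial>lborel \<partial>lborel))"
    by (simp add: nn_integral_add nn_integral_cmult)
  also have "(\<integral>\<^sup>+x. \<integral>\<^sup>+y. H x * H y \<partial>lborel \<partial>lborel) = (\<integral>\<^sup>+x. H x \<partial>lborel) * (\<integral>\<^sup>+x. H x \<partial>lborel)"
    by (simp add: nn_integral_cmult nn_integral_multc)
  also have "(\<integral>\<^sup>+x. \<integral>\<^sup>+y. H x * W (x - y) \<partial>lborel \<partial>lborel) = (\<integral>\<^sup>+x. H x \<partial>lborel) * ennreal B"
    using gB by (simp add: nn_integral_cmult nn_integral_multc W_def)
  also have "(\<integral>\<^sup>+x. \<integral>\<^sup>+y. H y * W (x - y) \<partial>lborel \<partial>lborel) = (\<integral>\<^sup>+y. \<integral>\<^sup>+x. H y * W (x - y) \<partial>lborel \<partial>lborel)"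
    by (rule lborel_pair.Fubini') measurable
  also have "\<dots> = (\<integral>\<^sup>+x. H x \<partial>lborel) * ennreal B"
    using gB' by (simp add: nn_integral_cmult nn_integral_multc W_def)
  also have "ennreal D * (ennreal (\<alpha> / A\<^sup>2) * ((\<integral>\<^sup>+x. H x \<partial>lborel) * (\<integral>\<^sup>+x. H x \<partial>lborel)) +
      ennreal (\<beta> / (A * B)) * ((\<integral>\<^sup>+x. H x \<partial>lborel) * ennreal B) +
      ennreal (\<beta> / (A * B)) * ((\<integral>\<^sup>+x. H x \<partial>lborel) * ennreal B)) \<le>
      ennreal D * (ennreal (\<alpha> / A\<^sup>2) * (ennreal A * ennreal A) +
      ennreal (\<beta> / (A * B)) * (ennreal A * ennreal B) + ennreal (\<beta> / (A * B)) * (ennreal A * ennreal B))"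
    using hA by (intro mult_left_mono add_mono mult_mono mult_right_mono) (auto simp: H_def)
  also have "\<dots> = ennreal (D * (\<alpha> / A\<^sup>2 * (A * A) + \<beta> / (A * B) * (A * B) + \<beta> / (A * B) * (A * B)))"
    by (rule E[symmetric]) (use \<alpha> \<beta> A B in auto)
  also have "\<alpha> / A\<^sup>2 * (A * A) + \<beta> / (A * B) * (A * B) + \<beta> / (A * B) * (A * B) = 1"
    using A B by (simp add: power2_eq_square \<alpha>_def)
  also have "D * 1 = (4 * pi * (m - 1) / (l * m)) powr (DIM('a) * (m - 1) / m) * A powr (2 / m)"
  proof -
    have "2 * pi / (l * r) = 4 * pi * (m - 1) / (l * m)"
      using m l by (simp add: r_def \<beta>_def field_simps)
    moreover have "DIM('a) / 2 * (2 * \<beta>) = DIM('a) * (m - 1) / m"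
      using m by (simp add: \<beta>_def field_simps)
    ultimately show ?thesis by (simp only: D_def B_def powr_powr mult_1_right mult.commute)
  qed
  finally show ?thesis .
qed

section \<open>The Fourier transform on \<open>L\<^sup>2\<close>\<close>

lemma fatou_le:
  assumes [measurable]: "\<And>k. f k \<in> borel_measurable M"
    and lim: "AE x in M. (\<lambda>k. f k x) \<longlonglongrightarrow> (g x :: ennreal)"
    and le: "eventually (\<lambda>k. (\<integral>\<^sup>+x. f k x \<partial>M) \<le> C) sequentially"
  shows "(\<integral>\<^sup>+x. g x \<partial>M) \<le> C"
proof -
  have "(\<integral>\<^sup>+x. g x \<partial>M) = (\<integral>\<^sup>+x. liminf (\<lambda>k. f k x) \<partial>M)"
    using lim by (intro nn_integral_cong_AE) (auto elim!: eventually_mono dest: lim_imp_Liminf[rotated])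
  also have "\<dots> \<le> liminf (\<lambda>k. \<integral>\<^sup>+x. f k x \<partial>M)"
    by (rule nn_integral_liminf) measurable
  also have "\<dots> \<le> limsup (\<lambda>k. \<integral>\<^sup>+x. f k x \<partial>M)"
    by (rule Liminf_le_Limsup) simp
  also have "\<dots> \<le> C"
    using le by (rule Limsup_bounded)
  finally show ?thesis .
qed

definition unitary_const :: "'a::euclidean_space itself \<Rightarrow> real" where
  "unitary_const _ = (2 * pi) powr (- real DIM('a) / 2)"

text \<open>A Gaussian weight is inserted and removed by Fatou as it flattens to 1. For m = 2 the
  powers of l cancel in the two Gaussian bounds and leave (2 pi)^n, so this half of Plancherel comes
  with the sharp constant 1.\<close>

lemma bessel_fourier_integral:
  fixes g :: "'a::euclidean_space \<Rightarrow> complex"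
  assumes g: "integrable lborel g"
  shows "sqint (\<lambda>\<xi>. unitary_const TYPE('a) *\<^sub>R fourier_integral g \<xi>) \<le> sqint g"
proof (cases "sqint g = \<infinity>")
  case False
  have [measurable]: "g \<in> borel_measurable borel"
    using g borel_measurable_integrable by auto
  have 1: "(\<integral>\<^sup>+\<xi>. ennsq (fourier_integral g \<xi>) \<partial>lborel) \<le> ennreal ((2 * pi) powr DIM('a) * A)"
    if A: "sqint g \<le> ennreal A" "0 < A" for A
  proof (rule fatou_le)
    have "(\<lambda>k. gauss (1 / real (Suc k)) \<xi>) \<longlonglongrightarrow> exp (- (0 * (norm \<xi>)\<^sup>2 / 2))" for \<xi> :: 'a
      unfolding gauss_def by (intro tendsto_intros LIMSEQ_Suc[OF lim_1_over_n]) auto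
    then show "AE \<xi> in lborel. (\<lambda>k. ennreal (gauss (1 / real (Suc k)) \<xi> * (norm (fourier_integral g \<xi>))\<^sup>2)) \<longlonglongrightarrow>
        ennsq (fourier_integral g \<xi>)"
      by (intro AE_I2 tendsto_ennrealI) (auto intro!: tendsto_eq_intros)
    show "\<forall>\<^sub>F k in sequentially. (\<integral>\<^sup>+\<xi>. ennreal (gauss (1 / real (Suc k)) \<xi> * (norm (fourier_integral g \<xi>))\<^sup>2) \<partial>lborel) \<le>
        ennreal ((2 * pi) powr DIM('a) * A)"
    proof (intro always_eventually allI)
      fix k
      define l where "l = 1 / real (Suc k)"
      have l: "0 < l" by (simp add: l_def)
      have "(\<integral>\<^sup>+\<xi>. ennreal (gauss l \<xi> * (norm (fourier_integral g \<xi>))\<^sup>2) \<partial>lborel) \<le>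
        ennreal ((2 * pi / l) powr (DIM('a) / 2)) *
          (\<integral>\<^sup>+x. \<integral>\<^sup>+y. ennreal (norm (g x) * norm (g y) * gauss (1 / l) (x - y)) \<partial>lborel \<partial>lborel)"
        using gauss_fourier_square_le[OF l g] by (simp add: ennreal_mult')
      also have "\<dots> \<le> ennreal ((2 * pi / l) powr (DIM('a) / 2)) *
          ennreal ((4 * pi * (2 - 1) / (1 / l * 2)) powr (real DIM('a) * (2 - 1) / 2) * A powr (2 / 2))"
        using A l by (intro mult_left_mono gauss_convolution_le[where h = "\<lambda>x. norm (g x)"]) (simp_all add: sqint_def)
      also have "\<dots> = ennreal ((2 * pi) powr DIM('a) * A)"
      proof -
        have "(2 * pi / l) powr (DIM('a) / 2) * (4 * pi * (2 - 1) / (1 / l * 2)) powr (real DIM('a) * (2 - 1) / 2) =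
            ((2 * pi / l) * (2 * pi * l)) powr (DIM('a) / 2)"
          using l by (subst powr_mult) (auto simp: mult.assoc)
        also have "(2 * pi / l) * (2 * pi * l) = (2 * pi) powr 2"
          using l by (simp add: power2_eq_square)
        also have "((2 * pi) powr 2) powr (DIM('a) / 2) = (2 * pi) powr DIM('a)"
          unfolding powr_powr by simp
        finally show ?thesis
          using A by (simp only: ennreal_mult'[symmetric] mult.assoc[symmetric] powr_ge_zero) simp
      qed
      finally show "(\<integral>\<^sup>+\<xi>. ennreal (gauss (1 / real (Suc k)) \<xi> * (norm (fourier_integral g \<xi>))\<^sup>2) \<partial>lborel) \<le>
        ennreal ((2 * pi) powr DIM('a) * A)" by (simp add: l_def)
    qed
  qed measurable
  have c: "(unitary_const TYPE('a))\<^sup>2 * (2 * pi) powr DIM('a) = 1"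
    by (simp add: unitary_const_def power2_eq_square flip: powr_add)
  have 2: "sqint (\<lambda>\<xi>. unitary_const TYPE('a) *\<^sub>R fourier_integral g \<xi>) \<le> ennreal A"
    if A: "sqint g \<le> ennreal A" "0 < A" for A
  proof -
    have "sqint (\<lambda>\<xi>. unitary_const TYPE('a) *\<^sub>R fourier_integral g \<xi>) =
        ennreal ((unitary_const TYPE('a))\<^sup>2) * (\<integral>\<^sup>+\<xi>. ennsq (fourier_integral g \<xi>) \<partial>lborel)"
      unfolding sqint_def by (subst nn_integral_cmult[symmetric]) (auto simp: power_mult_distrib ennreal_mult')
    also have "\<dots> \<le> ennreal ((unitary_const TYPE('a))\<^sup>2) * ennreal ((2 * pi) powr DIM('a) * A)"
      by (intro mult_left_mono 1 A) auto
    also have "\<dots> = ennreal A"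
      using c by (simp add: ennreal_mult'[symmetric] mult.assoc[symmetric])
    finally show ?thesis .
  qed
  \<comment> \<open>\<open>gauss_convolution_le\<close> divides by its bound, which therefore must
    be positive; the slack e provides this also when \<open>sqint g\<close> is 0.\<close>
  show ?thesis
  proof (rule ennreal_le_epsilon)
    fix e :: real assume "0 < e"
    then show "sqint (\<lambda>\<xi>. unitary_const TYPE('a) *\<^sub>R fourier_integral g \<xi>) \<le> sqint g + ennreal e"
      using 2[of "enn2real (sqint g) + e"] False
      by (auto simp: ennreal_plus less_top add_nonneg_pos)
  qed
qed simp

section \<open>Truncation to balls and the limit in L^2\<close>

definition cutoff :: "real \<Rightarrow> ('a::euclidean_space \<Rightarrow> complex) \<Rightarrow> 'a \<Rightarrow> complex" where
  "cutoff R f x = indicator (cball 0 R) x *\<^sub>R f x"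

lemma cball_in_borel [measurable]: "cball x r \<in> sets borel"
  by simp

lemma borel_measurable_cutoff [measurable]: "f \<in> borel_measurable borel \<Longrightarrow> cutoff R f \<in> borel_measurable borel"
  unfolding cutoff_def[abs_def] by measurable

lemma truncated_fourier_eq:
  "truncated_fourier R (f :: 'a::euclidean_space \<Rightarrow> complex) \<xi> = unitary_const TYPE('a) *\<^sub>R fourier_integral (cutoff R f) \<xi>"
  by (simp add: truncated_fourier_def unitary_const_def fourier_integral_def cutoff_def set_lebesgue_integral_def)

lemma borel_measurable_truncated_fourier [measurable]:
  "f \<in> borel_measurable borel \<Longrightarrow> truncated_fourier R f \<in> borel_measurable borel"
  unfolding truncated_fourier_eq[abs_def] by measurable

text \<open>On a ball, of finite measure, |f| is dominated by 1 + |f|^2.\<close>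

lemma integrable_cutoff:
  assumes "f \<in> Lp_space 2"
  shows "integrable lborel (cutoff R f)"
proof -
  have [measurable]: "f \<in> borel_measurable borel" and fin: "sqint f < \<infinity>"
    using assms by (auto simp: Lp_space_2_iff)
  have "(\<integral>\<^sup>+x. ennreal (norm (cutoff R f x)) \<partial>lborel) \<le>
      (\<integral>\<^sup>+x. indicator (cball 0 R) x + ennsq (f x) \<partial>lborel)"
  proof (rule nn_integral_mono)
    fix x
    have "norm (f x) \<le> 1 + (norm (f x))\<^sup>2"
      using sum_squares_bound[of "norm (f x)" 1] norm_ge_zero[of "f x"] by (simp only: power_one mult_1_right)
    then show "ennreal (norm (cutoff R f x)) \<le> indicator (cball 0 R) x + ennsq (f x)"
      by (auto simp: cutoff_def indicator_def ennreal_1[symmetric] ennreal_plus[symmetric] simp del: ennreal_1 ennreal_plus intro!: ennreal_leI)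
  qed
  also have "\<dots> = emeasure lborel (cball (0::'a) R) + sqint f"
    by (simp add: nn_integral_add sqint_def)
  also have "\<dots> < \<infinity>"
    using fin emeasure_bounded_finite[OF bounded_cball, of "0::'a" R] by (simp add: ennreal_add_less_top)
  finally show ?thesis by (simp add: integrable_iff_bounded)
qed

text \<open>The squared L^2 mass outside a ball. It serves as the Cauchy modulus of the truncated
  transforms, see \<open>sqint_truncated_diff_le\<close>.\<close>

definition tail :: "('a::euclidean_space \<Rightarrow> complex) \<Rightarrow> real \<Rightarrow> ennreal" where
  "tail f R = sqint (\<lambda>x. f x - cutoff R f x)"

lemma tail_antimono: "R \<le> S \<Longrightarrow> tail f S \<le> tail f R"
  unfolding tail_def by (intro sqint_mono) (auto simp: cutoff_def indicator_def)

text \<open>Dominated convergence is applied along integer radii; monotonicity extends the limit to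
  all real radii.\<close>

lemma tail_tendsto_0:
  assumes "f \<in> Lp_space 2"
  shows "(tail f \<longlongrightarrow> 0) at_top"
proof -
  have [measurable]: "f \<in> borel_measurable borel" and fin: "sqint f < \<infinity>"
    using assms by (auto simp: Lp_space_2_iff)
  have "(\<lambda>k. \<integral>\<^sup>+x. ennsq (f x - cutoff (real k) f x) \<partial>lborel) \<longlonglongrightarrow> (\<integral>\<^sup>+(x::'a). 0 \<partial>lborel)"
  proof (rule nn_integral_dominated_convergence[where w = "\<lambda>x. ennsq (f x)"])
    show "AE x in lborel. (\<lambda>k. ennsq (f x - cutoff (real k) f x)) \<longlonglongrightarrow> 0"
    proof (rule AE_I2)
      fix x :: 'a
      obtain k0 where k0: "norm x \<le> real k0" using real_arch_simple by blast
      have "\<forall>\<^sub>F k in sequentially. ennsq (f x - cutoff (real k) f x) = 0"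
        using eventually_ge_at_top[of k0] by eventually_elim (use k0 in \<open>auto simp: cutoff_def indicator_def\<close>)
      then show "(\<lambda>k. ennsq (f x - cutoff (real k) f x)) \<longlonglongrightarrow> 0"
        by (rule tendsto_eventually)
    qed
    show "(\<integral>\<^sup>+x. ennsq (f x) \<partial>lborel) < \<infinity>" using fin by (simp add: sqint_def)
    show "AE x in lborel. ennsq (f x - cutoff (real k) f x) \<le> ennsq (f x)" for k
      by (auto simp: cutoff_def indicator_def)
  qed measurable
  then have seq: "(\<lambda>k. tail f (real k)) \<longlonglongrightarrow> 0" by (simp add: tail_def sqint_def)
  show ?thesis
  proof (rule order_tendstoI)
    fix e :: ennreal assume "0 < e"
    then have "\<forall>\<^sub>F k in sequentially. tail f (real k) < e" using seq order_tendstoD(2) by blast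
    then obtain k where "tail f (real k) < e" by (auto simp: eventually_sequentially)
    then have "tail f R < e" if "real k \<le> R" for R using tail_antimono[OF that] by (rule le_less_trans[rotated])
    then show "\<forall>\<^sub>F R in at_top. tail f R < e" by (auto simp: eventually_at_top_linorder)
  qed simp
qed

lemma sqint_truncated_diff_le:
  assumes f: "f \<in> Lp_space 2" and "R \<le> S"
  shows "sqint (\<lambda>\<xi>. truncated_fourier R f \<xi> - truncated_fourier S f \<xi>) \<le> tail f R"
proof -
  have 1: "truncated_fourier R f \<xi> - truncated_fourier S f \<xi> =
      unitary_const TYPE('a) *\<^sub>R fourier_integral (\<lambda>x. cutoff R f x - cutoff S f x) \<xi>" for \<xi>
    using fourier_integral_add[of "cutoff R f" "\<lambda>x. - cutoff S f x" \<xi>] integrable_cutoff[OF f]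
    by (simp add: truncated_fourier_eq scaleR_diff_right fourier_integral_def)
  have "sqint (\<lambda>\<xi>. truncated_fourier R f \<xi> - truncated_fourier S f \<xi>) \<le> sqint (\<lambda>x. cutoff R f x - cutoff S f x)"
    unfolding 1 using integrable_cutoff[OF f] by (intro bessel_fourier_integral) auto
  also have "\<dots> \<le> tail f R"
    unfolding tail_def using \<open>R \<le> S\<close> by (intro sqint_mono) (auto simp: cutoff_def indicator_def)
  finally show ?thesis .
qed

lemma sqint_truncated_le:
  assumes f: "f \<in> Lp_space 2"
  shows "sqint (truncated_fourier R f) \<le> sqint f"
proof -
  have "sqint (truncated_fourier R f) \<le> sqint (cutoff R f)"
    unfolding truncated_fourier_eq[abs_def] by (intro bessel_fourier_integral integrable_cutoff f)
  also have "\<dots> \<le> sqint f"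
    by (intro sqint_mono) (auto simp: cutoff_def indicator_def)
  finally show ?thesis .
qed

text \<open>Riesz--Fischer: the weights \<open>2\<^sup>k\<close> turn the \<open>L\<^sup>2\<close> bounds \<open>4\<^sup>-\<^sup>k\<close> on consecutive differences into
  almost everywhere geometric decay.\<close>

lemma sqint_complete:
  fixes F :: "real \<Rightarrow> 'a::euclidean_space \<Rightarrow> complex"
  assumes [measurable]: "\<And>R. F R \<in> borel_measurable borel"
    and cauchy: "\<And>R S. R \<le> S \<Longrightarrow> sqint (\<lambda>x. F R x - F S x) \<le> \<tau> R"
    and \<tau>: "(\<tau> \<longlongrightarrow> 0) at_top"
  obtains G where "G \<in> borel_measurable borel" "\<And>R. sqint (\<lambda>x. F R x - G x) \<le> \<tau> R"
proof -
  have "\<exists>r. \<forall>R\<ge>r. \<tau> R < ennreal ((1 / 4) ^ k)" for k :: nat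
    using order_tendstoD(2)[OF \<tau>, of "ennreal ((1 / 4) ^ k)"] by (auto simp: eventually_at_top_linorder)
  then obtain r where r: "\<And>k R. r k \<le> R \<Longrightarrow> \<tau> R < ennreal ((1 / 4) ^ k)" by metis
  \<comment> \<open>\<open>\<rho>\<close> must be increasing, for the Cauchy bound between
    neighbours; beyond \<open>r k\<close>, for the bound \<open>4 ^ (- k)\<close>; and unbounded, so
    that every fixed R is eventually passed.\<close>
  define \<rho> where "\<rho> k = real k + (\<Sum>i\<le>k. \<bar>r i\<bar>)" for k :: nat
  have \<rho>: "real k \<le> \<rho> k" "r k \<le> \<rho> k" "\<rho> k \<le> \<rho> (Suc k)" for k
  proof -
    have "\<bar>r k\<bar> \<le> (\<Sum>i\<le>k. \<bar>r i\<bar>)" by (rule member_le_sum) auto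
    then show "r k \<le> \<rho> k" by (simp add: \<rho>_def)
    show "real k \<le> \<rho> k" by (simp add: \<rho>_def sum_nonneg)
    show "\<rho> k \<le> \<rho> (Suc k)" by (simp add: \<rho>_def)
  qed
  define d where "d k x = F (\<rho> (Suc k)) x - F (\<rho> k) x" for k x
  have [measurable]: "d k \<in> borel_measurable borel" for k by (simp add: d_def[abs_def])
  have sd: "sqint (d k) \<le> ennreal ((1 / 4) ^ k)" for k
    using cauchy[OF \<rho>(3)[of k]] r[OF \<rho>(2)[of k]] sqint_diff_commute[of "F (\<rho> k)" "F (\<rho> (Suc k))"]
    by (simp add: d_def[abs_def])
  have "(\<integral>\<^sup>+x. (\<Sum>k. ennreal (2 ^ k * (norm (d k x))\<^sup>2)) \<partial>lborel) = (\<Sum>k. \<integral>\<^sup>+x. ennreal (2 ^ k * (norm (d k x))\<^sup>2) \<partial>lborel)"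
    by (rule nn_integral_suminf) measurable
  also have "\<dots> = (\<Sum>k. ennreal (2 ^ k) * sqint (d k))"
    by (simp add: ennreal_mult' nn_integral_cmult sqint_def)
  also have "\<dots> \<le> (\<Sum>k. ennreal ((1 / 2) ^ k))"
  proof (intro suminf_le)
    fix k
    have "ennreal (2 ^ k) * sqint (d k) \<le> ennreal (2 ^ k) * ennreal ((1 / 4) ^ k)"
      by (intro mult_left_mono sd) auto
    also have "\<dots> = ennreal ((1 / 2) ^ k)"
      by (simp add: ennreal_mult'[symmetric] power_mult_distrib[symmetric])
    finally show "ennreal (2 ^ k) * sqint (d k) \<le> ennreal ((1 / 2) ^ k)" .
  qed auto
  also have "\<dots> < \<infinity>"
    by (subst suminf_ennreal2) (auto intro!: summable_geometric)
  finally have "AE x in lborel. (\<Sum>k. ennreal (2 ^ k * (norm (d k x))\<^sup>2)) \<noteq> \<infinity>"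
    by (intro nn_integral_PInf_AE) auto
  then have conv: "AE x in lborel. convergent (\<lambda>k. F (\<rho> k) x)"
  proof eventually_elim
    fix x assume "(\<Sum>k. ennreal (2 ^ k * (norm (d k x))\<^sup>2)) \<noteq> \<infinity>"
    moreover define B where "B = enn2real (\<Sum>k. ennreal (2 ^ k * (norm (d k x))\<^sup>2))"
    ultimately have B: "(\<Sum>k. ennreal (2 ^ k * (norm (d k x))\<^sup>2)) = ennreal B" "0 \<le> B"
      by (simp_all add: less_top[symmetric])
    have "norm (d k x) \<le> sqrt B * (sqrt (1 / 2)) ^ k" for k
    proof -
      have "ennreal (2 ^ k * (norm (d k x))\<^sup>2) \<le> ennreal B"
        using sum_le_suminf[of "\<lambda>k. ennreal (2 ^ k * (norm (d k x))\<^sup>2)" "{k}"] B by auto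
      then have "2 ^ k * (norm (d k x))\<^sup>2 \<le> B" using B(2) by simp
      then have "(norm (d k x))\<^sup>2 \<le> B * (1 / 2) ^ k" by (simp add: field_simps)
      then have "norm (d k x) \<le> sqrt (B * (1 / 2) ^ k)" by (rule real_le_rsqrt)
      then show ?thesis by (simp add: real_sqrt_mult real_sqrt_power)
    qed
    moreover have "summable (\<lambda>k. sqrt B * (sqrt (1 / 2)) ^ k)"
      by (intro summable_mult summable_geometric) (simp add: real_sqrt_lt_1_iff)
    ultimately have "summable (\<lambda>k. d k x)" by (rule summable_comparison_test'[rotated, where N = 0]) 
    then have "convergent (\<lambda>n. \<Sum>k<n. d k x)" by (simp add: summable_iff_convergent)
    then have "convergent (\<lambda>n. F (\<rho> n) x - F (\<rho> 0) x)"
      by (simp add: d_def sum_lessThan_telescope[of "\<lambda>k. F (\<rho> k) x"])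
    then show "convergent (\<lambda>k. F (\<rho> k) x)"
      by (simp add: convergent_diff_const_right_iff)
  qed
  define G where "G x = lim (\<lambda>k. F (\<rho> k) x)" for x
  have [measurable]: "G \<in> borel_measurable borel"
    unfolding G_def[abs_def] by (rule borel_measurable_lim_metric) measurable
  \<comment> \<open>For fixed R the late \<open>\<rho> k\<close> exceed R, so the Cauchy bound holds
    along the subsequence and Fatou carries it to the limit, for every R and not only those of the
    subsequence.\<close>
  have "sqint (\<lambda>x. F R x - G x) \<le> \<tau> R" for R
    unfolding sqint_def
  proof (rule fatou_le)
    show "AE x in lborel. (\<lambda>k. ennsq (F R x - F (\<rho> k) x)) \<longlonglongrightarrow> ennsq (F R x - G x)"
      using conv
    proof eventually_elim
      fix x assume "convergent (\<lambda>k. F (\<rho> k) x)"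
      then have "(\<lambda>k. F (\<rho> k) x) \<longlonglongrightarrow> G x" by (simp add: G_def convergent_LIMSEQ_iff)
      then show "(\<lambda>k. ennsq (F R x - F (\<rho> k) x)) \<longlonglongrightarrow> ennsq (F R x - G x)"
        by (intro tendsto_ennrealI tendsto_intros)
    qed
    obtain k0 where k0: "R \<le> real k0" using real_arch_simple by blast
    show "\<forall>\<^sub>F k in sequentially. (\<integral>\<^sup>+x. ennsq (F R x - F (\<rho> k) x) \<partial>lborel) \<le> \<tau> R"
      using eventually_ge_at_top[of k0]
    proof eventually_elim
      case (elim k)
      then have "R \<le> \<rho> k" using k0 \<rho>(1)[of k] by (meson of_nat_le_iff order_trans)
      then show ?case using cauchy by (simp add: sqint_def)
    qed
  qed measurable
  then show ?thesis using that[of G] by simp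
qed

lemma Lp_space_2_measurable [measurable_dest]: "f \<in> Lp_space 2 \<Longrightarrow> f \<in> borel_measurable borel"
  by (simp add: Lp_space_2_iff)

lemma Lp_space_2_add:
  assumes "f \<in> Lp_space 2" "g \<in> Lp_space 2"
  shows "(\<lambda>x. f x + g x) \<in> Lp_space 2"
proof -
  have "2 * sqint f + 2 * sqint g < \<infinity>"
    using assms by (simp add: Lp_space_2_iff ennreal_add_less_top ennreal_mult_less_top)
  then show ?thesis
    using le_less_trans[OF sqint_add_le[of f g]] assms by (auto simp: Lp_space_2_iff)
qed

lemma Lp_space_2_dominated:
  assumes "g \<in> Lp_space 2" "f \<in> borel_measurable borel" "AE x in lborel. norm (f x) \<le> norm (g x)"
  shows "f \<in> Lp_space 2" "sqint f \<le> sqint g"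
proof -
  show le: "sqint f \<le> sqint g"
    unfolding sqint_def using assms(3)
    by (intro nn_integral_mono_AE) (auto elim!: eventually_mono intro!: ennreal_leI power_mono)
  show "f \<in> Lp_space 2"
    using assms(1,2) le_less_trans[OF le] by (simp add: Lp_space_2_iff)
qed

lemma Lp_space_2_uminus: "f \<in> Lp_space 2 \<Longrightarrow> (\<lambda>x. - f x) \<in> Lp_space 2"
  by (rule Lp_space_2_dominated(1)[of f]) auto

lemma Lp_space_2_diff:
  "f \<in> Lp_space 2 \<Longrightarrow> g \<in> Lp_space 2 \<Longrightarrow> (\<lambda>x. f x - g x) \<in> Lp_space 2"
  using Lp_space_2_add[of f "\<lambda>x. - g x"] Lp_space_2_uminus[of g] by simp

lemma Lp_space_2_scaleR: "f \<in> Lp_space 2 \<Longrightarrow> (\<lambda>x. c *\<^sub>R f x) \<in> Lp_space 2"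
  unfolding Lp_space_def by (auto simp: power_mult_distrib)

lemma Lp_space_2_cutoff: "f \<in> Lp_space 2 \<Longrightarrow> cutoff R f \<in> Lp_space 2"
  by (rule Lp_space_2_dominated(1)[of f]) (auto simp: cutoff_def indicator_def)

lemma Lp_space_2_reflect: "f \<in> Lp_space 2 \<Longrightarrow> (\<lambda>x. f (- x)) \<in> Lp_space 2"
  by (auto simp: Lp_space_2_iff sqint_uminus_arg)

text \<open>The Bessel inequality makes the truncated transforms Cauchy in L^2. The limit differs
  from one of them by a function in L^2, hence lies in L^2 itself.\<close>

lemma ex_fourier_transform:
  assumes f: "f \<in> Lp_space 2"
  shows "\<exists>F. is_fourier_transform f F"
proof -
  have [measurable]: "f \<in> borel_measurable borel" using f by measurable
  obtain G where [measurable]: "G \<in> borel_measurable borel"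
    and G: "\<And>R. sqint (\<lambda>x. truncated_fourier R f x - G x) \<le> tail f R"
    using sqint_complete[OF _ sqint_truncated_diff_le[OF f] tail_tendsto_0[OF f]] by auto
  obtain R where R: "tail f R < 1"
    using order_tendstoD(2)[OF tail_tendsto_0[OF f], of 1] by (auto simp: eventually_at_top_linorder)
  have "(\<lambda>x. truncated_fourier R f x - G x) \<in> Lp_space 2"
    using le_less_trans[OF G[of R] R] less_top le_less_trans
    by (auto simp: Lp_space_2_iff intro: less_trans[OF _ ennreal_one_less_top])
  moreover have "truncated_fourier R f \<in> Lp_space 2"
    using f sqint_truncated_le[OF f, of R] by (auto simp: Lp_space_2_iff)
  ultimately have "G \<in> Lp_space 2"
    using Lp_space_2_diff[of "truncated_fourier R f" "\<lambda>x. truncated_fourier R f x - G x"] by simp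
  moreover have "((\<lambda>R. sqint (\<lambda>x. truncated_fourier R f x - G x)) \<longlongrightarrow> 0) at_top"
    by (rule tendsto_sandwich[OF _ always_eventually tendsto_const tail_tendsto_0[OF f]]) (use G in auto)
  ultimately show ?thesis
    using f by (auto simp: is_fourier_transform_def sqint_def)
qed

lemma is_fourier_transform_fourier_transform:
  "f \<in> Lp_space 2 \<Longrightarrow> is_fourier_transform f (fourier_transform f)"
  unfolding fourier_transform_def by (rule someI_ex[OF ex_fourier_transform])

lemma fourier_transform_L2: "f \<in> Lp_space 2 \<Longrightarrow> fourier_transform f \<in> Lp_space 2"
  using is_fourier_transform_fourier_transform by (auto simp: is_fourier_transform_def)

lemma fourier_transform_measurable [measurable (raw)]:
  "f \<in> Lp_space 2 \<Longrightarrow> fourier_transform f \<in> borel_measurable borel"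
  using fourier_transform_L2 Lp_space_2_measurable by blast

lemma truncated_fourier_tendsto:
  "is_fourier_transform f F \<Longrightarrow> ((\<lambda>R. sqint (\<lambda>x. truncated_fourier R f x - F x)) \<longlongrightarrow> 0) at_top"
  by (simp add: is_fourier_transform_def sqint_def)

lemma sqint_eq_0_limit:
  assumes [measurable]: "\<And>k. h k \<in> borel_measurable borel" "f \<in> borel_measurable borel" "g \<in> borel_measurable borel"
    and f: "((\<lambda>k. sqint (\<lambda>x. h k x - f x)) \<longlongrightarrow> 0) F" and g: "((\<lambda>k. sqint (\<lambda>x. h k x - g x)) \<longlongrightarrow> 0) F"
    and F: "F \<noteq> bot"
  shows "AE x in lborel. f x = g x"
proof -
  have "((\<lambda>k. 2 * sqint (\<lambda>x. h k x - f x) + 2 * sqint (\<lambda>x. h k x - g x)) \<longlongrightarrow> 2 * 0 + 2 * 0) F"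
    by (intro tendsto_add ennreal_tendsto_cmult f g) auto
  moreover have "sqint (\<lambda>x. f x - g x) \<le> 2 * sqint (\<lambda>x. h k x - f x) + 2 * sqint (\<lambda>x. h k x - g x)" for k
    using sqint_triangle[of f "h k" g] by (simp add: sqint_diff_commute[of f])
  ultimately have "sqint (\<lambda>x. f x - g x) \<le> 2 * 0 + 2 * 0"
    by (intro tendsto_lowerbound[OF _ _ F]) auto
  then show ?thesis by (simp add: sqint_0_iff)
qed

lemma fourier_transform_unique:
  assumes "is_fourier_transform f F"
  shows "AE \<xi> in lborel. fourier_transform f \<xi> = F \<xi>"
proof -
  have f: "f \<in> Lp_space 2" and F: "F \<in> Lp_space 2" using assms by (auto simp: is_fourier_transform_def)
  show ?thesis
    by (rule sqint_eq_0_limit[OF _ _ _ truncated_fourier_tendsto[OF is_fourier_transform_fourier_transform[OF f]]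
          truncated_fourier_tendsto[OF assms]]) (use f F in \<open>auto intro: Lp_space_2_measurable fourier_transform_L2\<close>)
qed

lemma sqint_fourier_transform_le:
  assumes f: "f \<in> Lp_space 2"
  shows "sqint (fourier_transform f) \<le> 2 * sqint f"
proof -
  let ?F = "fourier_transform f"
  have [measurable]: "f \<in> borel_measurable borel" "?F \<in> borel_measurable borel" using f by auto
  have "((\<lambda>R. 2 * sqint (\<lambda>x. truncated_fourier R f x - ?F x) + 2 * sqint f) \<longlongrightarrow> 2 * 0 + 2 * sqint f) at_top"
    by (intro tendsto_add ennreal_tendsto_cmult truncated_fourier_tendsto is_fourier_transform_fourier_transform f tendsto_const) auto
  moreover have "sqint ?F \<le> 2 * sqint (\<lambda>x. truncated_fourier R f x - ?F x) + 2 * sqint f" for R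
  proof -
    have "sqint ?F \<le> 2 * sqint (\<lambda>x. ?F x - truncated_fourier R f x) + 2 * sqint (truncated_fourier R f)"
      using sqint_add_le[of "\<lambda>x. ?F x - truncated_fourier R f x" "truncated_fourier R f"] by simp
    also have "\<dots> \<le> 2 * sqint (\<lambda>x. truncated_fourier R f x - ?F x) + 2 * sqint f"
      by (intro add_mono mult_left_mono sqint_truncated_le f) (auto simp: sqint_diff_commute)
    finally show ?thesis .
  qed
  ultimately have "sqint ?F \<le> 2 * 0 + 2 * sqint f"
    by (intro tendsto_lowerbound[where F = at_top]) auto
  then show ?thesis by simp
qed

lemma fourier_transform_diff:
  assumes f: "f \<in> Lp_space 2" and g: "g \<in> Lp_space 2"
  shows "AE \<xi> in lborel. fourier_transform (\<lambda>x. f x - g x) \<xi> = fourier_transform f \<xi> - fourier_transform g \<xi>"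
proof (rule fourier_transform_unique)
  let ?F = "fourier_transform f" and ?G = "fourier_transform g"
  have [measurable]: "f \<in> borel_measurable borel" "g \<in> borel_measurable borel"
    "?F \<in> borel_measurable borel" "?G \<in> borel_measurable borel" using f g by auto
  have t: "truncated_fourier R (\<lambda>x. f x - g x) \<xi> = truncated_fourier R f \<xi> - truncated_fourier R g \<xi>" for R \<xi>
  proof -
    have "cutoff R (\<lambda>x. f x - g x) = (\<lambda>x. cutoff R f x + (- cutoff R g x))"
      by (auto simp: cutoff_def fun_eq_iff scaleR_diff_right)
    then show ?thesis
      using fourier_integral_add[of "cutoff R f" "\<lambda>x. - cutoff R g x" \<xi>] integrable_cutoff[OF f] integrable_cutoff[OF g]
      by (simp add: truncated_fourier_eq scaleR_diff_right fourier_integral_def)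
  qed
  have "((\<lambda>R. 2 * sqint (\<lambda>x. truncated_fourier R f x - ?F x) + 2 * sqint (\<lambda>x. truncated_fourier R g x - ?G x)) \<longlongrightarrow> 2 * 0 + 2 * 0) at_top"
    by (intro tendsto_add ennreal_tendsto_cmult truncated_fourier_tendsto is_fourier_transform_fourier_transform f g) auto
  then have lim: "((\<lambda>R. 2 * sqint (\<lambda>x. truncated_fourier R f x - ?F x) + 2 * sqint (\<lambda>x. truncated_fourier R g x - ?G x)) \<longlongrightarrow> 0) at_top"
    by simp
  have le: "sqint (\<lambda>\<xi>. truncated_fourier R (\<lambda>x. f x - g x) \<xi> - (?F \<xi> - ?G \<xi>)) \<le>
      2 * sqint (\<lambda>x. truncated_fourier R f x - ?F x) + 2 * sqint (\<lambda>x. truncated_fourier R g x - ?G x)" for R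
    using sqint_add_le[of "\<lambda>x. truncated_fourier R f x - ?F x" "\<lambda>x. ?G x - truncated_fourier R g x"]
    by (simp add: t sqint_diff_commute[of ?G] algebra_simps)
  have "((\<lambda>R. sqint (\<lambda>\<xi>. truncated_fourier R (\<lambda>x. f x - g x) \<xi> - (?F \<xi> - ?G \<xi>))) \<longlongrightarrow> 0) at_top"
    by (rule tendsto_sandwich[OF always_eventually always_eventually tendsto_const lim]) (use le in auto)
  then show "is_fourier_transform (\<lambda>x. f x - g x) (\<lambda>\<xi>. ?F \<xi> - ?G \<xi>)"
    using f g by (simp add: is_fourier_transform_def sqint_def Lp_space_2_diff fourier_transform_L2)
qed

lemma sqint_fourier_transform_diff_le:
  assumes f: "f \<in> Lp_space 2" and g: "g \<in> Lp_space 2"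
  shows "sqint (\<lambda>\<xi>. fourier_transform f \<xi> - fourier_transform g \<xi>) \<le> 2 * sqint (\<lambda>x. f x - g x)"
proof -
  have "sqint (\<lambda>\<xi>. fourier_transform f \<xi> - fourier_transform g \<xi>) = sqint (fourier_transform (\<lambda>x. f x - g x))"
    unfolding sqint_def using fourier_transform_diff[OF f g] by (intro nn_integral_cong_AE) (auto elim!: eventually_mono)
  also have "\<dots> \<le> 2 * sqint (\<lambda>x. f x - g x)"
    by (intro sqint_fourier_transform_le Lp_space_2_diff f g)
  finally show ?thesis .
qed

text \<open>The truncated integrals converge pointwise by dominated convergence and in L^2 to the
  transform; Fatou shows that the two limits have L^2 distance 0.\<close>

lemma fourier_transform_L1:
  fixes g :: "'a::euclidean_space \<Rightarrow> complex"
  assumes g: "g \<in> Lp_space 2" and i: "integrable lborel g"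
  shows "AE \<xi> in lborel. fourier_transform g \<xi> = unitary_const TYPE('a) *\<^sub>R fourier_integral g \<xi>"
proof -
  let ?F = "fourier_transform g" and ?c = "unitary_const TYPE('a)"
  have [measurable]: "g \<in> borel_measurable borel" "?F \<in> borel_measurable borel" using g by auto
  have lim: "(\<lambda>k. fourier_integral (cutoff (real k) g) \<xi>) \<longlonglongrightarrow> fourier_integral g \<xi>" for \<xi>
    unfolding fourier_integral_def
  proof (rule integral_dominated_convergence[where w = "\<lambda>x. norm (g x)"])
    show "AE x in lborel. (\<lambda>k. cis (- (x \<bullet> \<xi>)) * cutoff (real k) g x) \<longlonglongrightarrow> cis (- (x \<bullet> \<xi>)) * g x"
    proof (rule AE_I2)
      fix x :: 'a
      obtain k0 where k0: "norm x \<le> real k0" using real_arch_simple by blast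
      have "\<forall>\<^sub>F k in sequentially. cis (- (x \<bullet> \<xi>)) * cutoff (real k) g x = cis (- (x \<bullet> \<xi>)) * g x"
        using eventually_ge_at_top[of k0] by eventually_elim (use k0 in \<open>auto simp: cutoff_def indicator_def\<close>)
      then show "(\<lambda>k. cis (- (x \<bullet> \<xi>)) * cutoff (real k) g x) \<longlonglongrightarrow> cis (- (x \<bullet> \<xi>)) * g x"
        by (rule tendsto_eventually)
    qed
    show "AE x in lborel. norm (cis (- (x \<bullet> \<xi>)) * cutoff (real k) g x) \<le> norm (g x)" for k
      by (auto simp: norm_mult cutoff_def indicator_def)
  qed (use i in auto)
  have seq: "(\<lambda>k. sqint (\<lambda>x. truncated_fourier (real k) g x - ?F x)) \<longlonglongrightarrow> 0"
    using truncated_fourier_tendsto[OF is_fourier_transform_fourier_transform[OF g]] filterlim_real_sequentially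
    by (rule filterlim_compose)
  have "sqint (\<lambda>\<xi>. ?c *\<^sub>R fourier_integral g \<xi> - ?F \<xi>) \<le> 0 + ennreal e" if "0 < e" for e :: real
    unfolding sqint_def
  proof (rule fatou_le)
    show "AE \<xi> in lborel. (\<lambda>k. ennsq (truncated_fourier (real k) g \<xi> - ?F \<xi>)) \<longlonglongrightarrow>
        ennsq (?c *\<^sub>R fourier_integral g \<xi> - ?F \<xi>)"
      unfolding truncated_fourier_eq by (intro AE_I2 tendsto_ennrealI tendsto_intros lim)
    show "\<forall>\<^sub>F k in sequentially. (\<integral>\<^sup>+\<xi>. ennsq (truncated_fourier (real k) g \<xi> - ?F \<xi>) \<partial>lborel) \<le> 0 + ennreal e"
      using order_tendstoD(2)[OF seq, of "ennreal e"] that by (auto simp: sqint_def elim!: eventually_mono)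
  qed measurable
  then have "sqint (\<lambda>\<xi>. ?c *\<^sub>R fourier_integral g \<xi> - ?F \<xi>) \<le> 0"
    by (rule ennreal_le_epsilon) auto
  then have "AE \<xi> in lborel. ?c *\<^sub>R fourier_integral g \<xi> - ?F \<xi> = 0"
    by (subst sqint_0_iff[symmetric]) auto
  then show ?thesis by (auto elim!: eventually_mono)
qed

section \<open>Fourier inversion\<close>

text \<open>The centred normal density with covariance l times the identity, that is, the kernel of
  the heat equation at time l / 2.\<close>

definition heat_kernel :: "real \<Rightarrow> 'a::euclidean_space \<Rightarrow> real" where
  "heat_kernel l z = (2 * pi * l) powr (- real DIM('a) / 2) * gauss (1 / l) z"

definition heat :: "real \<Rightarrow> ('a::euclidean_space \<Rightarrow> complex) \<Rightarrow> 'a \<Rightarrow> complex" where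
  "heat l f x = (LINT y|lborel. f y * of_real (heat_kernel l (x - y)))"

lemma heat_kernel_nonneg [simp]: "0 \<le> heat_kernel l z"
  by (simp add: heat_kernel_def)

lemma borel_measurable_heat_kernel [measurable]: "heat_kernel l \<in> borel_measurable borel"
  unfolding heat_kernel_def[abs_def] by measurable

lemma borel_measurable_heat [measurable]:
  assumes [measurable]: "f \<in> borel_measurable borel"
  shows "heat l f \<in> borel_measurable borel"
  unfolding heat_def[abs_def] by measurable

lemma nn_integral_heat_kernel:
  assumes "0 < l"
  shows "(\<integral>\<^sup>+z. ennreal (heat_kernel l (z::'a::euclidean_space)) \<partial>lborel) = 1"
proof -
  have "(\<integral>\<^sup>+z. ennreal (heat_kernel l (z::'a)) \<partial>lborel) =
      ennreal ((2 * pi * l) powr (- real DIM('a) / 2)) * ennreal ((2 * pi * l) powr (DIM('a) / 2))"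
    using assms nn_integral_gauss[of "1 / l", where 'a='a]
    by (simp add: heat_kernel_def ennreal_mult' nn_integral_cmult)
  also have "\<dots> = ennreal ((2 * pi * l) powr (- real DIM('a) / 2 + DIM('a) / 2))"
    by (simp only: ennreal_mult'[symmetric] powr_ge_zero powr_add)
  also have "\<dots> = 1" using assms by simp
  finally show ?thesis .
qed

lemma nn_integral_heat_kernel_shift:
  assumes "0 < l"
  shows "(\<integral>\<^sup>+y. ennreal (heat_kernel l (x - y)) \<partial>lborel) = 1"
    and "(\<integral>\<^sup>+y. ennreal (heat_kernel l (y - x)) \<partial>lborel) = 1"
proof -
  show 1: "(\<integral>\<^sup>+y. ennreal (heat_kernel l (x - y)) \<partial>lborel) = 1"
    using nn_integral_reflect[of "\<lambda>z. ennreal (heat_kernel l z)" x] nn_integral_heat_kernel[OF assms, where 'a='a] by simp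
  have "heat_kernel l (y - x) = heat_kernel l (x - y)" for y
    by (simp add: heat_kernel_def gauss_def norm_minus_commute)
  with 1 show "(\<integral>\<^sup>+y. ennreal (heat_kernel l (y - x)) \<partial>lborel) = 1" by simp
qed

lemma integrable_mult_heat_kernel:
  fixes f :: "'a::euclidean_space \<Rightarrow> complex"
  assumes "integrable lborel f" "0 < l"
  shows "integrable lborel (\<lambda>y. f y * of_real (heat_kernel l (x - y)))"
proof -
  have [measurable]: "f \<in> borel_measurable borel" using assms borel_measurable_integrable by auto
  have "heat_kernel l z \<le> (2 * pi * l) powr (- real DIM('a) / 2)" for z :: 'a
    using gauss_le_1[of "1 / l" z] assms(2) by (simp add: heat_kernel_def mult_left_le)
  then show ?thesis
    by (intro Bochner_Integration.integrable_bound[OF integrable_mult_left[OF assms(1), of "of_real ((2 * pi * l) powr (- real DIM('a) / 2))"]])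
       (auto simp: norm_mult mult_left_mono)
qed

lemma heat_add:
  assumes "integrable lborel f" "integrable lborel g" "0 < l"
  shows "heat l (\<lambda>x. f x + g x) x = heat l f x + heat l g x"
  unfolding heat_def distrib_right
  by (intro Bochner_Integration.integral_add integrable_mult_heat_kernel assms)

lemma nn_integral_norm_heat_le:
  fixes f :: "'a::euclidean_space \<Rightarrow> complex"
  assumes [measurable]: "f \<in> borel_measurable borel" and l: "0 < l"
  shows "(\<integral>\<^sup>+x. ennreal (norm (heat l f x)) \<partial>lborel) \<le> (\<integral>\<^sup>+x. ennreal (norm (f x)) \<partial>lborel)"
proof -
  have "(\<integral>\<^sup>+x. ennreal (norm (heat l f x)) \<partial>lborel) \<le>
      (\<integral>\<^sup>+x. \<integral>\<^sup>+y. ennreal (norm (f y)) * ennreal (heat_kernel l (x - y)) \<partial>lborel \<partial>lborel)"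
  proof (rule nn_integral_mono)
    fix x
    show "ennreal (norm (heat l f x)) \<le> (\<integral>\<^sup>+y. ennreal (norm (f y)) * ennreal (heat_kernel l (x - y)) \<partial>lborel)"
      using norm_integral_le_nn_integral[of lborel "\<lambda>y. f y * of_real (heat_kernel l (x - y))"]
      by (simp add: heat_def norm_mult ennreal_mult')
  qed
  also have "\<dots> = (\<integral>\<^sup>+y. \<integral>\<^sup>+x. ennreal (norm (f y)) * ennreal (heat_kernel l (x - y)) \<partial>lborel \<partial>lborel)"
    by (rule lborel_pair.Fubini') measurable
  also have "\<dots> = (\<integral>\<^sup>+x. ennreal (norm (f x)) \<partial>lborel)"
    by (simp add: nn_integral_cmult nn_integral_heat_kernel_shift[OF l])
  finally show ?thesis .
qed

section \<open>Convergence of the heat semigroup to the identity on L^1\<close>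

definition heat_error :: "nat \<Rightarrow> ('a::euclidean_space \<Rightarrow> complex) \<Rightarrow> ennreal" where
  "heat_error k f = (\<integral>\<^sup>+x. ennreal (norm (heat (1 / real (Suc k)) f x - f x)) \<partial>lborel)"

lemma heat_error_add_le:
  assumes "integrable lborel f" "integrable lborel g"
  shows "heat_error k (\<lambda>x. f x + g x) \<le> heat_error k f + heat_error k g"
proof -
  have [measurable]: "f \<in> borel_measurable borel" "g \<in> borel_measurable borel"
    using assms borel_measurable_integrable by auto
  show ?thesis unfolding heat_error_def
  proof (subst nn_integral_add[symmetric])
    show "(\<integral>\<^sup>+x. ennreal (norm (heat (1 / real (Suc k)) (\<lambda>x. f x + g x) x - (f x + g x))) \<partial>lborel)
      \<le> (\<integral>\<^sup>+x. ennreal (norm (heat (1 / real (Suc k)) f x - f x)) + ennreal (norm (heat (1 / real (Suc k)) g x - g x)) \<partial>lborel)"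
    proof (rule nn_integral_mono)
      fix x
      have "norm (heat (1 / real (Suc k)) (\<lambda>x. f x + g x) x - (f x + g x)) \<le>
          norm (heat (1 / real (Suc k)) f x - f x) + norm (heat (1 / real (Suc k)) g x - g x)"
        using norm_triangle_ineq[of "heat (1 / real (Suc k)) f x - f x" "heat (1 / real (Suc k)) g x - g x"]
        by (subst heat_add[OF assms]) (auto simp: algebra_simps)
      then show "ennreal (norm (heat (1 / real (Suc k)) (\<lambda>x. f x + g x) x - (f x + g x))) \<le>
          ennreal (norm (heat (1 / real (Suc k)) f x - f x)) + ennreal (norm (heat (1 / real (Suc k)) g x - g x))"
        by (simp add: ennreal_plus[symmetric] ennreal_leI del: ennreal_plus)
    qed
  qed measurable
qed

lemma heat_error_le:
  assumes [measurable]: "f \<in> borel_measurable borel"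
  shows "heat_error k f \<le> 2 * (\<integral>\<^sup>+x. ennreal (norm (f x)) \<partial>lborel)"
proof -
  have "heat_error k f \<le> (\<integral>\<^sup>+x. ennreal (norm (heat (1 / real (Suc k)) f x)) + ennreal (norm (f x)) \<partial>lborel)"
    unfolding heat_error_def
    by (intro nn_integral_mono) (simp add: ennreal_plus[symmetric] ennreal_leI norm_triangle_ineq4 del: ennreal_plus)
  also have "\<dots> \<le> (\<integral>\<^sup>+x. ennreal (norm (f x)) \<partial>lborel) + (\<integral>\<^sup>+x. ennreal (norm (f x)) \<partial>lborel)"
    by (subst nn_integral_add) (auto intro!: add_right_mono nn_integral_norm_heat_le)
  finally show ?thesis by (simp add: mult_2)
qed

text \<open>The functions with vanishing error form a closed set in L^1: smoothing is a contraction
  there, so the error of f exceeds that of g by at most twice the distance between f and g.\<close>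

lemma heat_error_approx:
  assumes f: "integrable lborel f"
    and approx: "\<And>e. 0 < e \<Longrightarrow> \<exists>g. integrable lborel g \<and> (\<lambda>k. heat_error k g) \<longlonglongrightarrow> 0 \<and>
      (\<integral>\<^sup>+x. ennreal (norm (f x - g x)) \<partial>lborel) \<le> ennreal e"
  shows "(\<lambda>k. heat_error k f) \<longlonglongrightarrow> 0"
proof (rule order_tendstoI)
  fix a :: ennreal assume "0 < a"
  then obtain e where e: "0 < e" "ennreal e < a"
    by (metis dense ennreal_cases ennreal_less_zero_iff ennreal_zero_less_top less_imp_le not_less_iff_gr_or_eq top.extremum_strict)
  obtain g where g: "integrable lborel g" "(\<lambda>k. heat_error k g) \<longlonglongrightarrow> 0"
    and fg: "(\<integral>\<^sup>+x. ennreal (norm (f x - g x)) \<partial>lborel) \<le> ennreal (e / 4)"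
    using approx[of "e / 4"] e by auto
  have [measurable]: "f \<in> borel_measurable borel" "g \<in> borel_measurable borel"
    using f g borel_measurable_integrable by auto
  have "\<forall>\<^sub>F k in sequentially. heat_error k g < ennreal (e / 2)"
    using order_tendstoD(2)[OF g(2)] e by simp
  then show "\<forall>\<^sub>F k in sequentially. heat_error k f < a"
  proof eventually_elim
    case (elim k)
    have "heat_error k f \<le> heat_error k g + heat_error k (\<lambda>x. f x - g x)"
      using heat_error_add_le[of g "\<lambda>x. f x - g x" k] f g by simp
    also have "\<dots> \<le> ennreal (e / 2) + 2 * ennreal (e / 4)"
      using elim order_trans[OF heat_error_le mult_left_mono[OF fg]] by (intro add_mono) auto
    also have "\<dots> = ennreal e"
      using e by (simp add: ennreal_mult'[symmetric] ennreal_plus[symmetric] del: ennreal_plus flip: ennreal_numeral)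
    finally show ?case using e(2) by simp
  qed
qed simp

text \<open>Half of the exponent is spent on the decay factor; the other half is again a heat
  kernel, with parameter 2 l and total mass 1.\<close>

lemma heat_kernel_decay:
  fixes z :: "'a::euclidean_space"
  assumes "0 < l" "0 \<le> \<rho>" "\<rho> \<le> norm z"
  shows "heat_kernel l z \<le> 2 powr (DIM('a) / 2) * exp (- (\<rho>\<^sup>2 / (4 * l))) * heat_kernel (2 * l) z"
proof -
  have "exp (- ((norm z)\<^sup>2 / (4 * l))) \<le> exp (- (\<rho>\<^sup>2 / (4 * l)))"
    using assms by (intro iffD2[OF exp_le_cancel_iff] le_imp_neg_le divide_right_mono power_mono) auto
  moreover have "gauss (1 / l) z = exp (- ((norm z)\<^sup>2 / (4 * l))) * gauss (1 / (2 * l)) z"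
    by (simp add: gauss_def flip: exp_add)
  ultimately have g: "gauss (1 / l) z \<le> exp (- (\<rho>\<^sup>2 / (4 * l))) * gauss (1 / (2 * l)) z"
    by (simp add: mult_right_mono)
  have "(2 * pi * l) powr (- real DIM('a) / 2) = 2 powr (DIM('a) / 2) * (2 * pi * (2 * l)) powr (- real DIM('a) / 2)"
  proof -
    have "(2 * pi * (2 * l)) powr (- real DIM('a) / 2) = 2 powr (- real DIM('a) / 2) * (2 * pi * l) powr (- real DIM('a) / 2)"
      using assms by (subst powr_mult[symmetric]) (auto simp: mult_ac)
    then have "2 powr (DIM('a) / 2) * (2 * pi * (2 * l)) powr (- real DIM('a) / 2) =
        (2 powr (DIM('a) / 2) * 2 powr (- real DIM('a) / 2)) * (2 * pi * l) powr (- real DIM('a) / 2)"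
      by simp
    then show ?thesis by (simp flip: powr_add)
  qed
  then have "heat_kernel l z = 2 powr (DIM('a) / 2) * (2 * pi * (2 * l)) powr (- real DIM('a) / 2) * gauss (1 / l) z"
    by (simp add: heat_kernel_def)
  also have "\<dots> \<le> 2 powr (DIM('a) / 2) * (2 * pi * (2 * l)) powr (- real DIM('a) / 2) * (exp (- (\<rho>\<^sup>2 / (4 * l))) * gauss (1 / (2 * l)) z)"
    by (intro mult_left_mono g) auto
  finally show ?thesis by (simp add: heat_kernel_def mult_ac)
qed

text \<open>Let Q be the smoothed indicator. It lies between 0 and 1 and has the same mass as U, so
  the excess outside U equals the deficit inside and the L^1 error is twice the integral of 1 - Q
  over U. Hence only points of U matter, and around each of them U contains a ball, off which the
  kernel has vanishing mass.\<close>

lemma heat_error_open: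
  fixes U :: "'a::euclidean_space set" and c :: complex
  assumes U: "open U" "emeasure lborel U < \<infinity>"
  shows "(\<lambda>k. heat_error k (\<lambda>x. indicator U x *\<^sub>R c)) \<longlonglongrightarrow> 0"
proof -
  have [measurable]: "U \<in> sets borel" using U by simp
  define l where "l k = 1 / real (Suc k)" for k
  have l: "0 < l k" for k by (simp add: l_def)
  define Q where "Q k x = (LINT y|lborel. indicator U y * heat_kernel (l k) (x - y))" for k x
  have [measurable]: "Q k \<in> borel_measurable borel" for k unfolding Q_def[abs_def] by measurable
  have ih: "integrable lborel (\<lambda>y. heat_kernel (l k) (x - y))" for k and x :: 'a
    using nn_integral_heat_kernel_shift(1)[of "l k" x, OF l] by (intro integrableI_nonneg) auto
  have iU: "integrable lborel (\<lambda>y. indicator U y * heat_kernel (l k) (x - y))" for k and x :: 'a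
    by (rule Bochner_Integration.integrable_bound[OF ih[of k x]]) (auto simp: indicator_def)
  have h1: "(LINT y|lborel. heat_kernel (l k) (x - y)) = 1" for k and x :: 'a
    using nn_integral_heat_kernel_shift(1)[of "l k" x, OF l] nn_integral_eq_integral[OF ih[of k x]] by simp
  have Q0: "0 \<le> Q k x" for k x unfolding Q_def by (intro integral_nonneg_AE) auto
  have Q1: "Q k x \<le> 1" for k x
    unfolding Q_def h1[of k x, symmetric] by (intro integral_mono iU ih) (auto simp: indicator_def)
  have heat: "heat (l k) (\<lambda>x. indicator U x *\<^sub>R c) x = Q k x *\<^sub>R c" for k x
  proof -
    have "heat (l k) (\<lambda>x. indicator U x *\<^sub>R c) x = (LINT y|lborel. (indicator U y * heat_kernel (l k) (x - y)) *\<^sub>R c)"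
      unfolding heat_def by (intro Bochner_Integration.integral_cong) (auto simp: scaleR_conv_of_real)
    also have "\<dots> = Q k x *\<^sub>R c" unfolding Q_def using iU by (intro integral_scaleR_left) auto
    finally show ?thesis .
  qed
  have Q_int: "(\<integral>\<^sup>+x. ennreal (Q k x) \<partial>lborel) = emeasure lborel U" for k
  proof -
    have "(\<integral>\<^sup>+x. ennreal (Q k x) \<partial>lborel) = (\<integral>\<^sup>+x. \<integral>\<^sup>+y. indicator U y * ennreal (heat_kernel (l k) (x - y)) \<partial>lborel \<partial>lborel)"
      unfolding Q_def using iU
      by (subst nn_integral_eq_integral[symmetric]) (auto intro!: nn_integral_cong simp: indicator_def)
    also have "\<dots> = (\<integral>\<^sup>+y. \<integral>\<^sup>+x. indicator U y * ennreal (heat_kernel (l k) (x - y)) \<partial>lborel \<partial>lborel)"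
      by (rule lborel_pair.Fubini') measurable
    also have "\<dots> = emeasure lborel U"
      by (simp add: nn_integral_cmult nn_integral_heat_kernel_shift[OF l])
    finally show ?thesis .
  qed
  have Qi: "integrable lborel (Q k)" for k
    using Q_int[of k] Q0 U by (intro integrableI_nonneg) auto
  have Ui: "integrable lborel (indicator U :: 'a \<Rightarrow> real)"
    using U by (intro integrable_real_indicator) auto
  have UQi: "integrable lborel (\<lambda>x. indicator U x * (1 - Q k x))" for k
    by (rule Bochner_Integration.integrable_bound[OF Ui]) (use Q0 Q1 in \<open>auto simp: indicator_def\<close>)
  have err: "heat_error k (\<lambda>x. indicator U x *\<^sub>R c) = ennreal (2 * norm c * (LINT x|lborel. indicator U x * (1 - Q k x)))" for k
  proof -
    have eq: "\<bar>Q k x - indicator U x\<bar> = (Q k x - indicator U x) + 2 * (indicator U x * (1 - Q k x))" for x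
      using Q0[of k x] Q1[of k x] by (auto simp: indicator_def)
    have abs_i: "integrable lborel (\<lambda>x. \<bar>Q k x - indicator U x\<bar>)" using Qi Ui by auto
    have "ennreal (LINT x|lborel. Q k x) = emeasure lborel U"
      using Q_int[of k] nn_integral_eq_integral[OF Qi[of k]] Q0 by simp
    then have "(LINT x|lborel. Q k x) = measure lborel U"
      using Q0 by (simp add: measure_def integral_nonneg_AE flip: \<open>ennreal (LINT x|lborel. Q k x) = emeasure lborel U\<close>)
    then have "(LINT x|lborel. \<bar>Q k x - indicator U x\<bar>) = 2 * (LINT x|lborel. indicator U x * (1 - Q k x))"
      unfolding eq using Qi Ui UQi by simp
    moreover have "heat_error k (\<lambda>x. indicator U x *\<^sub>R c) = (\<integral>\<^sup>+x. ennreal (norm c * \<bar>Q k x - indicator U x\<bar>) \<partial>lborel)"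
      unfolding heat_error_def l_def[symmetric] heat by (simp add: scaleR_diff_left[symmetric] mult.commute)
    moreover have "\<dots> = ennreal (LINT x|lborel. norm c * \<bar>Q k x - indicator U x\<bar>)"
      using abs_i by (intro nn_integral_eq_integral) auto
    ultimately show ?thesis by (simp add: mult_ac)
  qed
  have lim1: "(\<lambda>k. Q k x) \<longlonglongrightarrow> 1" if x: "x \<in> U" for x
  proof -
    obtain \<rho> where \<rho>: "0 < \<rho>" "ball x \<rho> \<subseteq> U" using U x by (meson open_contains_ball)
    have "1 - Q k x \<le> 2 powr (DIM('a) / 2) * exp (- (\<rho>\<^sup>2 / (4 * l k)))" for k
    proof -
      have ih2: "integrable lborel (\<lambda>y. heat_kernel (2 * l k) (x - y))" 
        using nn_integral_heat_kernel_shift(1)[of "2 * l k" x] l[of k] by (intro integrableI_nonneg) auto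
      have "(LINT y|lborel. heat_kernel (2 * l k) (x - y)) = 1"
        using nn_integral_heat_kernel_shift(1)[of "2 * l k" x] l[of k] nn_integral_eq_integral[OF ih2] by simp
      have "1 - Q k x = (LINT y|lborel. heat_kernel (l k) (x - y) - indicator U y * heat_kernel (l k) (x - y))"
        using ih iU by (simp add: Q_def h1)
      also have "\<dots> \<le> (LINT y|lborel. (2 powr (DIM('a) / 2) * exp (- (\<rho>\<^sup>2 / (4 * l k)))) * heat_kernel (2 * l k) (x - y))"
      proof (intro integral_mono)
        fix y
        show "heat_kernel (l k) (x - y) - indicator U y * heat_kernel (l k) (x - y) \<le>
          2 powr (DIM('a) / 2) * exp (- (\<rho>\<^sup>2 / (4 * l k))) * heat_kernel (2 * l k) (x - y)"
        proof (cases "y \<in> U")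
          case False
          then have "\<rho> \<le> norm (x - y)" using \<rho> by (auto simp: dist_norm subset_eq not_less[symmetric])
          then show ?thesis using heat_kernel_decay[OF l, of \<rho> "x - y" k] \<rho>(1) False by simp
        qed simp
      qed (use ih iU ih2 in auto)
      also have "\<dots> = 2 powr (DIM('a) / 2) * exp (- (\<rho>\<^sup>2 / (4 * l k)))"
        using \<open>(LINT y|lborel. heat_kernel (2 * l k) (x - y)) = 1\<close> by simp
      finally show ?thesis .
    qed
    moreover have lim: "(\<lambda>k. 2 powr (DIM('a) / 2) * exp (- (\<rho>\<^sup>2 / (4 * l k)))) \<longlonglongrightarrow> 0"
    proof -
      have "(\<lambda>k. exp (- (\<rho>\<^sup>2 / 4 * real (Suc k)))) \<longlonglongrightarrow> 0"
        using \<rho> by real_asymp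
      then show ?thesis using tendsto_mult_right_zero by (fastforce simp: l_def)
    qed
    ultimately have "(\<lambda>k. 1 - Q k x) \<longlonglongrightarrow> 0"
      using Q1 by (intro tendsto_sandwich[OF always_eventually always_eventually tendsto_const lim]) auto
    from tendsto_diff[OF tendsto_const[of 1] this] show ?thesis by simp
  qed
  have "(\<lambda>k. LINT x|lborel. indicator U x * (1 - Q k x)) \<longlonglongrightarrow> (LINT (x::'a)|lborel. 0 :: real)"
  proof (rule integral_dominated_convergence[where w = "indicator U"])
    show "AE x in lborel. (\<lambda>k. indicator U x * (1 - Q k x)) \<longlonglongrightarrow> 0"
    proof (rule AE_I2)
      fix x
      show "(\<lambda>k. indicator U x * (1 - Q k x)) \<longlonglongrightarrow> 0"
        using tendsto_diff[OF tendsto_const[of 1] lim1[of x]] by (cases "x \<in> U") auto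
    qed
  qed (use Ui Q0 Q1 in \<open>auto simp: indicator_def\<close>)
  then have "(\<lambda>k. ennreal (2 * norm c * (LINT x|lborel. indicator U x * (1 - Q k x)))) \<longlonglongrightarrow> ennreal (2 * norm c * 0)"
    by (intro tendsto_ennrealI tendsto_intros) simp
  then show ?thesis by (simp add: err)
qed

text \<open>Outer regularity approximates a Borel set of finite measure in L^1 by an open superset;
  sums and dominated limits then exhaust L^1.\<close>

lemma heat_error_tendsto_0:
  fixes f :: "'a::euclidean_space \<Rightarrow> complex"
  assumes "integrable lborel f"
  shows "(\<lambda>k. heat_error k f) \<longlonglongrightarrow> 0"
  using assms
proof (induction rule: integrable_induct)
  case (base A c)
  have [measurable]: "A \<in> sets borel" using base by simp
  show ?case
  proof (rule heat_error_approx)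
    show "integrable lborel (\<lambda>x. indicator A x *\<^sub>R c)" using base by (intro integrable_scaleR_left) auto
    fix e :: real assume e: "0 < e"
    define e' where "e' = e / (norm c + 1)"
    have e': "0 < e'" "norm c * e' \<le> e" using e by (auto simp: e'_def field_simps add_pos_nonneg)
    obtain U where U: "open U" "A \<subseteq> U" "emeasure lborel (U - A) < ennreal e'"
      using outer_regular_lborel[of A e'] base e' by auto
    have [measurable]: "U \<in> sets borel" using U by simp
    have "emeasure lborel U \<le> emeasure lborel A + emeasure lborel (U - A)"
      using U emeasure_subadditive[of A lborel "U - A"] by (simp add: Un_absorb1)
    also have "\<dots> < \<infinity>" using base U(3) by (auto simp: ennreal_add_less_top intro: less_trans)
    finally have fU: "emeasure lborel U < \<infinity>" .
    have "(\<integral>\<^sup>+x. ennreal (norm (indicator A x *\<^sub>R c - indicator U x *\<^sub>R c)) \<partial>lborel) =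
        (\<integral>\<^sup>+x. ennreal (norm c) * indicator (U - A) x \<partial>lborel)"
      using U(2) by (intro nn_integral_cong) (auto simp: indicator_def)
    also have "\<dots> = ennreal (norm c) * emeasure lborel (U - A)"
      by (subst nn_integral_cmult_indicator) auto
    also have "\<dots> \<le> ennreal (norm c) * ennreal e'"
      using U(3) by (intro mult_left_mono) auto
    also have "\<dots> \<le> ennreal e" using e' by (simp add: ennreal_mult'[symmetric] ennreal_leI)
    finally show "\<exists>g. integrable lborel g \<and> (\<lambda>k. heat_error k g) \<longlonglongrightarrow> 0 \<and>
        (\<integral>\<^sup>+x. ennreal (norm (indicator A x *\<^sub>R c - g x)) \<partial>lborel) \<le> ennreal e"
      using heat_error_open[OF U(1) fU, of c] fU
      by (intro exI[of _ "\<lambda>x. indicator U x *\<^sub>R c"]) (auto intro!: integrable_scaleR_left)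
  qed
next
  case (add f g)
  have "(\<lambda>k. heat_error k f + heat_error k g) \<longlonglongrightarrow> 0 + 0"
    using add by (intro tendsto_add) auto
  then have lim: "(\<lambda>k. heat_error k f + heat_error k g) \<longlonglongrightarrow> 0" by simp
  have "heat_error k (\<lambda>x. f x + g x) \<le> heat_error k f + heat_error k g" for k
    using add by (intro heat_error_add_le) auto
  then show ?case
    by (intro tendsto_sandwich[OF always_eventually always_eventually tendsto_const lim]) auto
next
  case (lim f s)
  have [measurable]: "f \<in> borel_measurable borel" "s i \<in> borel_measurable borel" for i
    using lim(1)[of i] lim(4) borel_measurable_integrable by auto
  have "(\<lambda>i. \<integral>\<^sup>+x. ennreal (norm (f x - s i x)) \<partial>lborel) \<longlonglongrightarrow> (\<integral>\<^sup>+(x::'a). 0 \<partial>lborel)"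
  proof (rule nn_integral_dominated_convergence[where w = "\<lambda>x. ennreal (3 * norm (f x))"])
    show "AE x in lborel. (\<lambda>i. ennreal (norm (f x - s i x))) \<longlonglongrightarrow> 0"
    proof (rule AE_I2)
      fix x
      have "(\<lambda>i. ennreal (norm (f x - s i x))) \<longlonglongrightarrow> ennreal (norm (f x - f x))"
        using lim(2)[of x] by (intro tendsto_ennrealI tendsto_intros) auto
      then show "(\<lambda>i. ennreal (norm (f x - s i x))) \<longlonglongrightarrow> 0" by simp
    qed
    show "AE x in lborel. ennreal (norm (f x - s i x)) \<le> ennreal (3 * norm (f x))" for i
    proof (intro AE_I2 ennreal_leI)
      fix x show "norm (f x - s i x) \<le> 3 * norm (f x)"
        using norm_triangle_ineq4[of "f x" "s i x"] lim(3)[of x i] by simp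
    qed
    have "integrable lborel (\<lambda>x. 3 *\<^sub>R f x)" using lim(4) by simp
    then show "(\<integral>\<^sup>+x. ennreal (3 * norm (f x)) \<partial>lborel) < \<infinity>"
      unfolding integrable_iff_bounded norm_scaleR by simp
  qed measurable
  then have l0: "(\<lambda>i. \<integral>\<^sup>+x. ennreal (norm (f x - s i x)) \<partial>lborel) \<longlonglongrightarrow> 0" by simp
  show ?case
  proof (rule heat_error_approx[OF lim(4)])
    fix e :: real assume "0 < e"
    then have "\<forall>\<^sub>F i in sequentially. (\<integral>\<^sup>+x. ennreal (norm (f x - s i x)) \<partial>lborel) < ennreal e"
      using order_tendstoD(2)[OF l0] by simp
    then obtain i where "(\<integral>\<^sup>+x. ennreal (norm (f x - s i x)) \<partial>lborel) < ennreal e"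
      by (auto simp: eventually_sequentially)
    then show "\<exists>g. integrable lborel g \<and> (\<lambda>k. heat_error k g) \<longlonglongrightarrow> 0 \<and>
        (\<integral>\<^sup>+x. ennreal (norm (f x - g x)) \<partial>lborel) \<le> ennreal e"
      using lim(1,5) by (intro exI[of _ "s i"]) auto
  qed
qed

section \<open>The inversion theorem and its consequences\<close>

lemma heat_kernel_fourier_const:
  fixes z :: "'a::euclidean_space"
  assumes "0 < l"
  shows "(unitary_const TYPE('a))\<^sup>2 * ((2 * pi / l) powr (DIM('a) / 2) * gauss (1 / l) z) = heat_kernel l z"
proof -
  have "(unitary_const TYPE('a))\<^sup>2 = ((2 * pi) powr 2) powr (- real DIM('a) / 2)"
    unfolding unitary_const_def powr_powr by (simp add: power2_eq_square powr_add[symmetric])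
  moreover have "(2 * pi / l) powr (DIM('a) / 2) = (l / (2 * pi)) powr (- real DIM('a) / 2)"
    using assms by (simp add: powr_minus powr_divide divide_simps)
  ultimately have "(unitary_const TYPE('a))\<^sup>2 * (2 * pi / l) powr (DIM('a) / 2) = ((2 * pi) powr 2 * (l / (2 * pi))) powr (- real DIM('a) / 2)"
    using assms by (subst powr_mult) auto
  also have "(2 * pi) powr 2 * (l / (2 * pi)) = 2 * pi * l"
    by (simp add: power2_eq_square)
  finally show ?thesis by (simp add: heat_kernel_def mult.assoc[symmetric])
qed

text \<open>The transform of h is multiplied by a Gaussian. Transforming again and reflecting gives
  the heat smoothing of h, by Gaussian inversion. As the Gaussian flattens, this converges in L^2 to
  the reflected double transform and in L^1 to h; a common subsequence converges almost everywhere
  to both.\<close>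

lemma fourier_inversion_L1:
  fixes h :: "'a::euclidean_space \<Rightarrow> complex"
  assumes h: "h \<in> Lp_space 2" and hi: "integrable lborel h"
  shows "AE x in lborel. fourier_transform (fourier_transform h) (- x) = h x"
proof -
  let ?F = "fourier_transform h" and ?c = "unitary_const TYPE('a)"
  let ?A = "\<lambda>x. fourier_transform ?F (- x)"
  have [measurable]: "h \<in> borel_measurable borel" "?F \<in> borel_measurable borel"
    "fourier_transform ?F \<in> borel_measurable borel"
    using h by (auto intro!: fourier_transform_measurable fourier_transform_L2)
  define l where "l k = 1 / real (Suc k)" for k
  have l: "0 < l k" for k by (simp add: l_def)
  have Fh: "AE \<xi> in lborel. ?F \<xi> = ?c *\<^sub>R fourier_integral h \<xi>"
    by (rule fourier_transform_L1[OF h hi])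
  define g where "g k \<xi> = of_real (gauss (l k) \<xi>) * (?c *\<^sub>R fourier_integral h \<xi>)" for k \<xi>
  have [measurable]: "g k \<in> borel_measurable borel" for k unfolding g_def[abs_def] by measurable
  have gi: "integrable lborel (g k)" for k
    unfolding g_def using norm_fourier_integral_le[OF hi] l
    by (intro integrable_gauss_mult[where B = "\<bar>?c\<bar> * (LINT x|lborel. norm (h x))"]) (auto intro!: mult_left_mono)
  have g2: "g k \<in> Lp_space 2" for k
  proof (rule Lp_space_2_dominated(1))
    show "?F \<in> Lp_space 2" using h by (rule fourier_transform_L2)
    show "AE x in lborel. norm (g k x) \<le> norm (?F x)"
      using Fh
    proof eventually_elim
      case (elim x)
      show ?case unfolding elim g_def norm_mult
        using gauss_le_1[of "l k" x] l[of k] by (intro mult_left_le_one_le) auto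
    qed
  qed measurable
  have heat: "AE x in lborel. fourier_transform (g k) (- x) = heat (l k) h x" for k
    using AE_reflect[OF fourier_transform_L1[OF g2[of k] gi[of k]]]
  proof eventually_elim
    case (elim x)
    have "fourier_integral (g k) (- x) = ?c *\<^sub>R fourier_integral (\<lambda>\<xi>. of_real (gauss (l k) \<xi>) * fourier_integral h \<xi>) (- x)"
      unfolding g_def fourier_integral_def mult_scaleR_right integral_scaleR_right ..
    then have "fourier_transform (g k) (- x) = of_real (?c\<^sup>2) *
        (LINT y|lborel. h y * of_real ((2 * pi / l k) powr (DIM('a) / 2) * gauss (1 / l k) (x - y)))"
      unfolding elim gauss_fourier_inversion[OF l hi] by (simp add: scaleR_conv_of_real power2_eq_square)
    also have "\<dots> = heat (l k) h x"
      unfolding heat_def integral_mult_right_zero[symmetric]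
      by (intro Bochner_Integration.integral_cong)
         (auto simp flip: heat_kernel_fourier_const[OF l])
    finally show ?case .
  qed
  have "(\<lambda>k. \<integral>\<^sup>+x. ennsq (g k x - ?F x) \<partial>lborel) \<longlonglongrightarrow> (\<integral>\<^sup>+(x::'a). 0 \<partial>lborel)"
  proof (rule nn_integral_dominated_convergence[where w = "\<lambda>x. ennsq (?F x)"])
    show "AE x in lborel. (\<lambda>k. ennsq (g k x - ?F x)) \<longlonglongrightarrow> 0"
      using Fh
    proof eventually_elim
      case (elim x)
      have "(\<lambda>k. gauss (l k) x) \<longlonglongrightarrow> exp (- (0 * (norm x)\<^sup>2 / 2))"
        unfolding gauss_def l_def by (intro tendsto_intros LIMSEQ_Suc[OF lim_1_over_n]) auto
      then have "(\<lambda>k. ennsq (of_real (gauss (l k) x) * ?F x - ?F x)) \<longlonglongrightarrow>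
          ennsq (of_real (exp (- (0 * (norm x)\<^sup>2 / 2))) * ?F x - ?F x)"
        by (intro tendsto_ennrealI tendsto_intros)
      then show ?case by (simp add: g_def elim)
    qed
    show "AE x in lborel. ennsq (g k x - ?F x) \<le> ennsq (?F x)" for k
      using Fh
    proof eventually_elim
      case (elim x)
      have "g k x - ?F x = of_real (gauss (l k) x - 1) * ?F x"
        by (simp add: g_def elim algebra_simps)
      moreover have "\<bar>gauss (l k) x - 1\<bar> \<le> 1"
        using gauss_le_1[of "l k" x] gauss_pos(1)[of "l k" x] l[of k] by (simp add: abs_le_iff)
      ultimately have "norm (g k x - ?F x) \<le> norm (?F x)"
        by (simp only: norm_mult norm_of_real mult_left_le_one_le norm_ge_zero abs_ge_zero)
      then show ?case by (intro ennreal_leI power_mono) auto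
    qed
    show "(\<integral>\<^sup>+x. ennsq (?F x) \<partial>lborel) < \<infinity>"
      using fourier_transform_L2[OF h] by (simp add: Lp_space_2_iff sqint_def)
  qed measurable
  then have "(\<lambda>k. sqint (\<lambda>x. g k x - ?F x)) \<longlonglongrightarrow> 0" by (simp add: sqint_def)
  from ennreal_tendsto_cmult[OF _ this, of 2] have lim2: "(\<lambda>k. 2 * sqint (\<lambda>x. g k x - ?F x)) \<longlonglongrightarrow> 0"
    by simp
  have A2: "?A \<in> Lp_space 2"
    using h by (intro Lp_space_2_reflect fourier_transform_L2)
  have heat_A: "sqint (\<lambda>x. heat (l k) h x - ?A x) \<le> 2 * sqint (\<lambda>x. g k x - ?F x)" for k
  proof -
    have m: "fourier_transform (g k) \<in> borel_measurable borel"
      using g2 by (rule fourier_transform_measurable)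
    have "sqint (\<lambda>x. heat (l k) h x - ?A x) = sqint (\<lambda>x. fourier_transform (g k) (- x) - ?A x)"
      unfolding sqint_def using heat[of k] by (intro nn_integral_cong_AE) (auto elim!: eventually_mono)
    also have "\<dots> = sqint (\<lambda>x. fourier_transform (g k) x - fourier_transform ?F x)"
      using sqint_uminus_arg[of "\<lambda>x. fourier_transform (g k) x - fourier_transform ?F x"] m by simp
    also have "\<dots> \<le> 2 * sqint (\<lambda>x. g k x - ?F x)"
      by (intro sqint_fourier_transform_diff_le g2 fourier_transform_L2 h)
    finally show ?thesis .
  qed
  have heat2: "heat (l k) h \<in> Lp_space 2" for k
  proof -
    have "(\<lambda>x. fourier_transform (g k) (- x)) \<in> Lp_space 2"
      by (intro Lp_space_2_reflect fourier_transform_L2 g2)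
    then show ?thesis
      by (rule Lp_space_2_dominated(1)) (use heat[of k] in \<open>auto elim!: eventually_mono\<close>)
  qed
  \<comment> \<open>L^2 convergence is restated as L^1 convergence of the squared distances, to
    which the subsequence theorem for L^1 applies.\<close>
  have i1: "integrable lborel (\<lambda>x. (norm (heat (l k) h x - ?A x))\<^sup>2)" for k
    using Lp_space_2_diff[OF heat2[of k] A2] by (simp add: Lp_space_def)
  have "(\<lambda>k. ennreal (LINT x|lborel. norm ((norm (heat (l k) h x - ?A x))\<^sup>2))) \<longlonglongrightarrow> ennreal 0"
  proof (rule tendsto_sandwich[OF always_eventually always_eventually tendsto_const])
    show "\<forall>k. ennreal (LINT x|lborel. norm ((norm (heat (l k) h x - ?A x))\<^sup>2)) \<le> 2 * sqint (\<lambda>x. g k x - ?F x)"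
      using heat_A i1 by (simp add: sqint_def nn_integral_eq_integral)
    show "(\<lambda>k. 2 * sqint (\<lambda>x. g k x - ?F x)) \<longlonglongrightarrow> ennreal 0" using lim2 by simp
  qed simp
  then have "(\<lambda>k. LINT x|lborel. norm ((norm (heat (l k) h x - ?A x))\<^sup>2)) \<longlonglongrightarrow> 0"
    by (subst (asm) tendsto_ennreal_iff) (auto intro!: always_eventually integral_nonneg_AE)
  from tendsto_L1_AE_subseq[OF i1 this] obtain r where r: "strict_mono r"
    and r_AE: "AE x in lborel. (\<lambda>k. (norm (heat (l (r k)) h x - ?A x))\<^sup>2) \<longlonglongrightarrow> 0" by blast
  have i2: "integrable lborel (\<lambda>x. heat (l k) h x - h x)" for k
  proof -
    have "(\<integral>\<^sup>+x. ennreal (norm (heat (l k) h x)) \<partial>lborel) \<le> (\<integral>\<^sup>+x. ennreal (norm (h x)) \<partial>lborel)"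
      by (rule nn_integral_norm_heat_le) (auto simp: l)
    also have "\<dots> < \<infinity>" using hi by (simp add: integrable_iff_bounded)
    finally have "integrable lborel (heat (l k) h)" by (simp add: integrable_iff_bounded)
    then show ?thesis using hi by simp
  qed
  have "(\<lambda>k. heat_error (r k) h) \<longlonglongrightarrow> 0"
    using heat_error_tendsto_0[OF hi] r LIMSEQ_subseq_LIMSEQ by (force simp: o_def)
  moreover have "heat_error (r k) h = ennreal (LINT x|lborel. norm (heat (l (r k)) h x - h x))" for k
    unfolding heat_error_def l_def[symmetric] using i2 by (intro nn_integral_eq_integral) auto
  ultimately have "(\<lambda>k. ennreal (LINT x|lborel. norm (heat (l (r k)) h x - h x))) \<longlonglongrightarrow> ennreal 0"
    by simp
  then have "(\<lambda>k. LINT x|lborel. norm (heat (l (r k)) h x - h x)) \<longlonglongrightarrow> 0"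
    by (subst (asm) tendsto_ennreal_iff) (auto intro!: always_eventually integral_nonneg_AE)
  from tendsto_L1_AE_subseq[OF i2 this] obtain r' where r': "strict_mono r'"
    and r'_AE: "AE x in lborel. (\<lambda>k. heat (l (r (r' k))) h x - h x) \<longlonglongrightarrow> 0" by blast
  from r_AE r'_AE show ?thesis
  proof eventually_elim
    case (elim x)
    have "(\<lambda>k. sqrt ((norm (heat (l (r (r' k))) h x - ?A x))\<^sup>2)) \<longlonglongrightarrow> sqrt 0"
      using LIMSEQ_subseq_LIMSEQ[OF elim(1) r'] by (intro tendsto_real_sqrt) (simp add: o_def)
    then have "(\<lambda>k. heat (l (r (r' k))) h x - ?A x) \<longlonglongrightarrow> 0"
      by (simp add: tendsto_norm_zero_iff)
    then have "(\<lambda>k. heat (l (r (r' k))) h x) \<longlonglongrightarrow> ?A x" by (simp add: LIM_zero_iff)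
    moreover have "(\<lambda>k. heat (l (r (r' k))) h x) \<longlonglongrightarrow> h x" using elim(2) by (simp add: LIM_zero_iff)
    ultimately show ?case by (rule LIMSEQ_unique)
  qed
qed

text \<open>Cutoffs lie in both L^1 and L^2, and both sides depend continuously on f in L^2.\<close>

theorem fourier_inversion:
  fixes f :: "'a::euclidean_space \<Rightarrow> complex"
  assumes f: "f \<in> Lp_space 2"
  shows "AE x in lborel. fourier_transform (fourier_transform f) x = f (- x)"
proof -
  let ?FF = "\<lambda>f. fourier_transform (fourier_transform f)"
  have L2: "?FF g \<in> Lp_space 2" if "g \<in> Lp_space 2" for g :: "'a \<Rightarrow> complex"
    using that by (intro fourier_transform_L2)
  define F where "F k = cutoff (real k) f" for k
  have F: "F k \<in> Lp_space 2" for k unfolding F_def by (intro Lp_space_2_cutoff f)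
  have [measurable]: "f \<in> borel_measurable borel" "F k \<in> borel_measurable borel"
    "?FF f \<in> borel_measurable borel" "?FF (F k) \<in> borel_measurable borel" for k
    using f F[of k] by (auto intro!: Lp_space_2_measurable L2)
  have "(\<lambda>k. tail f (real k)) \<longlonglongrightarrow> 0"
    using tail_tendsto_0[OF f] filterlim_real_sequentially by (rule filterlim_compose)
  then have tl: "(\<lambda>k. sqint (\<lambda>x. F k x - f x)) \<longlonglongrightarrow> 0"
    by (simp add: tail_def F_def sqint_diff_commute[of f])
  have tl4: "(\<lambda>k. 2 * (2 * sqint (\<lambda>x. F k x - f x))) \<longlonglongrightarrow> 0"
    using ennreal_tendsto_cmult[OF _ ennreal_tendsto_cmult[OF _ tl, of 2], of 2] by simp
  show ?thesis
  proof (rule sqint_eq_0_limit[where F = sequentially and h = "\<lambda>k. ?FF (F k)"])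
    have "sqint (\<lambda>x. ?FF (F k) x - ?FF f x) \<le> 2 * (2 * sqint (\<lambda>x. F k x - f x))" for k
      by (rule order_trans[OF sqint_fourier_transform_diff_le[OF fourier_transform_L2[OF F[of k]] fourier_transform_L2[OF f]]
            mult_left_mono[OF sqint_fourier_transform_diff_le[OF F[of k] f]]]) simp
    then show "(\<lambda>k. sqint (\<lambda>x. ?FF (F k) x - ?FF f x)) \<longlonglongrightarrow> 0"
      by (intro tendsto_sandwich[OF always_eventually always_eventually tendsto_const tl4]) auto
    have "sqint (\<lambda>x. ?FF (F k) x - f (- x)) = sqint (\<lambda>x. F k x - f x)" for k
    proof -
      have "AE x in lborel. ?FF (F k) (- x) = F k x"
        unfolding F_def by (intro fourier_inversion_L1 Lp_space_2_cutoff integrable_cutoff f)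
      from AE_reflect[OF this] have "sqint (\<lambda>x. ?FF (F k) x - f (- x)) = sqint (\<lambda>x. F k (- x) - f (- x))"
        unfolding sqint_def by (intro nn_integral_cong_AE) (auto elim!: eventually_mono)
      also have "\<dots> = sqint (\<lambda>x. F k x - f x)"
        using sqint_uminus_arg[of "\<lambda>x. F k x - f x"] by simp
      finally show ?thesis .
    qed
    then show "(\<lambda>k. sqint (\<lambda>x. ?FF (F k) x - f (- x))) \<longlonglongrightarrow> 0" using tl by simp
  qed auto
qed

text \<open>The transform of the reflected function is a preimage, since inversion reflects once
  more.\<close>

lemma ex_fourier_preimage:
  fixes F :: "'a::euclidean_space \<Rightarrow> complex"
  assumes "F \<in> Lp_space 2"
  obtains f where "f \<in> Lp_space 2" "AE \<xi> in lborel. fourier_transform f \<xi> = F \<xi>"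
proof (rule that)
  show "fourier_transform (\<lambda>x. F (- x)) \<in> Lp_space 2"
    by (intro fourier_transform_L2 Lp_space_2_reflect assms)
  show "AE \<xi> in lborel. fourier_transform (fourier_transform (\<lambda>x. F (- x))) \<xi> = F \<xi>"
    using fourier_inversion[OF Lp_space_2_reflect[OF assms]] by simp
qed

text \<open>The upper bound applied to the transform of f, whose transform is f reflected.\<close>

lemma sqint_le_fourier_transform:
  fixes f :: "'a::euclidean_space \<Rightarrow> complex"
  assumes f: "f \<in> Lp_space 2"
  shows "sqint f \<le> 2 * sqint (fourier_transform f)"
proof -
  have "sqint f = sqint (\<lambda>x. f (- x))" using f by (intro sqint_uminus_arg[symmetric]) auto
  also have "\<dots> = sqint (fourier_transform (fourier_transform f))"
    unfolding sqint_def using fourier_inversion[OF f] by (intro nn_integral_cong_AE) (auto elim!: eventually_mono)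
  also have "\<dots> \<le> 2 * sqint (fourier_transform f)"
    by (intro sqint_fourier_transform_le fourier_transform_L2 f)
  finally show ?thesis .
qed

section \<open>The singular weight at low frequencies\<close>

lemma nn_integral_powr_Icc:
  assumes "0 < p" "0 \<le> X"
  shows "(\<integral>\<^sup>+s. ennreal (s powr (p - 1)) * indicator {0..X} s \<partial>lborel) = ennreal (X powr p / p)"
proof -
  have "((\<lambda>s. s powr (p - 1)) has_integral (X powr p / p)) {0..X}"
    using has_integral_powr_from_0[of "p - 1" X] assms by simp
  then show ?thesis by (intro nn_integral_has_integral_lebesgue') auto
qed

lemma nn_integral_powr_atLeast:
  assumes "0 < p" "0 < X"
  shows "(\<integral>\<^sup>+s. ennreal (s powr (- p - 1)) * indicator {X..} s \<partial>lborel) = ennreal (X powr - p / p)"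
proof -
  have "((\<lambda>s. s powr (- p - 1)) has_integral (X powr - p / p)) {X..}"
    using has_integral_powr_to_inf[of "- p - 1" X] assms by simp
  then show ?thesis by (intro nn_integral_has_integral_lebesgue') auto
qed

lemma AE_nonzero: "AE x in lborel. (x::'a::euclidean_space) \<noteq> 0"
  by (rule AE_lborel_singleton)

text \<open>Layer cake: \<open>|x|\<^sup>-\<^sup>k\<close> is \<open>k\<close> times the integral of \<open>s\<^sup>-\<^sup>k\<^sup>-\<^sup>1\<close> over \<open>s \<ge> |x|\<close>, which reduces the
  claim to volumes of balls.\<close>

lemma nn_integral_norm_powr_cball:
  fixes k :: real
  assumes k: "0 < k" "k < real DIM('a::euclidean_space)"
  obtains C where "0 < C" "\<And>\<rho>. 0 < \<rho> \<Longrightarrow>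
    (\<integral>\<^sup>+(x::'a). ennreal (norm x powr - k) * indicator (cball 0 \<rho>) x \<partial>lborel) \<le> ennreal (C * \<rho> powr (DIM('a) - k))"
proof -
  let ?n = "real DIM('a)" and ?V = "unit_ball_vol (real DIM('a))"
  \<comment> \<open>The two terms come from s <= \<rho>, where the ball of radius s has volume
    \<open>?V\<close> s^n, and from s >= \<rho>, where the volume stays at \<open>?V\<close>
    \<rho>^n. The first integral converges because k < n.\<close>
  define C where "C = k * (?V / (?n - k) + ?V / k)"
  have V: "0 < ?V" by simp
  have C: "0 < C" unfolding C_def using k V by (intro mult_pos_pos add_pos_pos divide_pos_pos) auto
  have "(\<integral>\<^sup>+(x::'a). ennreal (norm x powr - k) * indicator (cball 0 \<rho>) x \<partial>lborel) \<le> ennreal (C * \<rho> powr (?n - k))"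
    if \<rho>: "0 < \<rho>" for \<rho>
  proof -
    have "(\<integral>\<^sup>+(x::'a). ennreal (norm x powr - k) * indicator (cball 0 \<rho>) x \<partial>lborel) =
        (\<integral>\<^sup>+(x::'a). \<integral>\<^sup>+s. ennreal k * (ennreal (s powr (- k - 1)) * indicator {norm x..} s * indicator (cball 0 \<rho>) x) \<partial>lborel \<partial>lborel)"
    proof (rule nn_integral_cong_AE, use AE_nonzero[where 'a='a] in eventually_elim)
      case (elim x)
      have "(\<integral>\<^sup>+s. ennreal k * (ennreal (s powr (- k - 1)) * indicator {norm x..} s * indicator (cball 0 \<rho>) x) \<partial>lborel) =
          ennreal k * ((\<integral>\<^sup>+s. ennreal (s powr (- k - 1)) * indicator {norm x..} s \<partial>lborel) * indicator (cball 0 \<rho>) x)"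
        by (simp add: nn_integral_cmult nn_integral_multc)
      also have "\<dots> = ennreal (norm x powr - k) * indicator (cball 0 \<rho>) x"
        using elim k by (subst nn_integral_powr_atLeast) (auto simp: ennreal_mult'[symmetric] mult.assoc[symmetric])
      finally show ?case by simp
    qed
    also have "\<dots> = (\<integral>\<^sup>+s. \<integral>\<^sup>+(x::'a). ennreal k * (ennreal (s powr (- k - 1)) * indicator {norm x..} s * indicator (cball 0 \<rho>) x) \<partial>lborel \<partial>lborel)"
      by (rule lborel_pair.Fubini') (simp add: indicator_def[of "{_..}"] split_beta')
    also have "\<dots> \<le> (\<integral>\<^sup>+s. ennreal k * (ennreal ?V * (ennreal (s powr ((?n - k) - 1)) * indicator {0..\<rho>} s) +
        ennreal (?V * \<rho> powr ?n) * (ennreal (s powr (- k - 1)) * indicator {\<rho>..} s)) \<partial>lborel)"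
    proof (rule nn_integral_mono)
      fix s :: real
      have "(\<integral>\<^sup>+(x::'a). ennreal k * (ennreal (s powr (- k - 1)) * indicator {norm x..} s * indicator (cball 0 \<rho>) x) \<partial>lborel) =
          (\<integral>\<^sup>+(x::'a). ennreal k * (ennreal (s powr (- k - 1)) * indicator (cball 0 s \<inter> cball 0 \<rho>) x) \<partial>lborel)"
        by (intro nn_integral_cong) (auto simp: indicator_def)
      also have "\<dots> = ennreal k * (ennreal (s powr (- k - 1)) * emeasure lborel (cball (0::'a) s \<inter> cball 0 \<rho>))"
        by (simp add: nn_integral_cmult)
      also have "\<dots> \<le> ennreal k * (ennreal ?V * (ennreal (s powr ((?n - k) - 1)) * indicator {0..\<rho>} s) +
          ennreal (?V * \<rho> powr ?n) * (ennreal (s powr (- k - 1)) * indicator {\<rho>..} s))"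
      proof (rule mult_left_mono)
        \<comment> \<open>For s < 0 the ball is empty, and at s = 0 the power of s is 0 by
          convention; the estimate has content only for s > 0.\<close>
        consider "s < 0" | "s = 0" | "0 < s" "s \<le> \<rho>" | "\<rho> < s" by linarith
        then show "ennreal (s powr (- k - 1)) * emeasure lborel (cball (0::'a) s \<inter> cball 0 \<rho>) \<le>
            ennreal ?V * (ennreal (s powr ((?n - k) - 1)) * indicator {0..\<rho>} s) +
            ennreal (?V * \<rho> powr ?n) * (ennreal (s powr (- k - 1)) * indicator {\<rho>..} s)"
        proof cases
          case 3
          then have "cball (0::'a) s \<inter> cball 0 \<rho> = cball 0 s" by auto
          moreover have "ennreal (s powr (- k - 1)) * emeasure lborel (cball (0::'a) s) =
              ennreal ?V * (ennreal (s powr ((?n - k) - 1)))"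
          proof -
            have "s powr (- k - 1) * s ^ DIM('a) = s powr ((?n - k) - 1)"
              using 3 by (simp add: powr_realpow[symmetric] powr_add[symmetric] algebra_simps)
            then show ?thesis using 3 V
              by (simp add: emeasure_cball ennreal_mult'[symmetric] mult.left_commute less_imp_le)
          qed
          ultimately show ?thesis using 3 by (simp add: add_increasing2)
        next
          case 4
          then have "cball (0::'a) s \<inter> cball 0 \<rho> = cball 0 \<rho>" by auto
          then show ?thesis using 4 \<rho> V
            by (simp add: emeasure_cball powr_realpow mult.commute)
        qed auto
      qed simp
      finally show "(\<integral>\<^sup>+(x::'a). ennreal k * (ennreal (s powr (- k - 1)) * indicator {norm x..} s * indicator (cball 0 \<rho>) x) \<partial>lborel) \<le>
        ennreal k * (ennreal ?V * (ennreal (s powr ((?n - k) - 1)) * indicator {0..\<rho>} s) +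
          ennreal (?V * \<rho> powr ?n) * (ennreal (s powr (- k - 1)) * indicator {\<rho>..} s))" .
    qed
    also have "\<dots> = ennreal k * (ennreal ?V * ennreal (\<rho> powr (?n - k) / (?n - k)) +
        ennreal (?V * \<rho> powr ?n) * ennreal (\<rho> powr - k / k))"
      using k \<rho> nn_integral_powr_Icc[of "?n - k" \<rho>] nn_integral_powr_atLeast[of k \<rho>]
      by (simp add: nn_integral_cmult nn_integral_add)
    also have "\<dots> = ennreal (k * (?V * (\<rho> powr (?n - k) / (?n - k)) + ?V * \<rho> powr ?n * (\<rho> powr - k / k)))"
      using k V by (simp add: ennreal_mult'[symmetric] ennreal_plus[symmetric] del: ennreal_plus)
    also have "k * (?V * (\<rho> powr (?n - k) / (?n - k)) + ?V * \<rho> powr ?n * (\<rho> powr - k / k)) = C * \<rho> powr (?n - k)"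
      using powr_add[of \<rho> ?n "- k"] by (simp add: C_def algebra_simps)
    finally show ?thesis .
  qed
  with C show ?thesis by (rule that)
qed

text \<open>Young's inequality after division by \<open>A powr (1 / p)\<close> and
  \<open>B powr (1 / q)\<close>. Upper bounds stand in place of the norms, so \<open>A\<close> may
  vanish although it occurs in a denominator; in that case u is 0 almost everywhere.\<close>

lemma nn_integral_Holder:
  fixes u v :: "'a \<Rightarrow> real" and p q A B :: real
  assumes [measurable]: "u \<in> borel_measurable M" "v \<in> borel_measurable M"
    and uv: "\<And>x. 0 \<le> u x" "\<And>x. 0 \<le> v x" and pq: "1 < p" "1 < q" "1 / p + 1 / q = 1"
    and A: "(\<integral>\<^sup>+x. ennreal (u x powr p) \<partial>M) \<le> ennreal A" "0 \<le> A"
    and B: "(\<integral>\<^sup>+x. ennreal (v x powr q) \<partial>M) \<le> ennreal B" "0 < B"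
  shows "(\<integral>\<^sup>+x. ennreal (u x * v x) \<partial>M) \<le> ennreal (A powr (1 / p) * B powr (1 / q))"
proof (cases "A = 0")
  case True
  then have "(\<integral>\<^sup>+x. ennreal (u x powr p) \<partial>M) = 0" using A by simp
  then have "AE x in M. u x = 0" by (subst (asm) nn_integral_0_iff_AE) auto
  then have "(\<integral>\<^sup>+x. ennreal (u x * v x) \<partial>M) = (\<integral>\<^sup>+x. 0 \<partial>M)"
    by (intro nn_integral_cong_AE) (auto elim!: eventually_mono)
  then show ?thesis by simp
next
  case False
  with A have A0: "0 < A" by simp
  let ?D = "A powr (1 / p) * B powr (1 / q)"
  have D: "0 < ?D" using A0 B by simp
  have pw: "u x * v x \<le> ?D * (1 / (p * A) * u x powr p + 1 / (q * B) * v x powr q)" for x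
  proof -
    have "(u x / A powr (1 / p)) * (v x / B powr (1 / q)) \<le>
        (u x / A powr (1 / p)) powr p / p + (v x / B powr (1 / q)) powr q / q"
      using pq uv by (intro Youngs_inequality) auto
    also have "\<dots> = 1 / (p * A) * u x powr p + 1 / (q * B) * v x powr q"
      using pq uv A0 B by (simp add: powr_divide powr_powr mult.commute)
    finally show ?thesis using A0 B by (simp add: field_simps)
  qed
  have "(\<integral>\<^sup>+x. ennreal (u x * v x) \<partial>M) \<le> (\<integral>\<^sup>+x. ennreal ?D * (ennreal (1 / (p * A)) * ennreal (u x powr p) +
      ennreal (1 / (q * B)) * ennreal (v x powr q)) \<partial>M)"
  proof (rule nn_integral_mono)
    fix x
    show "ennreal (u x * v x) \<le> ennreal ?D * (ennreal (1 / (p * A)) * ennreal (u x powr p) + ennreal (1 / (q * B)) * ennreal (v x powr q))"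
    proof -
      have "ennreal ?D * (ennreal (1 / (p * A)) * ennreal (u x powr p) + ennreal (1 / (q * B)) * ennreal (v x powr q)) =
          ennreal (?D * (1 / (p * A) * u x powr p + 1 / (q * B) * v x powr q))"
        using D pq A0 B by (simp only: ennreal_mult'[symmetric] ennreal_plus[symmetric] powr_ge_zero mult_nonneg_nonneg
            zero_le_divide_1_iff less_imp_le mult_pos_pos order.strict_trans[OF zero_less_one])
      then show ?thesis using ennreal_leI[OF pw[of x]] by simp
    qed
  qed
  also have "\<dots> = ennreal ?D * (ennreal (1 / (p * A)) * (\<integral>\<^sup>+x. ennreal (u x powr p) \<partial>M) +
      ennreal (1 / (q * B)) * (\<integral>\<^sup>+x. ennreal (v x powr q) \<partial>M))"
    by (simp add: nn_integral_cmult nn_integral_add)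
  also have "\<dots> \<le> ennreal ?D * (ennreal (1 / (p * A)) * ennreal A + ennreal (1 / (q * B)) * ennreal B)"
    by (intro mult_left_mono add_mono A B) auto
  also have "\<dots> = ennreal (?D * (1 / (p * A) * A + 1 / (q * B) * B))"
    using D pq A0 B by (simp only: ennreal_mult'[symmetric] ennreal_plus[symmetric] powr_ge_zero mult_nonneg_nonneg
            zero_le_divide_1_iff less_imp_le mult_pos_pos order.strict_trans[OF zero_less_one])
  also have "1 / (p * A) * A + 1 / (q * B) * B = 1" using A0 B pq by simp
  finally show ?thesis by simp
qed

lemma gauss_convolution_le':
  fixes h :: "'a::euclidean_space \<Rightarrow> real" and l m A :: real
  assumes [measurable]: "h \<in> borel_measurable borel" and h: "\<And>x. 0 \<le> h x"
    and l: "0 < l" and m: "1 < m" "m \<le> 2" and A: "0 \<le> A"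
    and hA: "(\<integral>\<^sup>+x. ennreal (h x powr m) \<partial>lborel) \<le> ennreal A"
  shows "(\<integral>\<^sup>+x. \<integral>\<^sup>+y. ennreal (h x * h y * gauss l (x - y)) \<partial>lborel \<partial>lborel) \<le>
    ennreal ((4 * pi * (m - 1) / (l * m)) powr (DIM('a) * (m - 1) / m) * A powr (2 / m))"
proof (cases "A = 0")
  case True
  then have "(\<integral>\<^sup>+x. ennreal (h x powr m) \<partial>lborel) = 0" using hA by simp
  then have "AE x in lborel. h x = 0" by (subst (asm) nn_integral_0_iff_AE) auto
  then have "(\<integral>\<^sup>+x. \<integral>\<^sup>+y. ennreal (h x * h y * gauss l (x - y)) \<partial>lborel \<partial>lborel) = (\<integral>\<^sup>+(x::'a). 0 \<partial>lborel)"
    by (intro nn_integral_cong_AE) (auto elim!: eventually_mono)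
  then show ?thesis by simp
next
  case False
  then show ?thesis using A by (intro gauss_convolution_le h l m hA) auto
qed

text \<open>Split at radius \<open>sqrt l\<close>: near the origin the weight controls the \<open>L\<^sup>1\<close> norm, far from it
  Young's inequality applies.\<close>

lemma gauss_fourier_transform_bound:
  fixes m c :: real
  assumes m: "1 < m" "m \<le> 2" and c: "0 < c" "c * (m / (m - 1)) < real DIM('a::euclidean_space)"
  obtains C where "0 < C" "\<And>(f::'a \<Rightarrow> complex) l A B. f \<in> Lp_space 2 \<Longrightarrow> 0 < l \<Longrightarrow> 0 \<le> A \<Longrightarrow> 0 \<le> B \<Longrightarrow>
    (\<integral>\<^sup>+x. ennreal ((norm x powr c * norm (f x)) powr m) * indicator (cball 0 (sqrt l)) x \<partial>lborel) \<le> ennreal A \<Longrightarrow>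
    (\<integral>\<^sup>+x. ennreal (norm (f x) powr m) * indicator (- cball 0 (sqrt l)) x \<partial>lborel) \<le> ennreal B \<Longrightarrow>
    gauss_energy l (fourier_transform f) \<le>
      ennreal (C * l powr - (DIM('a) * (1 / m - 1 / 2)) * (l powr - c * A powr (2 / m) + B powr (2 / m)))"
proof -
  let ?n = "real DIM('a)" and ?c = "unitary_const TYPE('a)"
  \<comment> \<open>The conjugate exponent of m. The hypothesis on c says that |x|^(-c q) is
    integrable near the origin, as Hoelder requires in the near part.\<close>
  define q where "q = m / (m - 1)"
  have q: "1 < q" "1 / m + 1 / q = 1" using m by (auto simp: q_def field_simps)
  have "0 < c * q" "c * q < ?n" using m c by (auto simp: q_def)
  then obtain K where K: "0 < K" "\<And>\<rho>. 0 < \<rho> \<Longrightarrow>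
    (\<integral>\<^sup>+(x::'a). ennreal (norm x powr - (c * q)) * indicator (cball 0 \<rho>) x \<partial>lborel) \<le> ennreal (K * \<rho> powr (?n - c * q))"
    using nn_integral_norm_powr_cball by metis
  define \<nu> where "\<nu> = ?n * (1 / m - 1 / 2)"
  define C1 where "C1 = (2 * pi) powr (?n / 2) * K powr (2 / q)"
  define C2 where "C2 = (2 * pi) powr (?n / 2) * (4 * pi * (m - 1) / m) powr (?n * (m - 1) / m)"
  \<comment> \<open>The 4 is a factor 2 from splitting f at the sphere of radius
    \<open>sqrt l\<close> and a factor 2 from replacing the truncated transform by its L^2
    limit.\<close>
  define C where "C = 4 * ?c\<^sup>2 * (C1 + C2)"
  have cpos: "0 < ?c" by (simp add: unitary_const_def)
  have C12: "0 < C1" "0 < C2" using K m by (auto simp: C1_def C2_def)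
  then have C: "0 < C" using cpos by (simp add: C_def)
  have mq: "(m - 1) / m = 1 / q" "1 / q = 1 - 1 / m" using q(2) by (auto simp: q_def)
  have L1: "(\<integral>\<^sup>+\<xi>. ennreal (gauss l \<xi>) * ennsq (fourier_integral (\<lambda>x. indicator S x *\<^sub>R f x) \<xi>) \<partial>lborel) \<le>
      ennreal (C1 * l powr (- \<nu> - c) * A powr (2 / m))"
    if f: "f \<in> borel_measurable borel" and i: "integrable lborel (\<lambda>x. indicator S x *\<^sub>R f x)"
      and S: "S \<in> sets borel" "S \<subseteq> cball 0 (sqrt l)" and l: "0 < l" and A: "0 \<le> A"
      and le: "(\<integral>\<^sup>+x. ennreal ((norm x powr c * norm (f x)) powr m) * indicator (cball 0 (sqrt l)) x \<partial>lborel) \<le> ennreal A"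
    for f :: "'a \<Rightarrow> complex" and S l A
  proof -
    have [measurable]: "f \<in> borel_measurable borel" "S \<in> sets borel" by fact+
    let ?g = "\<lambda>x. indicator S x *\<^sub>R f x"
    have "(\<integral>\<^sup>+x. ennreal (norm (?g x)) \<partial>lborel) \<le>
        (\<integral>\<^sup>+x. ennreal ((norm x powr c * norm (f x) * indicator (cball 0 (sqrt l)) x) * (norm x powr - c * indicator (cball 0 (sqrt l)) x)) \<partial>lborel)"
    proof (rule nn_integral_mono_AE, use AE_nonzero[where 'a='a] in eventually_elim)
      case (elim x)
      have "norm x powr c * norm x powr - c = 1" using elim by (simp add: powr_add[symmetric])
      then have "norm x powr c * norm (f x) * norm x powr - c = norm (f x)"
        by (simp only: mult.commute[of _ "norm (f x)"] mult.assoc mult_1_right)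
      note eq = this
      show ?case
      proof (cases "x \<in> S")
        case True
        then have "indicator S x = (1::real)" "indicator (cball 0 (sqrt l)) x = (1::real)"
          using S(2) by (auto simp: indicator_def)
        with eq show ?thesis by (simp only: scaleR_one mult_1_right order_refl)
      qed simp
    qed
    also have "\<dots> \<le> ennreal (A powr (1 / m) * (K * sqrt l powr (?n - c * q)) powr (1 / q))"
    proof (rule nn_integral_Holder[where p = m and q = q and A = A and B = "K * sqrt l powr (?n - c * q)" and
          u = "\<lambda>x. norm x powr c * norm (f x) * indicator (cball 0 (sqrt l)) x" and
          v = "\<lambda>x. norm x powr - c * indicator (cball 0 (sqrt l)) x"])
      have "ennreal ((norm x powr c * norm (f x) * indicator (cball 0 (sqrt l)) x) powr m) =
          ennreal ((norm x powr c * norm (f x)) powr m) * indicator (cball 0 (sqrt l)) x" for x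
        by (simp add: indicator_def)
      then show "(\<integral>\<^sup>+x. ennreal ((norm x powr c * norm (f x) * indicator (cball 0 (sqrt l)) x) powr m) \<partial>lborel) \<le> ennreal A"
        using le by simp
      have "ennreal ((norm x powr - c * indicator (cball 0 (sqrt l)) x) powr q) =
          ennreal (norm x powr - (c * q)) * indicator (cball 0 (sqrt l)) x" for x :: 'a
        by (simp add: indicator_def powr_powr)
      then show "(\<integral>\<^sup>+(x::'a). ennreal ((norm x powr - c * indicator (cball 0 (sqrt l)) x) powr q) \<partial>lborel) \<le>
          ennreal (K * sqrt l powr (?n - c * q))"
        using K(2)[of "sqrt l"] l by simp
      show "0 < K * sqrt l powr (?n - c * q)" using K l by simp
    qed (use m q A in auto)
    finally have n1: "(\<integral>\<^sup>+x. ennreal (norm (?g x)) \<partial>lborel) \<le> ennreal (A powr (1 / m) * (K * sqrt l powr (?n - c * q)) powr (1 / q))" .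
    have sq: "(sqrt l powr (?n - c * q)) powr (2 / q) = l powr (?n / q - c)"
    proof -
      have "1 / 2 * (?n - c * q) * (2 / q) = ?n / q - c" using q by (simp add: diff_divide_distrib)
      moreover have "sqrt l = l powr (1 / 2)" using l by (simp add: powr_half_sqrt)
      ultimately show ?thesis by (simp only: powr_powr)
    qed
    have "gauss_energy l (fourier_integral ?g) \<le>
        ennreal ((2 * pi / l) powr (?n / 2)) *
        (\<integral>\<^sup>+x. \<integral>\<^sup>+y. ennreal (norm (?g x) * norm (?g y) * gauss (1 / l) (x - y)) \<partial>lborel \<partial>lborel)"
      by (rule gauss_fourier_square_le[OF l i])
    also have "\<dots> \<le> ennreal ((2 * pi / l) powr (?n / 2)) *
        (\<integral>\<^sup>+x. \<integral>\<^sup>+y. ennreal (norm (?g x)) * ennreal (norm (?g y)) \<partial>lborel \<partial>lborel)"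
      using l by (intro mult_left_mono nn_integral_mono) (auto simp: ennreal_mult'[symmetric] intro!: ennreal_leI mult_left_le gauss_le_1)
    also have "\<dots> = ennreal ((2 * pi / l) powr (?n / 2)) * ((\<integral>\<^sup>+x. ennreal (norm (?g x)) \<partial>lborel) * (\<integral>\<^sup>+x. ennreal (norm (?g x)) \<partial>lborel))"
      by (subst nn_integral_cmult, measurable) (subst nn_integral_multc, auto)
    also have "\<dots> \<le> ennreal ((2 * pi / l) powr (?n / 2)) * (ennreal (A powr (1 / m) * (K * sqrt l powr (?n - c * q)) powr (1 / q)) *
        ennreal (A powr (1 / m) * (K * sqrt l powr (?n - c * q)) powr (1 / q)))"
      by (intro mult_left_mono mult_mono n1) auto
    also have "\<dots> = ennreal ((2 * pi / l) powr (?n / 2) * ((A powr (1 / m) * (K * sqrt l powr (?n - c * q)) powr (1 / q)) *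
        (A powr (1 / m) * (K * sqrt l powr (?n - c * q)) powr (1 / q))))"
      by (simp only: ennreal_mult'[symmetric] mult_nonneg_nonneg powr_ge_zero)
    also have "(A powr (1 / m) * (K * sqrt l powr (?n - c * q)) powr (1 / q)) * (A powr (1 / m) * (K * sqrt l powr (?n - c * q)) powr (1 / q)) =
        A powr (1 / m + 1 / m) * (K * sqrt l powr (?n - c * q)) powr (1 / q + 1 / q)"
      by (simp only: powr_add mult_ac)
    also have "(2 * pi / l) powr (?n / 2) * (A powr (1 / m + 1 / m) * (K * sqrt l powr (?n - c * q)) powr (1 / q + 1 / q)) =
        (2 * pi) powr (?n / 2) * K powr (2 / q) * (l powr (- (?n / 2)) * l powr (?n / q - c)) * A powr (2 / m)"
      using l K(1) q(1) by (simp add: powr_mult sq powr_divide powr_minus divide_simps)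
    also have "l powr (- (?n / 2)) * l powr (?n / q - c) = l powr (- \<nu> - c)"
    proof -
      have "?n / q = ?n * (1 / q)" by simp
      then have "- (?n / 2) + (?n / q - c) = - \<nu> - c"
        unfolding mq(2) \<nu>_def by (simp add: right_diff_distrib)
      then show ?thesis by (simp only: powr_add[symmetric])
    qed
    finally show ?thesis by (simp add: C1_def)
  qed
  have L2: "(\<integral>\<^sup>+\<xi>. ennreal (gauss l \<xi>) * ennsq (fourier_integral (\<lambda>x. indicator S x *\<^sub>R f x) \<xi>) \<partial>lborel) \<le>
      ennreal (C2 * l powr - \<nu> * B powr (2 / m))"
    if f: "f \<in> borel_measurable borel" and i: "integrable lborel (\<lambda>x. indicator S x *\<^sub>R f x)"
      and S: "S \<in> sets borel" "S \<subseteq> - cball 0 (sqrt l)" and l: "0 < l" and B: "0 \<le> B"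
      and le: "(\<integral>\<^sup>+x. ennreal (norm (f x) powr m) * indicator (- cball 0 (sqrt l)) x \<partial>lborel) \<le> ennreal B"
    for f :: "'a \<Rightarrow> complex" and S l B
  proof -
    have [measurable]: "f \<in> borel_measurable borel" "S \<in> sets borel" by fact+
    let ?g = "\<lambda>x. indicator S x *\<^sub>R f x"
    have gB: "(\<integral>\<^sup>+x. ennreal (norm (?g x) powr m) \<partial>lborel) \<le> ennreal B"
    proof (rule order_trans[OF nn_integral_mono le])
      fix x
      show "ennreal (norm (?g x) powr m) \<le> ennreal (norm (f x) powr m) * indicator (- cball 0 (sqrt l)) x"
        using S(2) by (auto simp: indicator_def)
    qed
    have "gauss_energy l (fourier_integral ?g) \<le>
        ennreal ((2 * pi / l) powr (?n / 2)) *
        (\<integral>\<^sup>+x. \<integral>\<^sup>+y. ennreal (norm (?g x) * norm (?g y) * gauss (1 / l) (x - y)) \<partial>lborel \<partial>lborel)"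
      by (rule gauss_fourier_square_le[OF l i])
    also have "\<dots> \<le> ennreal ((2 * pi / l) powr (?n / 2)) *
        ennreal ((4 * pi * (m - 1) / (1 / l * m)) powr (?n * (m - 1) / m) * B powr (2 / m))"
      using l m B gB by (intro mult_left_mono gauss_convolution_le'[where h = "\<lambda>x. norm (?g x)"]) auto
    also have "\<dots> = ennreal ((2 * pi / l) powr (?n / 2) * ((4 * pi * (m - 1) / (1 / l * m)) powr (?n * (m - 1) / m) * B powr (2 / m)))"
      by (simp only: ennreal_mult'[symmetric] mult_nonneg_nonneg powr_ge_zero)
    also have "4 * pi * (m - 1) / (1 / l * m) = 4 * pi * (m - 1) / m * l" using l by simp
    also have "(2 * pi / l) powr (?n / 2) * ((4 * pi * (m - 1) / m * l) powr (?n * (m - 1) / m) * B powr (2 / m)) =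
        (2 * pi) powr (?n / 2) * (4 * pi * (m - 1) / m) powr (?n * (m - 1) / m) *
        (l powr (- (?n / 2)) * l powr (?n * (m - 1) / m)) * B powr (2 / m)"
    proof -
      have "(2 * pi / l) powr (?n / 2) = (2 * pi) powr (?n / 2) * l powr (- (?n / 2))"
        using l by (simp add: powr_divide powr_minus_divide)
      moreover have "(4 * pi * (m - 1) / m * l) powr (?n * (m - 1) / m) =
          (4 * pi * (m - 1) / m) powr (?n * (m - 1) / m) * l powr (?n * (m - 1) / m)"
        by (rule powr_mult)
      ultimately show ?thesis by (simp only: mult_ac)
    qed
    also have "l powr (- (?n / 2)) * l powr (?n * (m - 1) / m) = l powr - \<nu>"
    proof -
      have "?n * (m - 1) / m = ?n * (1 - 1 / m)"
        by (simp only: times_divide_eq_right[symmetric] mq)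
      then have "- (?n / 2) + ?n * (m - 1) / m = - \<nu>"
        unfolding \<nu>_def by (simp add: right_diff_distrib)
      then show ?thesis by (simp only: powr_add[symmetric])
    qed
    finally show ?thesis by (simp add: C2_def)
  qed
  have "gauss_energy l (fourier_transform f) \<le>
      ennreal (C * l powr - \<nu> * (l powr - c * A powr (2 / m) + B powr (2 / m)))"
    if f: "f \<in> Lp_space 2" and l: "0 < l" and A: "0 \<le> A" and B: "0 \<le> B"
      and leA: "(\<integral>\<^sup>+x. ennreal ((norm x powr c * norm (f x)) powr m) * indicator (cball 0 (sqrt l)) x \<partial>lborel) \<le> ennreal A"
      and leB: "(\<integral>\<^sup>+x. ennreal (norm (f x) powr m) * indicator (- cball 0 (sqrt l)) x \<partial>lborel) \<le> ennreal B"
    for f :: "'a \<Rightarrow> complex" and l A B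
  proof -
    have fm [measurable]: "f \<in> borel_measurable borel" using f by measurable
    have Fm [measurable]: "fourier_transform f \<in> borel_measurable borel" using f by (rule fourier_transform_measurable)
    define X where "X = C1 * l powr (- \<nu> - c) * A powr (2 / m)"
    define Y where "Y = C2 * l powr - \<nu> * B powr (2 / m)"
    have XY: "0 \<le> X" "0 \<le> Y" using C12 by (auto simp: X_def Y_def)
    \<comment> \<open>The Fourier integrals of the two pieces are available only after truncation to
      a ball, where the pieces are integrable. The bound does not depend on R and so passes to the
      limit.\<close>
    have trunc: "gauss_energy l (truncated_fourier R f) \<le>
        ennreal (2 * ?c\<^sup>2 * (X + Y))" for R
    proof -
      define S1 where "S1 = cball (0::'a) R \<inter> cball 0 (sqrt l)"
      define S2 where "S2 = cball (0::'a) R - cball 0 (sqrt l)"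
      define g1 where "g1 x = indicator S1 x *\<^sub>R f x" for x
      define g2 where "g2 x = indicator S2 x *\<^sub>R f x" for x
      have [measurable]: "S1 \<in> sets borel" "S2 \<in> sets borel" by (auto simp: S1_def S2_def)
      have [measurable]: "g1 \<in> borel_measurable borel" "g2 \<in> borel_measurable borel"
        unfolding g1_def[abs_def] g2_def[abs_def] by measurable
      have i: "integrable lborel g1" "integrable lborel g2"
        by (rule Bochner_Integration.integrable_bound[OF integrable_cutoff[OF f, of R]];
            auto simp: g1_def g2_def S1_def S2_def cutoff_def indicator_def)+
      have "cutoff R f = (\<lambda>x. g1 x + g2 x)"
        by (auto simp: fun_eq_iff cutoff_def g1_def g2_def S1_def S2_def indicator_def)
      then have eq: "truncated_fourier R f \<xi> = ?c *\<^sub>R (fourier_integral g1 \<xi> + fourier_integral g2 \<xi>)" for \<xi>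
        using fourier_integral_add[OF i] by (simp add: truncated_fourier_eq)
      have "gauss_energy l (truncated_fourier R f) =
          ennreal (?c\<^sup>2) * (\<integral>\<^sup>+\<xi>. ennreal (gauss l \<xi>) * ennsq (fourier_integral g1 \<xi> + fourier_integral g2 \<xi>) \<partial>lborel)"
        unfolding eq by (subst nn_integral_cmult[symmetric])
          (auto simp: power_mult_distrib ennreal_mult' mult_ac intro!: nn_integral_cong)
      also have "\<dots> \<le> ennreal (?c\<^sup>2) * (2 * gauss_energy l (fourier_integral g1) +
          2 * gauss_energy l (fourier_integral g2))"
        by (intro mult_left_mono weighted_sqint_add_le) auto
      also have "\<dots> \<le> ennreal (?c\<^sup>2) * (2 * ennreal X + 2 * ennreal Y)"
      proof (intro mult_left_mono add_mono)
        show "gauss_energy l (fourier_integral g1) \<le> ennreal X"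
          unfolding g1_def[abs_def] X_def
          by (rule L1[OF fm _ _ _ l A leA]) (use i in \<open>auto simp: g1_def[abs_def] S1_def\<close>)
        show "gauss_energy l (fourier_integral g2) \<le> ennreal Y"
          unfolding g2_def[abs_def] Y_def
          by (rule L2[OF fm _ _ _ l B leB]) (use i in \<open>auto simp: g2_def[abs_def] S2_def\<close>)
      qed auto
      also have "\<dots> = ennreal (2 * ?c\<^sup>2 * (X + Y))"
        using XY by (simp add: ennreal_mult ennreal_plus distrib_left distrib_right mult_ac)
      finally show ?thesis .
    qed
    have "((\<lambda>R. 2 * ennreal (2 * ?c\<^sup>2 * (X + Y)) + 2 * sqint (\<lambda>x. truncated_fourier R f x - fourier_transform f x)) \<longlongrightarrow>
        2 * ennreal (2 * ?c\<^sup>2 * (X + Y)) + 2 * 0) at_top"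
      by (intro tendsto_add tendsto_const ennreal_tendsto_cmult truncated_fourier_tendsto
          is_fourier_transform_fourier_transform f) auto
    moreover have "gauss_energy l (fourier_transform f) \<le>
        2 * ennreal (2 * ?c\<^sup>2 * (X + Y)) + 2 * sqint (\<lambda>x. truncated_fourier R f x - fourier_transform f x)" for R
    proof -
      have "(\<integral>\<^sup>+\<xi>. ennreal (gauss l \<xi>) * ennsq (truncated_fourier R f \<xi> + (fourier_transform f \<xi> - truncated_fourier R f \<xi>)) \<partial>lborel) \<le>
          2 * gauss_energy l (truncated_fourier R f) +
          2 * (\<integral>\<^sup>+\<xi>. ennreal (gauss l \<xi>) * ennsq (fourier_transform f \<xi> - truncated_fourier R f \<xi>) \<partial>lborel)"
        by (intro weighted_sqint_add_le) auto
      also have "\<dots> \<le> 2 * ennreal (2 * ?c\<^sup>2 * (X + Y)) + 2 * sqint (\<lambda>x. truncated_fourier R f x - fourier_transform f x)"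
      proof (intro add_mono mult_left_mono trunc)
        show "(\<integral>\<^sup>+\<xi>. ennreal (gauss l \<xi>) * ennsq (fourier_transform f \<xi> - truncated_fourier R f \<xi>) \<partial>lborel) \<le>
            sqint (\<lambda>x. truncated_fourier R f x - fourier_transform f x)"
          unfolding sqint_def norm_minus_commute[of "truncated_fourier _ _ _"] using l
          by (intro nn_integral_mono) (auto simp: ennreal_mult'[symmetric] intro!: ennreal_leI mult_left_le_one_le gauss_le_1)
      qed auto
      finally show ?thesis by simp
    qed
    ultimately have "gauss_energy l (fourier_transform f) \<le>
        2 * ennreal (2 * ?c\<^sup>2 * (X + Y)) + 2 * 0"
      by (intro tendsto_lowerbound[where F = at_top and f = "\<lambda>R. 2 * ennreal (2 * ?c\<^sup>2 * (X + Y)) + 2 * sqint (\<lambda>x. truncated_fourier R f x - fourier_transform f x)"]) auto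
    also have "\<dots> = ennreal (4 * ?c\<^sup>2 * (X + Y))"
      using XY by (simp add: ennreal_mult' mult.assoc[symmetric])
    also have "\<dots> \<le> ennreal (C * l powr - \<nu> * (l powr - c * A powr (2 / m) + B powr (2 / m)))"
    proof (rule ennreal_leI)
      have "X \<le> (C1 + C2) * (l powr - \<nu> * (l powr - c * A powr (2 / m)))"
        using C12 l by (simp add: X_def powr_diff powr_minus_divide mult_right_mono divide_right_mono)
      moreover have "Y \<le> (C1 + C2) * (l powr - \<nu> * B powr (2 / m))"
        using C12 l by (simp add: Y_def mult_right_mono)
      ultimately have "4 * ?c\<^sup>2 * (X + Y) \<le> 4 * ?c\<^sup>2 * ((C1 + C2) * (l powr - \<nu> * (l powr - c * A powr (2 / m))) +
          (C1 + C2) * (l powr - \<nu> * B powr (2 / m)))"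
        by (intro mult_left_mono add_mono) auto
      then show "4 * ?c\<^sup>2 * (X + Y) \<le> C * l powr - \<nu> * (l powr - c * A powr (2 / m) + B powr (2 / m))"
        by (simp add: C_def algebra_simps)
    qed
    finally show ?thesis .
  qed
  then show ?thesis using that[OF C] by (simp add: \<nu>_def)
qed

section \<open>The low-frequency weight and its superposition of Gaussians\<close>

lemma power2_powr:
  fixes x p :: real
  assumes "0 < x"
  shows "(x\<^sup>2) powr p = x powr (2 * p)"
proof -
  have "x\<^sup>2 = x powr 2" using assms by simp
  then show ?thesis by (simp only: powr_powr)
qed

lemma inverse_power2_powr:
  fixes x p :: real
  assumes "0 < x"
  shows "(1 / x\<^sup>2) powr p = x powr (- (2 * p))"
  unfolding powr_divide power2_powr[OF assms] by (simp add: powr_minus_divide)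

text \<open>The profile of the propagators at low frequency: \<open>r powr - a\<close> is the
  singularity that the weight of the data pays for, and the minimum records decay beyond the
  frequency 1 / T. Any \<kappa> above n (1/m - 1/2) yields the rate T^(-n (1/m - 1/2)) in
  \<open>low_frequency_bound\<close>.\<close>

definition low_weight :: "real \<Rightarrow> real \<Rightarrow> real \<Rightarrow> real \<Rightarrow> real" where
  "low_weight a \<kappa> T r = r powr - a * min 1 ((T * r) powr - \<kappa>)"

lemma low_weight_nonneg [simp]: "0 \<le> low_weight a \<kappa> T r"
  by (simp add: low_weight_def)

lemma borel_measurable_low_weight [measurable]:
  "low_weight a \<kappa> T \<in> borel_measurable borel"
  unfolding low_weight_def by measurable

text \<open>The squared weight is dominated by a superposition of Gaussians; the part
  \<open>s \<in> [r\<^sup>-\<^sup>2, 2 r\<^sup>-\<^sup>2]\<close> of the superposition is enough.\<close>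

lemma low_weight_square_le:
  fixes x :: "'a::euclidean_space"
  assumes a: "0 < a" and \<kappa>: "0 \<le> \<kappa>" and T: "0 < T"
  shows "ennreal ((low_weight a \<kappa> T (norm x))\<^sup>2) \<le> ennreal (2 * exp 1) *
    (\<integral>\<^sup>+s. ennreal (s powr (a - 1) * min 1 ((s / T\<^sup>2) powr \<kappa>)) * indicator {0..} s * ennreal (gauss s x) \<partial>lborel)"
proof (cases "x = 0")
  case True
  then show ?thesis by (simp add: low_weight_def)
next
  case False
  define r where "r = norm x"
  have r: "0 < r" using False by (simp add: r_def)
  define W where "W = (low_weight a \<kappa> T r)\<^sup>2"
  have W: "W = r powr (- (2 * a)) * min 1 ((T * r) powr - (2 * \<kappa>))"
  proof -
    have "(r powr - a)\<^sup>2 = r powr (- (2 * a))" by (simp add: power2_eq_square powr_add[symmetric])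
    moreover have "(min 1 ((T * r) powr - \<kappa>))\<^sup>2 = min 1 ((T * r) powr - (2 * \<kappa>))"
    proof (cases "(T * r) powr - \<kappa> \<le> 1")
      case True
      then have "((T * r) powr - \<kappa>)\<^sup>2 \<le> 1" by (simp add: power_le_one)
      with True show ?thesis by (simp add: min_def power2_eq_square powr_add[symmetric])
    next
      case False
      then have "1 \<le> ((T * r) powr - \<kappa>)\<^sup>2" by simp
      with False show ?thesis by (simp add: min_def power2_eq_square powr_add[symmetric])
    qed
    ultimately show ?thesis by (simp add: W_def low_weight_def power_mult_distrib)
  qed
  have W0: "0 \<le> W" by (simp add: W_def)
  \<comment> \<open>Here s r^2 lies between 1 and 2, so the Gaussian is at least
    \<open>exp (- 1)\<close> and the powers of s are comparable to those of r^(-2). The length of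
    the interval is r^(-2), which explains the factor r^2 in the pointwise bound.\<close>
  define I where "I = {1 / r\<^sup>2 .. 2 / r\<^sup>2}"
  have pw: "W * r\<^sup>2 / (2 * exp 1) \<le> s powr (a - 1) * min 1 ((s / T\<^sup>2) powr \<kappa>) * gauss s x" if s: "s \<in> I" for s
  proof -
    have s1: "1 / r\<^sup>2 \<le> s" "s \<le> 2 / r\<^sup>2" using s by (auto simp: I_def)
    have s0: "0 < s" using s1(1) r by (meson divide_pos_pos less_le_trans zero_less_one zero_less_power)
    have e: "exp (- 1) \<le> gauss s x"
      using s1(2) r by (simp add: gauss_def r_def[symmetric] field_simps)
    have "r powr (- (2 * a)) = (1 / r\<^sup>2) powr a"
      by (rule inverse_power2_powr[OF r, symmetric])
    also have "\<dots> \<le> s powr a" using s1(1) r a by (intro powr_mono2) auto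
    finally have "r powr (- (2 * a)) * (r\<^sup>2 / 2) \<le> s powr a * (1 / s)"
      using s1(2) r s0 by (intro mult_mono) (auto simp: field_simps)
    also have "s powr a * (1 / s) = s powr (a - 1)" using s0 by (simp add: powr_diff)
    finally have p1: "r powr (- (2 * a)) * (r\<^sup>2 / 2) \<le> s powr (a - 1)" .
    have "(T * r) powr - (2 * \<kappa>) = (1 / (T * r)\<^sup>2) powr \<kappa>"
      using r T by (intro inverse_power2_powr[symmetric]) simp
    also have "\<dots> = (1 / r\<^sup>2 / T\<^sup>2) powr \<kappa>" by (simp add: power_mult_distrib mult.commute)
    also have "\<dots> \<le> (s / T\<^sup>2) powr \<kappa>" using s1(1) r T \<kappa> by (intro powr_mono2 divide_right_mono) auto
    finally have p2: "min 1 ((T * r) powr - (2 * \<kappa>)) \<le> min 1 ((s / T\<^sup>2) powr \<kappa>)" by auto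
    have "W * r\<^sup>2 / (2 * exp 1) = (r powr (- (2 * a)) * (r\<^sup>2 / 2)) * min 1 ((T * r) powr - (2 * \<kappa>)) * exp (- 1)"
      by (simp add: W exp_minus field_simps)
    also have "\<dots> \<le> s powr (a - 1) * min 1 ((s / T\<^sup>2) powr \<kappa>) * gauss s x"
      by (intro mult_mono p1 p2 e) auto
    finally show ?thesis .
  qed
  have "ennreal W = ennreal (2 * exp 1) * (ennreal (W * r\<^sup>2 / (2 * exp 1)) * ennreal (1 / r\<^sup>2))"
    using r W0 by (simp add: ennreal_mult'[symmetric])
  also have "ennreal (1 / r\<^sup>2) = emeasure lborel I"
    using r by (simp add: I_def divide_right_mono diff_divide_distrib[symmetric])
  also have "ennreal (W * r\<^sup>2 / (2 * exp 1)) * emeasure lborel I =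
      (\<integral>\<^sup>+s. ennreal (W * r\<^sup>2 / (2 * exp 1)) * indicator I s \<partial>lborel)"
    by (subst nn_integral_cmult_indicator) (auto simp: I_def)
  also have "\<dots> \<le> (\<integral>\<^sup>+s. ennreal (s powr (a - 1) * min 1 ((s / T\<^sup>2) powr \<kappa>)) * indicator {0..} s * ennreal (gauss s x) \<partial>lborel)"
  proof (rule nn_integral_mono)
    fix s
    have "s \<in> I \<Longrightarrow> 0 \<le> s" using r by (auto simp: I_def intro: order_trans[rotated])
    then show "ennreal (W * r\<^sup>2 / (2 * exp 1)) * indicator I s \<le>
      ennreal (s powr (a - 1) * min 1 ((s / T\<^sup>2) powr \<kappa>)) * indicator {0..} s * ennreal (gauss s x)"
      using pw[of s] by (cases "s \<in> I") (auto simp: ennreal_mult'[symmetric] intro!: ennreal_leI)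
  qed
  finally show ?thesis by (simp add: W_def r_def mult_left_mono)
qed

text \<open>A form of Pitt's inequality. For \<open>m < 2\<close> the Gaussian bounds are integrable in \<open>s\<close> because
  \<open>\<nu> > 0\<close>; for \<open>m = 2\<close> one has to integrate in \<open>s\<close> before estimating the two moments.\<close>

lemma low_frequency_bound:
  fixes m a \<kappa> :: real
  assumes m: "1 < m" "m \<le> 2" and a: "0 < a" "a * (m / (m - 1)) < real DIM('a::euclidean_space)"
    and \<kappa>: "DIM('a) * (1 / m - 1 / 2) < \<kappa>"
  obtains C where "0 < C" "\<And>(f::'a \<Rightarrow> complex) T. f \<in> Lp_space 2 \<Longrightarrow> f \<in> weighted_Lp_space a m \<Longrightarrow> 0 < T \<Longrightarrow>
    sqint (\<lambda>\<xi>. low_weight a \<kappa> T (norm \<xi>) *\<^sub>R fourier_transform f \<xi>) \<le>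
      ennreal ((C * T powr - (DIM('a) * (1 / m - 1 / 2)) * weighted_Lp_norm a m f)\<^sup>2)"
proof -
  define q where "q = m / (m - 1)"
  define n where "n = real DIM('a)"
  define \<nu> where "\<nu> = n * (1 / m - 1 / 2)"
  have q: "1 < q" using m by (simp add: q_def)
  have "a < n / q" using a q by (simp add: q_def[symmetric] n_def field_simps)
  \<comment> \<open>There is room between a and n / q: c < n / q is the integrability condition of
    \<open>gauss_fourier_transform_bound\<close>, and c > a makes the integral of s^(-(c - a) - 1)
    over s >= |x|^2 converge when m = 2.\<close>
  then obtain c where c: "a < c" "c < n / q" using dense by blast
  have c0: "0 < c" "c * (m / (m - 1)) < real DIM('a)"
    using c a q by (auto simp: q_def[symmetric] n_def field_simps)
  obtain C where C: "0 < C" and bnd: "\<And>(f::'a \<Rightarrow> complex) l A B. f \<in> Lp_space 2 \<Longrightarrow> 0 < l \<Longrightarrow> 0 \<le> A \<Longrightarrow> 0 \<le> B \<Longrightarrow>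
    (\<integral>\<^sup>+x. ennreal ((norm x powr c * norm (f x)) powr m) * indicator (cball 0 (sqrt l)) x \<partial>lborel) \<le> ennreal A \<Longrightarrow>
    (\<integral>\<^sup>+x. ennreal (norm (f x) powr m) * indicator (- cball 0 (sqrt l)) x \<partial>lborel) \<le> ennreal B \<Longrightarrow>
    gauss_energy l (fourier_transform f) \<le>
      ennreal (C * l powr - (DIM('a) * (1 / m - 1 / 2)) * (l powr - c * A powr (2 / m) + B powr (2 / m)))"
    using gauss_fourier_transform_bound[OF m c0] by blast
  have "DIM('a) * (1 / m - 1 / 2) = \<nu>" by (simp add: \<nu>_def n_def)
  note bound = bnd[unfolded this]
  have \<nu>: "0 \<le> \<nu>" "\<nu> < \<kappa>" using m \<kappa> by (auto simp: \<nu>_def n_def field_simps)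
  have F_le: "sqint (\<lambda>\<xi>. low_weight a \<kappa> T (norm \<xi>) *\<^sub>R fourier_transform f \<xi>) \<le> ennreal (2 * exp 1) *
      (\<integral>\<^sup>+s. ennreal (s powr (a - 1) * min 1 ((s / T\<^sup>2) powr \<kappa>)) * indicator {0..} s *
        gauss_energy s (fourier_transform f) \<partial>lborel)"
    if f: "f \<in> Lp_space 2" and T: "0 < T" for f :: "'a \<Rightarrow> complex" and T
  proof -
    have [measurable]: "fourier_transform f \<in> borel_measurable borel" using f by (rule fourier_transform_measurable)
    have [measurable]: "(\<lambda>(s, x). gauss s (x::'a)) \<in> borel_measurable (borel \<Otimes>\<^sub>M borel)"
      unfolding gauss_def by measurable
    let ?w = "\<lambda>s. ennreal (s powr (a - 1) * min 1 ((s / T\<^sup>2) powr \<kappa>)) * indicator {0..} s"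
    have "sqint (\<lambda>\<xi>. low_weight a \<kappa> T (norm \<xi>) *\<^sub>R fourier_transform f \<xi>) =
        (\<integral>\<^sup>+\<xi>. ennreal ((low_weight a \<kappa> T (norm \<xi>))\<^sup>2) * ennsq (fourier_transform f \<xi>) \<partial>lborel)"
      unfolding sqint_def by (intro nn_integral_cong) (simp add: power_mult_distrib ennreal_mult')
    also have "\<dots> \<le> (\<integral>\<^sup>+\<xi>. (ennreal (2 * exp 1) * (\<integral>\<^sup>+s. ?w s * ennreal (gauss s \<xi>) \<partial>lborel)) *
        ennsq (fourier_transform f \<xi>) \<partial>lborel)"
      using a \<nu> T by (intro nn_integral_mono mult_right_mono low_weight_square_le) auto
    also have "\<dots> = (\<integral>\<^sup>+\<xi>. \<integral>\<^sup>+s. ennreal (2 * exp 1) * (?w s * (ennreal (gauss s \<xi>) * ennsq (fourier_transform f \<xi>))) \<partial>lborel \<partial>lborel)"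
      by (intro nn_integral_cong) (simp add: nn_integral_cmult[symmetric] nn_integral_multc[symmetric] mult.assoc)
    also have "\<dots> = (\<integral>\<^sup>+s. \<integral>\<^sup>+\<xi>. ennreal (2 * exp 1) * (?w s * (ennreal (gauss s \<xi>) * ennsq (fourier_transform f \<xi>))) \<partial>lborel \<partial>lborel)"
      by (rule lborel_pair.Fubini') measurable
    also have "\<dots> = ennreal (2 * exp 1) * (\<integral>\<^sup>+s. ?w s * gauss_energy s (fourier_transform f) \<partial>lborel)"
      by (simp add: nn_integral_cmult)
    finally show ?thesis .
  qed
  have M: "(\<integral>\<^sup>+x. ennreal ((norm x powr a * norm (f x)) powr m) \<partial>lborel) = ennreal ((weighted_Lp_norm a m f) powr m)"
    if "f \<in> weighted_Lp_space a m" for f :: "'a \<Rightarrow> complex"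
  proof -
    have i: "integrable lborel (\<lambda>x. (norm x powr a * norm (f x)) powr m)"
      using that by (simp add: weighted_Lp_space_def Lp_space_def)
    then show ?thesis
      using m by (simp add: nn_integral_eq_integral weighted_Lp_norm_def Lp_norm_def powr_powr integral_nonneg_AE)
  qed
  have main: "\<exists>K>0. \<forall>(f::'a \<Rightarrow> complex) T. f \<in> Lp_space 2 \<longrightarrow> f \<in> weighted_Lp_space a m \<longrightarrow> 0 < T \<longrightarrow>
      (\<integral>\<^sup>+s. ennreal (s powr (a - 1) * min 1 ((s / T\<^sup>2) powr \<kappa>)) * indicator {0..} s *
        gauss_energy s (fourier_transform f) \<partial>lborel) \<le>
      ennreal (K * T powr - (2 * \<nu>) * (weighted_Lp_norm a m f)\<^sup>2)"
  proof (cases "m = 2")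
    case False
    then have \<nu>0: "0 < \<nu>" using m by (simp add: \<nu>_def n_def field_simps)
    \<comment> \<open>The superposition is split at s = T^2: below, the factor (s / T^2)^\<kappa>
      gives the term with \<kappa> - \<nu>; above, the bare power s^(-\<nu> - 1) gives the term with
      \<nu>. The 2 counts the near and the far part in x, which obey the same bound.\<close>
    define K where "K = 2 * C * (1 / (\<kappa> - \<nu>) + 1 / \<nu>)"
    have K: "0 < K" unfolding K_def using C \<nu> \<nu>0 by (intro mult_pos_pos add_pos_pos) auto
    show ?thesis
    proof (intro exI[of _ K] conjI K allI impI)
      fix f :: "'a \<Rightarrow> complex" and T :: real
      assume f: "f \<in> Lp_space 2" and fw: "f \<in> weighted_Lp_space a m" and T: "0 < T"
      have [measurable]: "f \<in> borel_measurable borel" using f by measurable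
      define N where "N = weighted_Lp_norm a m f"
      have N: "0 \<le> N" by (simp add: N_def weighted_Lp_norm_def)
      \<comment> \<open>Within radius \<open>sqrt s\<close> one has |x|^c <= s^((c - a) / 2) |x|^a,
        and outside 1 <= s^(-a / 2) |x|^a. Both moments are thus bounded by the weighted norm, with
        the same total power of s.\<close>
      have Qs: "gauss_energy s (fourier_transform f) \<le>
          ennreal (2 * C * N\<^sup>2 * s powr (- \<nu> - a))" if s: "0 < s" for s
      proof -
        have sq: "sqrt s powr p = s powr (p / 2)" for p
          using s by (simp add: powr_half_sqrt[symmetric] powr_powr)
        have "gauss_energy s (fourier_transform f) \<le>
          ennreal (C * s powr - \<nu> * (s powr - c * (s powr ((c - a) * m / 2) * N powr m) powr (2 / m) +
            (s powr (- a * m / 2) * N powr m) powr (2 / m)))"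
        proof (rule bound[OF f s])
          have "(\<integral>\<^sup>+x. ennreal ((norm x powr c * norm (f x)) powr m) * indicator (cball 0 (sqrt s)) x \<partial>lborel) \<le>
              (\<integral>\<^sup>+x. ennreal (s powr ((c - a) * m / 2)) * ennreal ((norm x powr a * norm (f x)) powr m) \<partial>lborel)"
          proof (rule nn_integral_mono)
            fix x :: 'a
            have "(norm x powr c * norm (f x)) powr m \<le> s powr ((c - a) * m / 2) * (norm x powr a * norm (f x)) powr m"
              if x: "norm x \<le> sqrt s"
            proof -
              have "norm x powr c = norm x powr (c - a) * norm x powr a" by (simp add: powr_add[symmetric])
              also have "\<dots> \<le> s powr ((c - a) / 2) * norm x powr a"
                unfolding sq[symmetric] using x c by (intro mult_right_mono powr_mono2) auto
              finally have "(norm x powr c * norm (f x)) powr m \<le> (s powr ((c - a) / 2) * norm x powr a * norm (f x)) powr m"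
                using m by (intro powr_mono2 mult_right_mono) auto
              then show ?thesis by (simp add: powr_mult powr_powr mult.assoc)
            qed
            then show "ennreal ((norm x powr c * norm (f x)) powr m) * indicator (cball 0 (sqrt s)) x \<le>
              ennreal (s powr ((c - a) * m / 2)) * ennreal ((norm x powr a * norm (f x)) powr m)"
              by (auto simp: ennreal_mult'[symmetric] indicator_def intro!: ennreal_leI)
          qed
          also have "\<dots> = ennreal (s powr ((c - a) * m / 2) * N powr m)"
            by (simp add: nn_integral_cmult M[OF fw] ennreal_mult' N_def)
          finally show "(\<integral>\<^sup>+x. ennreal ((norm x powr c * norm (f x)) powr m) * indicator (cball 0 (sqrt s)) x \<partial>lborel) \<le>
              ennreal (s powr ((c - a) * m / 2) * N powr m)" .
          have "(\<integral>\<^sup>+x. ennreal (norm (f x) powr m) * indicator (- cball 0 (sqrt s)) x \<partial>lborel) \<le>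
              (\<integral>\<^sup>+x. ennreal (s powr (- a * m / 2)) * ennreal ((norm x powr a * norm (f x)) powr m) \<partial>lborel)"
          proof (rule nn_integral_mono)
            fix x :: 'a
            have "norm (f x) powr m \<le> s powr (- a * m / 2) * (norm x powr a * norm (f x)) powr m"
              if x: "sqrt s < norm x"
            proof -
              have "1 = s powr (- a / 2) * sqrt s powr a" unfolding sq using s by (simp add: powr_add[symmetric])
              also have "\<dots> \<le> s powr (- a / 2) * norm x powr a"
                using x a s by (intro mult_left_mono powr_mono2) auto
              finally have "1 * norm (f x) \<le> s powr (- a / 2) * norm x powr a * norm (f x)"
                by (intro mult_right_mono) auto
              then have "norm (f x) powr m \<le> (s powr (- a / 2) * norm x powr a * norm (f x)) powr m"
                using m by (intro powr_mono2) auto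
              then show ?thesis by (simp add: powr_mult powr_powr mult.assoc)
            qed
            then show "ennreal (norm (f x) powr m) * indicator (- cball 0 (sqrt s)) x \<le>
              ennreal (s powr (- a * m / 2)) * ennreal ((norm x powr a * norm (f x)) powr m)"
              by (auto simp: ennreal_mult'[symmetric] indicator_def intro!: ennreal_leI)
          qed
          also have "\<dots> = ennreal (s powr (- a * m / 2) * N powr m)"
            by (simp add: nn_integral_cmult M[OF fw] ennreal_mult' N_def)
          finally show "(\<integral>\<^sup>+x. ennreal (norm (f x) powr m) * indicator (- cball 0 (sqrt s)) x \<partial>lborel) \<le>
              ennreal (s powr (- a * m / 2) * N powr m)" .
        qed auto
        also have "C * s powr - \<nu> * (s powr - c * (s powr ((c - a) * m / 2) * N powr m) powr (2 / m) +
            (s powr (- a * m / 2) * N powr m) powr (2 / m)) = 2 * C * N\<^sup>2 * s powr (- \<nu> - a)"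
        proof -
          have 1: "(s powr ((c - a) * m / 2) * N powr m) powr (2 / m) = s powr (c - a) * N\<^sup>2"
            using m N by (simp add: powr_mult powr_powr)
          have 2: "(s powr (- a * m / 2) * N powr m) powr (2 / m) = s powr (- a) * N\<^sup>2"
            using m N by (simp add: powr_mult powr_powr)
          have 3: "s powr - c * s powr (c - a) = s powr (- a)" "s powr - \<nu> * s powr (- a) = s powr (- \<nu> - a)"
            by (simp_all add: powr_add[symmetric])
          have "C * s powr - \<nu> * (s powr - c * (s powr (c - a) * N\<^sup>2) + s powr (- a) * N\<^sup>2) =
              C * N\<^sup>2 * (s powr - \<nu> * (s powr - c * s powr (c - a) + s powr (- a)))"
            by (simp add: algebra_simps)
          also have "\<dots> = 2 * C * N\<^sup>2 * (s powr - \<nu> * s powr (- a))" unfolding 3(1) by simp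
          finally show ?thesis unfolding 1 2 3(2) .
        qed
        finally show ?thesis .
      qed
      have "(\<integral>\<^sup>+s. ennreal (s powr (a - 1) * min 1 ((s / T\<^sup>2) powr \<kappa>)) * indicator {0..} s *
          gauss_energy s (fourier_transform f) \<partial>lborel) \<le>
        (\<integral>\<^sup>+s. ennreal (2 * C * N\<^sup>2) * (ennreal (T powr - (2 * \<kappa>)) * (ennreal (s powr (\<kappa> - \<nu> - 1)) * indicator {0..T\<^sup>2} s) +
          ennreal (s powr (- \<nu> - 1)) * indicator {T\<^sup>2..} s) \<partial>lborel)"
      proof (rule nn_integral_mono)
        fix s :: real
        show "ennreal (s powr (a - 1) * min 1 ((s / T\<^sup>2) powr \<kappa>)) * indicator {0..} s *
          gauss_energy s (fourier_transform f) \<le>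
          ennreal (2 * C * N\<^sup>2) * (ennreal (T powr - (2 * \<kappa>)) * (ennreal (s powr (\<kappa> - \<nu> - 1)) * indicator {0..T\<^sup>2} s) +
          ennreal (s powr (- \<nu> - 1)) * indicator {T\<^sup>2..} s)"
        proof (cases "0 < s")
          case False
          then show ?thesis by (cases "s = 0") auto
        next
          case s: True
          have mul: "s powr (a - 1) * s powr (- \<nu> - a) = s powr (- \<nu> - 1)"
            by (subst powr_add[symmetric], rule arg_cong[where f = "\<lambda>e. s powr e"]) simp
          have mn: "s powr (- \<nu> - 1) * min 1 ((s / T\<^sup>2) powr \<kappa>) \<le> T powr - (2 * \<kappa>) * s powr (\<kappa> - \<nu> - 1)" "s powr (- \<nu> - 1) * min 1 ((s / T\<^sup>2) powr \<kappa>) \<le> s powr (- \<nu> - 1)"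
          proof -
            have e: "(s / T\<^sup>2) powr \<kappa> = s powr \<kappa> * T powr - (2 * \<kappa>)"
              unfolding powr_divide power2_powr[OF T] by (simp add: powr_minus_divide)
            have pp: "s powr (- \<nu> - 1) * s powr \<kappa> = s powr (\<kappa> - \<nu> - 1)"
              by (subst powr_add[symmetric], rule arg_cong[where f = "\<lambda>e. s powr e"]) simp
            have "s powr (- \<nu> - 1) * min 1 ((s / T\<^sup>2) powr \<kappa>) \<le> s powr (- \<nu> - 1) * (s / T\<^sup>2) powr \<kappa>"
              by (intro mult_left_mono) auto
            then show "s powr (- \<nu> - 1) * min 1 ((s / T\<^sup>2) powr \<kappa>) \<le> T powr - (2 * \<kappa>) * s powr (\<kappa> - \<nu> - 1)"
              unfolding e pp[symmetric] by (simp only: mult_ac)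
            show "s powr (- \<nu> - 1) * min 1 ((s / T\<^sup>2) powr \<kappa>) \<le> s powr (- \<nu> - 1)"
              using mult_left_mono[of "min 1 ((s / T\<^sup>2) powr \<kappa>)" 1 "s powr (- \<nu> - 1)"] by simp
          qed
          have "ennreal (s powr (a - 1) * min 1 ((s / T\<^sup>2) powr \<kappa>)) * indicator {0..} s *
            gauss_energy s (fourier_transform f) \<le>
            ennreal (s powr (a - 1) * min 1 ((s / T\<^sup>2) powr \<kappa>)) * ennreal (2 * C * N\<^sup>2 * s powr (- \<nu> - a))"
            using s by (simp add: mult_left_mono Qs)
          also have "\<dots> = ennreal (2 * C * N\<^sup>2 * (s powr (- \<nu> - 1) * min 1 ((s / T\<^sup>2) powr \<kappa>)))"
            unfolding mul[symmetric] by (simp add: ennreal_mult'[symmetric] mult_ac)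
          also have "\<dots> = ennreal (2 * C * N\<^sup>2) * ennreal (s powr (- \<nu> - 1) * min 1 ((s / T\<^sup>2) powr \<kappa>))"
            using C by (intro ennreal_mult) auto
          also have "\<dots> \<le> ennreal (2 * C * N\<^sup>2) * (ennreal (T powr - (2 * \<kappa>)) * (ennreal (s powr (\<kappa> - \<nu> - 1)) * indicator {0..T\<^sup>2} s) +
          ennreal (s powr (- \<nu> - 1)) * indicator {T\<^sup>2..} s)"
          proof (rule mult_left_mono)
            show "ennreal (s powr (- \<nu> - 1) * min 1 ((s / T\<^sup>2) powr \<kappa>)) \<le> ennreal (T powr - (2 * \<kappa>)) * (ennreal (s powr (\<kappa> - \<nu> - 1)) * indicator {0..T\<^sup>2} s) +
                ennreal (s powr (- \<nu> - 1)) * indicator {T\<^sup>2..} s"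
            proof (cases "s < T\<^sup>2")
              case True
              then show ?thesis using s ennreal_leI[OF mn(1)] by (simp add: ennreal_mult')
            next
              case False
              then show ?thesis using ennreal_leI[OF mn(2)] by (simp add: add_increasing)
            qed
          qed simp
          finally show ?thesis .
        qed
      qed
      also have "\<dots> = ennreal (2 * C * N\<^sup>2) * (ennreal (T powr - (2 * \<kappa>)) * ennreal ((T\<^sup>2) powr (\<kappa> - \<nu>) / (\<kappa> - \<nu>)) + ennreal ((T\<^sup>2) powr - \<nu> / \<nu>))"
        using T \<nu> \<nu>0 nn_integral_powr_Icc[of "\<kappa> - \<nu>" "T\<^sup>2"] nn_integral_powr_atLeast[of \<nu> "T\<^sup>2"]
        by (simp add: nn_integral_cmult nn_integral_add)
      also have "\<dots> = ennreal (2 * C * N\<^sup>2 * (T powr - (2 * \<kappa>) * ((T\<^sup>2) powr (\<kappa> - \<nu>) / (\<kappa> - \<nu>)) + (T\<^sup>2) powr - \<nu> / \<nu>))"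
        using C \<nu> \<nu>0 by (simp add: ennreal_mult'[symmetric] ennreal_plus[symmetric] del: ennreal_plus)
      also have "2 * C * N\<^sup>2 * (T powr - (2 * \<kappa>) * ((T\<^sup>2) powr (\<kappa> - \<nu>) / (\<kappa> - \<nu>)) + (T\<^sup>2) powr - \<nu> / \<nu>) = K * T powr - (2 * \<nu>) * N\<^sup>2"
      proof -
        have T2: "(T\<^sup>2) powr p = T powr (2 * p)" for p using T by (rule power2_powr)
        have "T powr - (2 * \<kappa>) * T powr (2 * (\<kappa> - \<nu>)) = T powr - (2 * \<nu>)" by (simp add: powr_add[symmetric])
        then show ?thesis unfolding T2 K_def times_divide_eq_right by (simp add: field_simps)
      qed
      finally show "(\<integral>\<^sup>+s. ennreal (s powr (a - 1) * min 1 ((s / T\<^sup>2) powr \<kappa>)) * indicator {0..} s *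
        gauss_energy s (fourier_transform f) \<partial>lborel) \<le>
        ennreal (K * T powr - (2 * \<nu>) * (weighted_Lp_norm a m f)\<^sup>2)" by (simp add: N_def)
    qed
  next
    case m2: True
    then have \<nu>0: "\<nu> = 0" by (simp add: \<nu>_def)
    \<comment> \<open>With \<nu> = 0 the bounds of the other case would leave the integral of 1 / s
      at infinity. Instead the minimum is estimated by 1 and the order of integration exchanged: for
      fixed x the near part lives on s >= |x|^2 and the far part on s <= |x|^2, and the integrals in
      s are |x|^(2 a) / (c - a) and |x|^(2 a) / a.\<close>
    define K where "K = C * (1 / (c - a) + 1 / a)"
    have K: "0 < K" unfolding K_def using C c a by (intro mult_pos_pos add_pos_pos) auto
    show ?thesis
    proof (intro exI[of _ K] conjI K allI impI)
      fix f :: "'a \<Rightarrow> complex" and T :: real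
      assume f: "f \<in> Lp_space 2" and fw: "f \<in> weighted_Lp_space a m" and T: "0 < T"
      have [measurable]: "f \<in> borel_measurable borel" using f by measurable
      define N where "N = weighted_Lp_norm a m f"
      have N: "0 \<le> N" by (simp add: N_def weighted_Lp_norm_def)
      define A where "A s = (\<integral>\<^sup>+x. ennreal ((norm x powr c * norm (f x))\<^sup>2) * indicator (cball 0 (sqrt s)) x \<partial>lborel)" for s
      define B where "B s = (\<integral>\<^sup>+x. ennsq (f x) * indicator (- cball 0 (sqrt s)) x \<partial>lborel)" for s
      \<comment> \<open>\<open>bound\<close> takes real moments. They are finite because f is in
        L^2, but only their integrals over s are controlled by the weighted norm.\<close>
      have fin: "A s < \<infinity>" "B s < \<infinity>" if "0 < s" for s
      proof -
        have "A s \<le> (\<integral>\<^sup>+x. ennreal ((sqrt s powr c)\<^sup>2) * ennsq (f x) \<partial>lborel)"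
          unfolding A_def
        proof (rule nn_integral_mono)
          fix x :: 'a
          show "ennreal ((norm x powr c * norm (f x))\<^sup>2) * indicator (cball 0 (sqrt s)) x \<le> ennreal ((sqrt s powr c)\<^sup>2) * ennsq (f x)"
            using c0 by (auto simp: ennreal_mult'[symmetric] indicator_def power_mult_distrib
                intro!: ennreal_leI mult_right_mono power_mono powr_mono2)
        qed
        also have "\<dots> = ennreal ((sqrt s powr c)\<^sup>2) * sqint f" by (simp add: nn_integral_cmult sqint_def)
        also have "\<dots> < \<infinity>" using f by (simp add: Lp_space_2_iff ennreal_mult_less_top)
        finally show "A s < \<infinity>" .
        have "B s \<le> sqint f" unfolding B_def sqint_def by (intro nn_integral_mono) (auto simp: indicator_def)
        then show "B s < \<infinity>" using f by (auto simp: Lp_space_2_iff)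
      qed
      have Qs: "gauss_energy s (fourier_transform f) \<le>
          ennreal C * (ennreal (s powr - c) * A s + B s)" if s: "0 < s" for s
      proof -
        obtain A' where A': "A s = ennreal A'" "0 \<le> A'" using fin(1)[OF s] by (cases "A s") auto
        obtain B' where B': "B s = ennreal B'" "0 \<le> B'" using fin(2)[OF s] by (cases "B s") auto
        have "gauss_energy s (fourier_transform f) \<le>
            ennreal (C * s powr - \<nu> * (s powr - c * A' powr (2 / m) + B' powr (2 / m)))"
          using A' B' by (intro bound[OF f s]) (auto simp: A_def B_def m2)
        also have "\<dots> = ennreal C * (ennreal (s powr - c) * A s + B s)"
          using A' B' s C by (simp add: m2 \<nu>0 ennreal_mult' ennreal_plus)
        finally show ?thesis .
      qed
      have "(\<integral>\<^sup>+s. ennreal (s powr (a - 1) * min 1 ((s / T\<^sup>2) powr \<kappa>)) * indicator {0..} s *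
          gauss_energy s (fourier_transform f) \<partial>lborel) \<le>
        (\<integral>\<^sup>+s. \<integral>\<^sup>+x. ennreal C * (ennreal ((norm x powr c * norm (f x))\<^sup>2) * (ennreal (s powr (- (c - a) - 1)) * indicator {(norm x)\<^sup>2..} s) +
            ennsq (f x) * (ennreal (s powr (a - 1)) * indicator {0..(norm x)\<^sup>2} s)) \<partial>lborel \<partial>lborel)"
      proof (rule nn_integral_mono)
        fix s :: real
        show "ennreal (s powr (a - 1) * min 1 ((s / T\<^sup>2) powr \<kappa>)) * indicator {0..} s *
          gauss_energy s (fourier_transform f) \<le>
          (\<integral>\<^sup>+x. ennreal C * (ennreal ((norm x powr c * norm (f x))\<^sup>2) * (ennreal (s powr (- (c - a) - 1)) * indicator {(norm x)\<^sup>2..} s) +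
            ennsq (f x) * (ennreal (s powr (a - 1)) * indicator {0..(norm x)\<^sup>2} s)) \<partial>lborel)"
        proof (cases "0 < s")
          case False
          then show ?thesis by (cases "s = 0") auto
        next
          case s: True
          have "ennreal (s powr (a - 1) * min 1 ((s / T\<^sup>2) powr \<kappa>)) * indicator {0..} s *
              gauss_energy s (fourier_transform f) \<le>
              ennreal (s powr (a - 1)) * (ennreal C * (ennreal (s powr - c) * A s + B s))"
          proof (rule mult_mono)
            have "s powr (a - 1) * min 1 ((s / T\<^sup>2) powr \<kappa>) \<le> s powr (a - 1) * 1" by (intro mult_left_mono) auto
            then show "ennreal (s powr (a - 1) * min 1 ((s / T\<^sup>2) powr \<kappa>)) * indicator {0..} s \<le> ennreal (s powr (a - 1))"
              using s by (simp add: ennreal_leI)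
          qed (use Qs[OF s] in auto)
          also have "\<dots> = ennreal C * ((ennreal (s powr (a - 1)) * ennreal (s powr - c)) * A s + ennreal (s powr (a - 1)) * B s)"
            by (simp add: distrib_left mult_ac)
          also have "ennreal (s powr (a - 1)) * ennreal (s powr - c) = ennreal (s powr (- (c - a) - 1))"
            by (simp only: ennreal_mult'[symmetric] powr_ge_zero, subst powr_add[symmetric],
                rule arg_cong[where f = "\<lambda>e. ennreal (s powr e)"]) simp
          also have "ennreal C * (ennreal (s powr (- (c - a) - 1)) * A s + ennreal (s powr (a - 1)) * B s) =
              (\<integral>\<^sup>+x. ennreal C * (ennreal (s powr (- (c - a) - 1)) * (ennreal ((norm x powr c * norm (f x))\<^sup>2) * indicator (cball 0 (sqrt s)) x) +
              ennreal (s powr (a - 1)) * (ennsq (f x) * indicator (- cball 0 (sqrt s)) x)) \<partial>lborel)"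
            unfolding A_def B_def by (simp add: nn_integral_cmult nn_integral_add)
          also have "\<dots> \<le> (\<integral>\<^sup>+x. ennreal C * (ennreal ((norm x powr c * norm (f x))\<^sup>2) * (ennreal (s powr (- (c - a) - 1)) * indicator {(norm x)\<^sup>2..} s) +
            ennsq (f x) * (ennreal (s powr (a - 1)) * indicator {0..(norm x)\<^sup>2} s)) \<partial>lborel)"
          proof (intro nn_integral_mono mult_left_mono add_mono)
            fix x :: 'a
            have i1: "indicator (cball 0 (sqrt s)) x = (indicator {(norm x)\<^sup>2..} s :: ennreal)"
              using s real_sqrt_le_iff[of "(norm x)\<^sup>2" s] by (auto simp: indicator_def)
            show "ennreal (s powr (- (c - a) - 1)) * (ennreal ((norm x powr c * norm (f x))\<^sup>2) * indicator (cball 0 (sqrt s)) x) \<le>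
              ennreal ((norm x powr c * norm (f x))\<^sup>2) * (ennreal (s powr (- (c - a) - 1)) * indicator {(norm x)\<^sup>2..} s)"
              unfolding i1 by (simp add: mult_ac)
            have i2: "indicator (- cball 0 (sqrt s)) x \<le> (indicator {0..(norm x)\<^sup>2} s :: ennreal)"
              using s real_sqrt_le_iff[of "(norm x)\<^sup>2" s] by (auto simp: indicator_def)
            have "ennreal (s powr (a - 1)) * (ennsq (f x) * indicator (- cball 0 (sqrt s)) x) =
                ennsq (f x) * (ennreal (s powr (a - 1)) * indicator (- cball 0 (sqrt s)) x)" by (simp add: mult_ac)
            also have "\<dots> \<le> ennsq (f x) * (ennreal (s powr (a - 1)) * indicator {0..(norm x)\<^sup>2} s)"
              by (intro mult_left_mono i2) auto
            finally show "ennreal (s powr (a - 1)) * (ennsq (f x) * indicator (- cball 0 (sqrt s)) x) \<le>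
              ennsq (f x) * (ennreal (s powr (a - 1)) * indicator {0..(norm x)\<^sup>2} s)" .
          qed auto
          finally show ?thesis .
        qed
      qed
      also have "\<dots> = (\<integral>\<^sup>+x. \<integral>\<^sup>+s. ennreal C * (ennreal ((norm x powr c * norm (f x))\<^sup>2) * (ennreal (s powr (- (c - a) - 1)) * indicator {(norm x)\<^sup>2..} s) +
            ennsq (f x) * (ennreal (s powr (a - 1)) * indicator {0..(norm x)\<^sup>2} s)) \<partial>lborel \<partial>lborel)"
        by (rule lborel_pair.Fubini') (simp add: indicator_def[of "{_..}"] indicator_def[of "{_.._}"] split_beta')
      also have "\<dots> = (\<integral>\<^sup>+x. ennreal K * ennreal ((norm x powr a * norm (f x)) powr m) \<partial>lborel)"
      proof (rule nn_integral_cong_AE, use AE_nonzero[where 'a='a] in eventually_elim)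
        case (elim x)
        have x2: "((norm x)\<^sup>2) powr p = norm x powr (2 * p)" for p using elim by (intro power2_powr) simp
        have "(\<integral>\<^sup>+s. ennreal C * (ennreal ((norm x powr c * norm (f x))\<^sup>2) * (ennreal (s powr (- (c - a) - 1)) * indicator {(norm x)\<^sup>2..} s) +
            ennsq (f x) * (ennreal (s powr (a - 1)) * indicator {0..(norm x)\<^sup>2} s)) \<partial>lborel) =
            ennreal C * (ennreal ((norm x powr c * norm (f x))\<^sup>2) * ennreal (((norm x)\<^sup>2) powr - (c - a) / (c - a)) +
            ennsq (f x) * ennreal (((norm x)\<^sup>2) powr a / a))"
          using elim a c nn_integral_powr_Icc[of a "(norm x)\<^sup>2"] nn_integral_powr_atLeast[of "c - a" "(norm x)\<^sup>2"]
          by (simp add: nn_integral_cmult nn_integral_add)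
        also have "\<dots> = ennreal (C * ((norm x powr c * norm (f x))\<^sup>2 * (((norm x)\<^sup>2) powr - (c - a) / (c - a)) +
            (norm (f x))\<^sup>2 * (((norm x)\<^sup>2) powr a / a)))"
          using C c a by (simp add: ennreal_mult'[symmetric] ennreal_plus[symmetric] del: ennreal_plus)
        also have "C * ((norm x powr c * norm (f x))\<^sup>2 * (((norm x)\<^sup>2) powr - (c - a) / (c - a)) +
            (norm (f x))\<^sup>2 * (((norm x)\<^sup>2) powr a / a)) = K * (norm x powr a * norm (f x)) powr m"
        proof -
          have s2: "(norm x powr p)\<^sup>2 = norm x powr (2 * p)" for p by (simp add: power2_eq_square powr_add[symmetric])
          have 1: "norm x powr (2 * c) * norm x powr (2 * - (c - a)) = norm x powr (2 * a)" by (simp add: powr_add[symmetric])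
          have "C * ((norm x powr c * norm (f x))\<^sup>2 * (((norm x)\<^sup>2) powr - (c - a) / (c - a)) + (norm (f x))\<^sup>2 * (((norm x)\<^sup>2) powr a / a)) =
              C * (norm (f x))\<^sup>2 * ((norm x powr (2 * c) * norm x powr (2 * - (c - a))) * (1 / (c - a)) + norm x powr (2 * a) * (1 / a))"
            unfolding x2 power_mult_distrib s2 by (simp add: algebra_simps)
          also have "\<dots> = K * (norm x powr (2 * a) * (norm (f x))\<^sup>2)" unfolding 1 K_def by (simp add: algebra_simps)
          also have "norm x powr (2 * a) * (norm (f x))\<^sup>2 = (norm x powr a * norm (f x)) powr m"
            by (simp add: m2 power_mult_distrib s2)
          finally show ?thesis .
        qed
        finally show ?case using K by (simp add: ennreal_mult')
      qed
      also have "\<dots> = ennreal (K * T powr - (2 * \<nu>) * N\<^sup>2)"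
        using K T N by (simp add: nn_integral_cmult M[OF fw] ennreal_mult' \<nu>0 N_def[symmetric]) (simp add: m2)
      finally show "(\<integral>\<^sup>+s. ennreal (s powr (a - 1) * min 1 ((s / T\<^sup>2) powr \<kappa>)) * indicator {0..} s *
        gauss_energy s (fourier_transform f) \<partial>lborel) \<le>
        ennreal (K * T powr - (2 * \<nu>) * (weighted_Lp_norm a m f)\<^sup>2)" by (simp add: N_def)
    qed
  qed
  then obtain K where K: "0 < K" and le: "\<And>(f::'a \<Rightarrow> complex) T. f \<in> Lp_space 2 \<Longrightarrow> f \<in> weighted_Lp_space a m \<Longrightarrow> 0 < T \<Longrightarrow>
      (\<integral>\<^sup>+s. ennreal (s powr (a - 1) * min 1 ((s / T\<^sup>2) powr \<kappa>)) * indicator {0..} s *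
        gauss_energy s (fourier_transform f) \<partial>lborel) \<le>
      ennreal (K * T powr - (2 * \<nu>) * (weighted_Lp_norm a m f)\<^sup>2)" by blast
  show ?thesis
  proof (rule that[of "sqrt (2 * exp 1 * K)"])
    show "0 < sqrt (2 * exp 1 * K)" using K by simp
    fix f :: "'a \<Rightarrow> complex" and T :: real
    assume f: "f \<in> Lp_space 2" and fw: "f \<in> weighted_Lp_space a m" and T: "0 < T"
    have "sqint (\<lambda>\<xi>. low_weight a \<kappa> T (norm \<xi>) *\<^sub>R fourier_transform f \<xi>) \<le>
        ennreal (2 * exp 1) * ennreal (K * T powr - (2 * \<nu>) * (weighted_Lp_norm a m f)\<^sup>2)"
      by (rule order_trans[OF F_le[OF f T]]) (intro mult_left_mono le f fw T, simp)
    also have "\<dots> = ennreal (2 * exp 1 * (K * T powr - (2 * \<nu>) * (weighted_Lp_norm a m f)\<^sup>2))"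
      by (simp add: ennreal_mult'[symmetric])
    also have "2 * exp 1 * (K * T powr - (2 * \<nu>) * (weighted_Lp_norm a m f)\<^sup>2) =
        (sqrt (2 * exp 1 * K) * T powr - \<nu> * weighted_Lp_norm a m f)\<^sup>2"
    proof -
      have "(T powr - \<nu>)\<^sup>2 = T powr - (2 * \<nu>)" by (simp add: power2_eq_square powr_add[symmetric])
      then show ?thesis using K by (simp add: power_mult_distrib)
    qed
    finally show "sqint (\<lambda>\<xi>. low_weight a \<kappa> T (norm \<xi>) *\<^sub>R fourier_transform f \<xi>) \<le>
      ennreal ((sqrt (2 * exp 1 * K) * T powr - (DIM('a) * (1 / m - 1 / 2)) * weighted_Lp_norm a m f)\<^sup>2)"
      by (simp add: \<nu>_def n_def)
  qed
qed

section \<open>The damped oscillator\<close>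

text \<open>At 0 the derivative is only one-sided; derivatives in the interior and continuity up to
  the endpoint suffice.\<close>

lemma decreasing_of_vector_derivative:
  fixes h h' :: "real \<Rightarrow> real"
  assumes d: "\<And>t. 0 \<le> t \<Longrightarrow> (h has_vector_derivative h' t) (at t within {0..})"
    and neg: "\<And>t. 0 \<le> t \<Longrightarrow> h' t \<le> 0" and t: "0 \<le> t"
  shows "h t \<le> h 0"
proof (rule DERIV_nonpos_imp_decreasing_open[OF t])
  fix x assume x: "0 < x" "x < t"
  have "at x within {0..} = at x" using x(1) by (intro at_within_interior) (simp add: interior_real_atLeast)
  with d[of x] x have "(h has_vector_derivative h' x) (at x)" by (simp only: less_imp_le)
  then have "DERIV h x :> h' x"
    by (simp only: has_real_derivative_iff_has_vector_derivative)
  then show "\<exists>y. DERIV h x :> y \<and> y \<le> 0" using neg[of x] x by auto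
next
  have "continuous_on {0..} h"
    by (rule continuous_on_vector_derivative) (use d in auto)
  then show "continuous_on {0..t} h" by (rule continuous_on_subset) auto
qed

text \<open>The cross term \<open>\<eta> (y' \<bullet> y)\<close> in the Lyapunov function produces the damping of \<open>y\<close> itself;
  \<open>\<eta> = 0\<close> gives the plain energy estimate.\<close>

lemma damped_energy_bound:
  fixes y y' :: "real \<Rightarrow> complex" and p q \<eta> :: real
  assumes p: "0 < p" and q: "0 < q" and \<eta>: "0 \<le> \<eta>" "\<eta> * (1 + p\<^sup>2 / (2 * q)) \<le> p / 2" "2 * \<eta> \<le> sqrt q"
    and y: "\<And>t. 0 \<le> t \<Longrightarrow> (y has_vector_derivative y' t) (at t within {0..})"
    and y': "\<And>t. 0 \<le> t \<Longrightarrow> (y' has_vector_derivative - (p *\<^sub>R y' t) - q *\<^sub>R y t) (at t within {0..})"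
    and t: "0 \<le> t"
  shows "(norm (y' t))\<^sup>2 + q * (norm (y t))\<^sup>2 \<le> 3 * exp (- (\<eta> / 2 * t)) * ((norm (y' 0))\<^sup>2 + q * (norm (y 0))\<^sup>2)"
proof -
  define G where "G t = (norm (y' t))\<^sup>2 + q * (norm (y t))\<^sup>2" for t
  define E where "E t = 1 / 2 * (y' t \<bullet> y' t) + q / 2 * (y t \<bullet> y t) + \<eta> * (y' t \<bullet> y t)" for t
  define E' where "E' t = - p * (norm (y' t))\<^sup>2 + \<eta> * ((norm (y' t))\<^sup>2 - p * (y' t \<bullet> y t) - q * (norm (y t))\<^sup>2)" for t
  have E_deriv: "(E has_vector_derivative E' t) (at t within {0..})" if "0 \<le> t" for t
  proof -
    note bil = bounded_bilinear.has_vector_derivative[OF bounded_bilinear_inner]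
    have 1: "((\<lambda>t. y' t \<bullet> y' t) has_vector_derivative (y' t \<bullet> (- (p *\<^sub>R y' t) - q *\<^sub>R y t) + (- (p *\<^sub>R y' t) - q *\<^sub>R y t) \<bullet> y' t)) (at t within {0..})"
      by (rule bil[OF y'[OF that] y'[OF that]])
    have 2: "((\<lambda>t. y t \<bullet> y t) has_vector_derivative (y t \<bullet> y' t + y' t \<bullet> y t)) (at t within {0..})"
      by (rule bil[OF y[OF that] y[OF that]])
    have 3: "((\<lambda>t. y' t \<bullet> y t) has_vector_derivative (y' t \<bullet> y' t + (- (p *\<^sub>R y' t) - q *\<^sub>R y t) \<bullet> y t)) (at t within {0..})"
      by (rule bil[OF y'[OF that] y[OF that]])
    have "(E has_vector_derivative (1 / 2 * (y' t \<bullet> (- (p *\<^sub>R y' t) - q *\<^sub>R y t) + (- (p *\<^sub>R y' t) - q *\<^sub>R y t) \<bullet> y' t) +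
        q / 2 * (y t \<bullet> y' t + y' t \<bullet> y t) + \<eta> * (y' t \<bullet> y' t + (- (p *\<^sub>R y' t) - q *\<^sub>R y t) \<bullet> y t))) (at t within {0..})"
      unfolding E_def[abs_def] by (intro has_vector_derivative_add has_vector_derivative_mult_right 1 2 3)
    also have "(1 / 2 * (y' t \<bullet> (- (p *\<^sub>R y' t) - q *\<^sub>R y t) + (- (p *\<^sub>R y' t) - q *\<^sub>R y t) \<bullet> y' t) +
        q / 2 * (y t \<bullet> y' t + y' t \<bullet> y t) + \<eta> * (y' t \<bullet> y' t + (- (p *\<^sub>R y' t) - q *\<^sub>R y t) \<bullet> y t)) = E' t"
      by (simp add: E'_def power2_norm_eq_inner inner_diff_right inner_diff_left inner_commute[of "y t" "y' t"] algebra_simps)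
    finally show ?thesis .
  qed
  have cross: "\<eta> * \<bar>y' t \<bullet> y t\<bar> \<le> 1 / 4 * G t" for t
  proof -
    have "\<bar>y' t \<bullet> y t\<bar> \<le> norm (y' t) * norm (y t)" by (rule Cauchy_Schwarz_ineq2)
    then have "\<eta> * \<bar>y' t \<bullet> y t\<bar> \<le> \<eta> * (norm (y' t) * norm (y t))" using \<eta> by (intro mult_left_mono)
    also have "\<dots> \<le> sqrt q / 2 * (norm (y' t) * norm (y t))" using \<eta> by (intro mult_right_mono) auto
    also have "\<dots> \<le> 1 / 4 * G t"
      using sum_squares_bound[of "norm (y' t)" "sqrt q * norm (y t)"] q
      by (simp add: G_def power_mult_distrib mult_ac)
    finally show ?thesis .
  qed
  \<comment> \<open>The condition 2 \<eta> <= \<open>sqrt q\<close> keeps the cross term below a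
    quarter of \<open>G\<close>. The ratio of the two bounds is the 3 in the conclusion.\<close>
  have EG: "1 / 4 * G t \<le> E t" "E t \<le> 3 / 4 * G t" for t
  proof -
    have "E t = 1 / 2 * G t + \<eta> * (y' t \<bullet> y t)"
      by (simp add: E_def G_def power2_norm_eq_inner algebra_simps)
    moreover have "\<bar>\<eta> * (y' t \<bullet> y t)\<bar> \<le> 1 / 4 * G t" using cross[of t] \<eta> by (simp add: abs_mult)
    ultimately show "1 / 4 * G t \<le> E t" "E t \<le> 3 / 4 * G t" by linarith+
  qed
  \<comment> \<open>Young's inequality gives p a b <= q b^2 / 2 + (p^2 / (2 q)) a^2. The first
    summand costs half of the new damping \<eta> q b^2; by the second condition on \<eta>, the
    coefficient of a^2 costs at most half of the old damping p a^2.\<close>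
  have E'_le: "E' t \<le> - (\<eta> / 2) * E t" for t
  proof -
    define a b where "a = norm (y' t)" and "b = norm (y t)"
    have "- (p * (y' t \<bullet> y t)) \<le> p * (a * b)"
      using Cauchy_Schwarz_ineq2[of "y' t" "y t"] p mult_left_mono[of "- (y' t \<bullet> y t)" "a * b" p]
      by (simp add: a_def b_def)
    also have "p * (a * b) \<le> q * b\<^sup>2 / 2 + p\<^sup>2 / (2 * q) * a\<^sup>2"
    proof -
      have "0 \<le> (q * b - p * a)\<^sup>2 / (2 * q)" using q by simp
      also have "\<dots> = q * b\<^sup>2 / 2 + p\<^sup>2 / (2 * q) * a\<^sup>2 - p * (a * b)"
        using q by (simp add: power2_eq_square field_simps)
      finally show ?thesis by simp
    qed
    finally have "\<eta> * (a\<^sup>2 - p * (y' t \<bullet> y t) - q * b\<^sup>2) \<le> \<eta> * (a\<^sup>2 + (q * b\<^sup>2 / 2 + p\<^sup>2 / (2 * q) * a\<^sup>2) - q * b\<^sup>2)"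
      using \<eta> by (intro mult_left_mono) auto
    also have "\<dots> = (\<eta> * (1 + p\<^sup>2 / (2 * q))) * a\<^sup>2 - \<eta> / 2 * (q * b\<^sup>2)" by (simp add: algebra_simps)
    also have "\<dots> \<le> p / 2 * a\<^sup>2 - \<eta> / 2 * (q * b\<^sup>2)" using \<eta> by (intro diff_right_mono mult_right_mono) auto
    finally have "E' t \<le> - (p / 2) * a\<^sup>2 - \<eta> / 2 * (q * b\<^sup>2)" by (simp add: E'_def a_def b_def)
    also have "\<dots> \<le> - (\<eta> / 2) * a\<^sup>2 - \<eta> / 2 * (q * b\<^sup>2)"
    proof -
      have "\<eta> * 1 \<le> \<eta> * (1 + p\<^sup>2 / (2 * q))" using \<eta> q by (intro mult_left_mono) auto
      then have "\<eta> \<le> p" using \<eta> p by linarith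
      then show ?thesis by (intro diff_right_mono mult_right_mono) auto
    qed
    also have "\<dots> = - (\<eta> / 2) * G t" by (simp add: G_def a_def b_def algebra_simps)
    also have "\<dots> \<le> - (\<eta> / 2) * E t"
    proof -
      have "0 \<le> G t" using q by (simp add: G_def)
      then have "E t \<le> G t" using EG(2)[of t] by linarith
      then show ?thesis using \<eta> by (simp add: mult_left_mono)
    qed
    finally show ?thesis .
  qed
  have "exp (\<eta> / 2 * t) * E t \<le> exp (\<eta> / 2 * 0) * E 0"
  proof (rule decreasing_of_vector_derivative[OF _ _ t])
    fix s :: real assume s: "0 \<le> s"
    have "((\<lambda>t. exp (\<eta> / 2 * t)) has_vector_derivative (\<eta> / 2 * exp (\<eta> / 2 * s))) (at s within {0..})"
      unfolding has_real_derivative_iff_has_vector_derivative[symmetric] by (auto intro!: derivative_eq_intros)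
    from has_vector_derivative_mult[OF this E_deriv[OF s]]
    show "((\<lambda>t. exp (\<eta> / 2 * t) * E t) has_vector_derivative (exp (\<eta> / 2 * s) * E' s + \<eta> / 2 * exp (\<eta> / 2 * s) * E s)) (at s within {0..})" .
    have "exp (\<eta> / 2 * s) * E' s \<le> exp (\<eta> / 2 * s) * (- (\<eta> / 2) * E s)" by (intro mult_left_mono E'_le) simp
    then show "exp (\<eta> / 2 * s) * E' s + \<eta> / 2 * exp (\<eta> / 2 * s) * E s \<le> 0" by (simp add: mult_ac)
  qed
  then have "exp (\<eta> / 2 * t) * E t \<le> E 0" by simp
  then have "exp (- (\<eta> / 2 * t)) * (exp (\<eta> / 2 * t) * E t) \<le> exp (- (\<eta> / 2 * t)) * E 0"
    by (rule mult_left_mono) simp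
  moreover have "exp (- (\<eta> / 2 * t)) * exp (\<eta> / 2 * t) = 1" by (simp flip: exp_add)
  ultimately have "E t \<le> exp (- (\<eta> / 2 * t)) * E 0" by (simp only: mult.assoc[symmetric] mult_1_left)
  also have "\<dots> \<le> exp (- (\<eta> / 2 * t)) * (3 / 4 * G 0)" by (intro mult_left_mono EG) auto
  finally have "G t \<le> 3 * exp (- (\<eta> / 2 * t)) * G 0" using EG(1)[of t] by linarith
  then show ?thesis by (simp add: G_def)
qed

text \<open>The integrating factor \<open>exp (- l * t)\<close> makes the product constant on the
  half line.\<close>

lemma linear_ode_exp:
  fixes z :: "real \<Rightarrow> complex" and l :: real
  assumes z: "\<And>t. 0 \<le> t \<Longrightarrow> (z has_vector_derivative l *\<^sub>R z t) (at t within {0..})" and t: "0 \<le> t"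
  shows "z t = exp (l * t) *\<^sub>R z 0"
proof -
  have d: "((\<lambda>t. exp (- l * t) *\<^sub>R z t) has_vector_derivative 0) (at s within {0..})" if s: "s \<in> {0..}" for s
  proof -
    have "((\<lambda>t. exp (- l * t)) has_vector_derivative (- l * exp (- l * s))) (at s within {0..})"
      unfolding has_real_derivative_iff_has_vector_derivative[symmetric] by (auto intro!: derivative_eq_intros)
    from bounded_bilinear.has_vector_derivative[OF bounded_bilinear_scaleR this z[of s]] s
    show ?thesis by (simp add: mult.commute)
  qed
  obtain c where c: "\<And>s. s \<in> {0..} \<Longrightarrow> exp (- l * s) *\<^sub>R z s = c"
    using has_vector_derivative_zero_constant[OF convex_real_interval(1) d] by blast
  have "exp (- l * t) *\<^sub>R z t = z 0" using c[of t] c[of 0] t by simp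
  then have "exp (l * t) *\<^sub>R z 0 = (exp (l * t) * exp (- l * t)) *\<^sub>R z t"
    by (simp only: scaleR_scaleR[symmetric])
  then show ?thesis by (simp flip: exp_add)
qed

text \<open>For \<open>p\<^sup>2 \<ge> 16 q\<close> both characteristic roots are real, and \<open>y' - \<lambda>\<^sub>1 y\<close>, \<open>y' - \<lambda>\<^sub>2 y\<close> solve
  first-order equations.\<close>

lemma overdamped_bound:
  fixes y y' :: "real \<Rightarrow> complex" and p q :: real
  assumes p: "0 < p" and q: "0 < q" and pq: "16 * q \<le> p\<^sup>2"
    and y: "\<And>t. 0 \<le> t \<Longrightarrow> (y has_vector_derivative y' t) (at t within {0..})"
    and y': "\<And>t. 0 \<le> t \<Longrightarrow> (y' has_vector_derivative - (p *\<^sub>R y' t) - q *\<^sub>R y t) (at t within {0..})"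
    and t: "0 \<le> t"
  shows "norm (y t) \<le> exp (- (q / p * t)) * (2 * norm (y 0) + 4 / p * norm (y' 0))"
    and "norm (y' t) \<le> 4 * (q / p) * exp (- (q / p * t)) * norm (y 0) +
      (4 * (q / p) / p * exp (- (q / p * t)) + 2 * exp (- (p / 2 * t))) * norm (y' 0)"
proof -
  define D where "D = sqrt (p\<^sup>2 - 4 * q)"
  define l1 l2 where "l1 = (- p + D) / 2" and "l2 = (- p - D) / 2"
  have D2: "D\<^sup>2 = p\<^sup>2 - 4 * q" using pq q by (simp add: D_def)
  \<comment> \<open>The hypothesis 16 q <= p^2 keeps the roots at distance at least p / 2, so
    recovering y and y' from z and w by dividing by \<open>D\<close> costs at most 2 / p.\<close>
  have D: "p / 2 \<le> D" "D < p"
  proof -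
    have "(p / 2)\<^sup>2 = p\<^sup>2 / 4" by (simp add: power_divide)
    then have "(p / 2)\<^sup>2 \<le> p\<^sup>2 - 4 * q" using pq zero_le_power2[of p] by linarith
    then show "p / 2 \<le> D" unfolding D_def by (rule real_le_rsqrt)
    have "p\<^sup>2 - 4 * q < p\<^sup>2" using q by simp
    then show "D < p" unfolding D_def using p by (intro real_less_lsqrt) auto
  qed
  have ll: "l1 * l2 = q" "l1 + l2 = - p" "l1 - l2 = D"
    using D2 by (auto simp: l1_def l2_def power2_eq_square field_simps)
  have D0: "0 < D" using D p by linarith
  have neg: "l1 < 0" "l2 < 0" "l2 \<le> - (p / 2)" "- p \<le> l2" "l2 \<le> l1" using D p D0 by (auto simp: l1_def l2_def)
  \<comment> \<open>The product of the roots is q and - l2 lies between p / 2 and p, so the slow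
    root is of size q / p on both sides.\<close>
  have l1: "l1 \<le> - (q / p)" "\<bar>l1\<bar> \<le> 2 * (q / p)"
  proof -
    have e: "l1 = q / l2" using ll(1) neg by (simp add: field_simps)
    have "q / p \<le> q / (- l2)" using neg q p by (intro frac_le) auto
    then show "l1 \<le> - (q / p)" using e by simp
    have "q / (- l2) \<le> q / (p / 2)" using neg q p by (intro frac_le) auto
    moreover have "\<bar>l1\<bar> = - l1" using neg(1) by simp
    moreover have "- l1 = q / (- l2)" using e by simp
    moreover have "q / (p / 2) = 2 * (q / p)" by simp
    ultimately show "\<bar>l1\<bar> \<le> 2 * (q / p)" by (simp only:)
  qed
  define z w where "z t = y' t - l1 *\<^sub>R y t" and "w t = y' t - l2 *\<^sub>R y t" for t
  have root: "- p - l1 = l2" "- p - l2 = l1" "q = l1 * l2" using ll by auto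
  have z_eq: "z t = exp (l2 * t) *\<^sub>R z 0"
  proof (rule linear_ode_exp[OF _ t])
    fix s :: real assume s: "0 \<le> s"
    have "(z has_vector_derivative (- (p *\<^sub>R y' s) - q *\<^sub>R y s) - l1 *\<^sub>R y' s) (at s within {0..})"
      unfolding z_def[abs_def] using y[OF s] y'[OF s]
      by (intro has_vector_derivative_diff bounded_linear.has_vector_derivative[OF bounded_linear_scaleR_right]) 
    also have "(- (p *\<^sub>R y' s) - q *\<^sub>R y s) - l1 *\<^sub>R y' s = (- p - l1) *\<^sub>R y' s - q *\<^sub>R y s"
      by (simp add: scaleR_diff_left)
    also have "\<dots> = l2 *\<^sub>R z s" unfolding root(1) unfolding root(3) z_def by (simp add: scaleR_diff_right mult.commute)
    finally show "(z has_vector_derivative l2 *\<^sub>R z s) (at s within {0..})" .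
  qed
  have w_eq: "w t = exp (l1 * t) *\<^sub>R w 0"
  proof (rule linear_ode_exp[OF _ t])
    fix s :: real assume s: "0 \<le> s"
    have "(w has_vector_derivative (- (p *\<^sub>R y' s) - q *\<^sub>R y s) - l2 *\<^sub>R y' s) (at s within {0..})"
      unfolding w_def[abs_def] using y[OF s] y'[OF s]
      by (intro has_vector_derivative_diff bounded_linear.has_vector_derivative[OF bounded_linear_scaleR_right])
    also have "(- (p *\<^sub>R y' s) - q *\<^sub>R y s) - l2 *\<^sub>R y' s = (- p - l2) *\<^sub>R y' s - q *\<^sub>R y s"
      by (simp add: scaleR_diff_left)
    also have "\<dots> = l1 *\<^sub>R w s" unfolding root(2) unfolding root(3) w_def by (simp add: scaleR_diff_right)
    finally show "(w has_vector_derivative l1 *\<^sub>R w s) (at s within {0..})" .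
  qed
  define a b where "a = norm (y 0)" and "b = norm (y' 0)"
  have ab: "0 \<le> a" "0 \<le> b" by (auto simp: a_def b_def)
  have w0: "norm (w 0) \<le> b - l2 * a"
    using norm_triangle_ineq4[of "y' 0" "l2 *\<^sub>R y 0"] neg by (simp add: w_def a_def b_def)
  have z0: "norm (z 0) \<le> b - l1 * a"
    using norm_triangle_ineq4[of "y' 0" "l1 *\<^sub>R y 0"] neg by (simp add: z_def a_def b_def)
  define e1 e2 where "e1 = exp (l1 * t)" and "e2 = exp (l2 * t)"
  define e where "e = exp (- (q / p * t))"
  have e1: "0 < e1" "e1 \<le> e" using mult_right_mono[OF l1(1) t] by (auto simp: e1_def e_def)
  have e2: "0 < e2" "e2 \<le> e" "e2 \<le> exp (- (p / 2 * t))"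
    using mult_right_mono[OF l1(1) t] mult_right_mono[OF neg(5) t] mult_right_mono[OF neg(3) t] by (auto simp: e2_def e_def)
  have "D *\<^sub>R y t = w t - z t" unfolding ll(3)[symmetric] by (simp add: w_def z_def scaleR_diff_left)
  then have "D * norm (y t) = norm (e1 *\<^sub>R w 0 - e2 *\<^sub>R z 0)"
    using D0 z_eq w_eq norm_scaleR[of D "y t"] by (simp add: e1_def e2_def)
  also have "\<dots> \<le> e1 * norm (w 0) + e2 * norm (z 0)"
    using norm_triangle_ineq4[of "e1 *\<^sub>R w 0" "e2 *\<^sub>R z 0"] e1 e2 by simp
  also have "\<dots> \<le> e * (b - l2 * a) + e * (b - l1 * a)"
    using e1 e2 w0 z0 by (intro add_mono mult_mono) auto
  also have "\<dots> = e * (2 * b - (l1 + l2) * a)" by (simp add: algebra_simps)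
  also have "\<dots> = e * (2 * b + p * a)" unfolding ll by simp
  finally have "p / 2 * norm (y t) \<le> e * (2 * b + p * a)"
    using mult_right_mono[OF D(1), of "norm (y t)"] by simp
  then show "norm (y t) \<le> exp (- (q / p * t)) * (2 * norm (y 0) + 4 / p * norm (y' 0))"
    using p by (simp add: e_def a_def b_def field_simps)
  have "D *\<^sub>R y' t = l1 *\<^sub>R w t - l2 *\<^sub>R z t"
    unfolding ll(3)[symmetric] by (simp add: w_def z_def scaleR_diff_left scaleR_diff_right mult.commute)
  then have "D * norm (y' t) = norm ((l1 * e1) *\<^sub>R w 0 - (l2 * e2) *\<^sub>R z 0)"
    using D0 z_eq w_eq norm_scaleR[of D "y' t"] by (simp add: e1_def e2_def)
  also have "\<dots> \<le> - (l1 * e1) * norm (w 0) + - (l2 * e2) * norm (z 0)"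
    using norm_triangle_ineq4[of "(l1 * e1) *\<^sub>R w 0" "(l2 * e2) *\<^sub>R z 0"] e1 e2 neg by (simp add: abs_mult)
  also have "\<dots> \<le> - (l1 * e1) * (b - l2 * a) + - (l2 * e2) * (b - l1 * a)"
    using e1 e2 neg w0 z0 by (intro add_mono mult_left_mono) (auto simp: mult_nonpos_nonneg)
  \<comment> \<open>The y(0) terms combine to the product of the roots, which is q. In the y'(0)
    terms the fast mode keeps the factor - l2, which can be as large as p, so its own exponential
    must be retained; this is the term \<open>exp (- (p / 2 * t))\<close> of the claim.\<close>
  also have "\<dots> = (l1 * l2) * (e1 + e2) * a + (- l1 * e1 + - l2 * e2) * b" by (simp add: algebra_simps)
  also have "\<dots> \<le> q * (2 * e) * a + (2 * (q / p) * e + p * exp (- (p / 2 * t))) * b"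
    unfolding ll(1) using e1 e2 neg l1 q ab p
    by (intro add_mono mult_right_mono mult_left_mono mult_mono) auto
  finally have "p / 2 * norm (y' t) \<le> q * (2 * e) * a + (2 * (q / p) * e + p * exp (- (p / 2 * t))) * b"
    using mult_right_mono[OF D(1), of "norm (y' t)"] by simp
  then show "norm (y' t) \<le> 4 * (q / p) * exp (- (q / p * t)) * norm (y 0) +
      (4 * (q / p) / p * exp (- (q / p * t)) + 2 * exp (- (p / 2 * t))) * norm (y' 0)"
    using p by (simp add: e_def a_def b_def field_simps power2_eq_square)
qed

section \<open>Exponential decay against powers and the low-frequency weight\<close>

lemma powr_exp_bound:
  assumes "0 \<le> (k::real)" "0 < c"
  obtains K where "0 < K" "\<And>u. 0 < u \<Longrightarrow> u powr k * exp (- (c * u)) \<le> K"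
proof (cases "k = 0")
  case True
  with assms show ?thesis by (intro that[of 1]) auto
next
  case False
  with assms have k: "0 < k" by simp
  \<comment> \<open>The constant is the value at the maximiser u = k / c; the inequality is ln x <=
    x - 1 at x = c u / k.\<close>
  have "u powr k * exp (- (c * u)) \<le> exp (- k - k * ln (c / k))" if u: "0 < u" for u
  proof -
    have "ln (c * u / k) \<le> c * u / k - 1" using u k assms by (intro ln_le_minus_one) auto
    then have "ln u \<le> c * u / k - 1 - ln (c / k)"
      using u k assms by (simp add: ln_mult ln_div)
    from mult_left_mono[OF this, of k] have "k * ln u \<le> c * u - k - k * ln (c / k)"
      using k by (simp add: right_diff_distrib)
    then show ?thesis using u by (simp add: powr_def mult_exp_exp)
  qed
  then show ?thesis by (intro that[of "exp (- k - k * ln (c / k))"]) auto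
qed

text \<open>With v = T r the factor r^j is T^(-j) v^j. The exponential in v absorbs v^j, which gives
  the 1 in the minimum, and also v^(j + \<kappa>), which gives the power.\<close>

lemma exp_le_low_weight:
  assumes j: "0 \<le> j" and c: "0 < c" and \<theta>: "0 < \<theta>" and \<kappa>: "0 \<le> \<kappa>"
  obtains K where "0 < K" "\<And>T r a. 0 < T \<Longrightarrow> 0 < r \<Longrightarrow>
    r powr j * r powr - a * exp (- (c * (T * r) powr \<theta>)) \<le> K * (T powr - j * low_weight a \<kappa> T r)"
proof -
  obtain K1 where K1: "0 < K1" "\<And>u. 0 < u \<Longrightarrow> u powr (j / \<theta>) * exp (- (c * u)) \<le> K1"
    using powr_exp_bound[of "j / \<theta>" c] j c \<theta> by auto
  obtain K2 where K2: "0 < K2" "\<And>u. 0 < u \<Longrightarrow> u powr ((j + \<kappa>) / \<theta>) * exp (- (c * u)) \<le> K2"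
    using powr_exp_bound[of "(j + \<kappa>) / \<theta>" c] j c \<theta> \<kappa> by auto
  show ?thesis
  proof (rule that[of "max K1 K2"])
    show "0 < max K1 K2" using K1 by simp
    fix T r a :: real assume T: "0 < T" and r: "0 < r"
    define v where "v = T * r"
    have v: "0 < v" using T r by (simp add: v_def)
    have "v powr j * exp (- (c * v powr \<theta>)) \<le> max K1 K2 * min 1 (v powr - \<kappa>)"
    proof -
      have "v powr j * exp (- (c * v powr \<theta>)) \<le> K1"
        using K1(2)[of "v powr \<theta>"] v \<theta> by (simp add: powr_powr)
      moreover have "v powr j * exp (- (c * v powr \<theta>)) \<le> K2 * v powr - \<kappa>"
      proof -
        have "v powr (j + \<kappa>) * exp (- (c * v powr \<theta>)) \<le> K2"
          using K2(2)[of "v powr \<theta>"] v \<theta> by (simp add: powr_powr)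
        then have "(v powr (j + \<kappa>) * exp (- (c * v powr \<theta>))) * v powr - \<kappa> \<le> K2 * v powr - \<kappa>"
          by (intro mult_right_mono) auto
        moreover have "v powr (j + \<kappa>) * v powr - \<kappa> = v powr j" by (simp add: powr_add[symmetric])
        ultimately show ?thesis by (metis mult.assoc mult.commute)
      qed
      moreover have "K2 * v powr - \<kappa> \<le> max K1 K2 * v powr - \<kappa>" by (intro mult_right_mono) auto
      ultimately show ?thesis by (auto simp: min_def)
    qed
    then have "T powr - j * r powr - a * (v powr j * exp (- (c * v powr \<theta>))) \<le> T powr - j * r powr - a * (max K1 K2 * min 1 (v powr - \<kappa>))"
      by (intro mult_left_mono) auto
    moreover have "T powr - j * v powr j = r powr j"
      using T r by (simp add: v_def powr_mult powr_minus field_simps)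
    ultimately show "r powr j * r powr - a * exp (- (c * (T * r) powr \<theta>)) \<le> max K1 K2 * (T powr - j * low_weight a \<kappa> T r)"
      by (simp add: low_weight_def v_def[symmetric] mult_ac) (simp add: mult.assoc[symmetric])
  qed
qed

text \<open>One constant for all exponents j that occur in the propagator bounds; the 1 keeps it
  positive when \<open>J\<close> is empty.\<close>

lemma exp_le_low_weight_finite:
  assumes J: "finite J" "\<And>j. j \<in> J \<Longrightarrow> 0 \<le> j" and c: "0 < c" and \<theta>: "0 < \<theta>" and \<kappa>: "0 \<le> \<kappa>"
  obtains K where "0 < K" "\<And>j T r a. j \<in> J \<Longrightarrow> 0 < T \<Longrightarrow> 0 < r \<Longrightarrow>
    r powr j * r powr - a * exp (- (c * (T * r) powr \<theta>)) \<le> K * (T powr - j * low_weight a \<kappa> T r)"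
proof -
  have "\<exists>K>0. \<forall>T r a. 0 < T \<longrightarrow> 0 < r \<longrightarrow>
      r powr j * r powr - a * exp (- (c * (T * r) powr \<theta>)) \<le> K * (T powr - j * low_weight a \<kappa> T r)" if "j \<in> J" for j
    using exp_le_low_weight[OF J(2)[OF that] c \<theta> \<kappa>] by metis
  then obtain K where K: "\<And>j. j \<in> J \<Longrightarrow> 0 < K j" "\<And>j T r a. j \<in> J \<Longrightarrow> 0 < T \<Longrightarrow> 0 < r \<Longrightarrow>
      r powr j * r powr - a * exp (- (c * (T * r) powr \<theta>)) \<le> K j * (T powr - j * low_weight a \<kappa> T r)"
    by metis
  show ?thesis
  proof (rule that[of "1 + sum K J"])
    show "0 < 1 + sum K J" using K(1) by (intro add_pos_nonneg sum_nonneg) (auto intro: less_imp_le)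
    fix j T r a :: real assume j: "j \<in> J" and T: "0 < T" "0 < r"
    have "K j \<le> 1 + sum K J" using member_le_sum[OF j _ J(1), of K] K(1) by (force intro: less_imp_le)
    then show "r powr j * r powr - a * exp (- (c * (T * r) powr \<theta>)) \<le> (1 + sum K J) * (T powr - j * low_weight a \<kappa> T r)"
      using K(2)[OF j T] by (meson order_trans mult_right_mono mult_nonneg_nonneg powr_ge_zero low_weight_nonneg)
  qed
qed

section \<open>Propagator bounds at low and high frequencies\<close>

definition damped_ode :: "real \<Rightarrow> real \<Rightarrow> (real \<Rightarrow> complex) \<Rightarrow> (real \<Rightarrow> complex) \<Rightarrow> bool" where
  "damped_ode p q y y' \<longleftrightarrow> (\<forall>t\<ge>0. (y has_vector_derivative y' t) (at t within {0..}) \<and>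
     (y' has_vector_derivative - (p *\<^sub>R y' t) - q *\<^sub>R y t) (at t within {0..}))"

lemma solves_damped_ode_iff:
  "solves_damped_ode \<sigma> \<delta> r a b y \<longleftrightarrow>
    (\<exists>y'. y 0 = a \<and> y' 0 = b \<and> damped_ode (r powr (2 * \<delta>)) (r powr (2 * \<sigma>)) y y')"
proof -
  have "(\<exists>y''. (y' has_vector_derivative y'') F \<and> y'' + P + Q = 0) \<longleftrightarrow> (y' has_vector_derivative - P - Q) F"
    for y' :: "real \<Rightarrow> complex" and F P Q
  proof -
    have "y'' + P + Q = 0 \<longleftrightarrow> y'' = - P - Q" for y'' by (auto simp: algebra_simps add_eq_0_iff)
    then show ?thesis by auto
  qed
  then show ?thesis by (simp add: solves_damped_ode_def damped_ode_def)
qed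

text \<open>The slow root is of size q / p = r^\<theta>, and T^\<theta> = 1 + t, so the slow mode
  decays in T r. Dividing by the gap of the roots gives the singularity 1 / p = r^(-2 \<delta>) in
  front of y'(0) only. Against a weight that contains this singularity the y(0) terms have r^(2
  \<delta>) to spare, worth T^(-2 \<delta>).\<close>

lemma low_frequency_multiplier:
  fixes \<sigma> \<delta> \<kappa> :: real
  assumes \<sigma>: "0 < 2 * \<delta>" "2 * \<delta> < \<sigma>" and \<kappa>: "0 \<le> \<kappa>"
  defines "\<theta> \<equiv> 2 * (\<sigma> - \<delta>)"
  obtains K \<epsilon> where "0 < K" "0 < \<epsilon>" "\<And>r t y y' T W. 0 < r \<Longrightarrow> r \<le> \<epsilon> \<Longrightarrow> 0 \<le> t \<Longrightarrow>
    damped_ode (r powr (2 * \<delta>)) (r powr (2 * \<sigma>)) y y' \<Longrightarrow>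
    T = (1 + t) powr (1 / \<theta>) \<Longrightarrow> W = low_weight (2 * \<delta>) \<kappa> T r \<Longrightarrow>
    norm (y t) \<le> K * (T powr - (2 * \<delta>) * W * norm (y 0) + W * norm (y' 0)) \<and>
    r powr \<sigma> * norm (y t) \<le> K * (T powr - (\<sigma> + 2 * \<delta>) * W * norm (y 0) + T powr - \<sigma> * W * norm (y' 0)) \<and>
    norm (y' t) \<le> K * (T powr - (\<theta> + 2 * \<delta>) * W * norm (y 0) + T powr - \<theta> * W * norm (y' 0))"
proof -
  define g where "g = 2 * \<sigma> - 4 * \<delta>"
  \<comment> \<open>The overdamped regime 16 q <= p^2 reads r^g <= 1 / 16.\<close>
  define \<epsilon> where "\<epsilon> = (1 / 16 :: real) powr (1 / g)"
  have g: "0 < g" using \<sigma> by (simp add: g_def)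
  have \<theta>: "0 < \<theta>" "2 * \<delta> \<le> \<theta>" using \<sigma> by (auto simp: \<theta>_def)
  have \<epsilon>: "0 < \<epsilon>" "\<epsilon> \<le> 1" using g powr_mono2[of "1 / g" "1 / 16" 1] by (auto simp: \<epsilon>_def)
  \<comment> \<open>The powers r^j left once r^(-2 \<delta>) is split off, in pairs for y(0) and
    y'(0): for y itself, for r^\<sigma> y, and for y', whose slow mode brings a factor q / p =
    r^\<theta>.\<close>
  let ?J = "{2 * \<delta>, 0, \<sigma> + 2 * \<delta>, \<sigma>, \<theta> + 2 * \<delta>, \<theta>}"
  have J: "0 \<le> j" if "j \<in> ?J" for j using that \<sigma> \<theta> by auto
  obtain M where M: "0 < M" "\<And>j T r a. j \<in> ?J \<Longrightarrow> 0 < T \<Longrightarrow> 0 < r \<Longrightarrow>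
    r powr j * r powr - a * exp (- (1 / 4 * (T * r) powr \<theta>)) \<le> M * (T powr - j * low_weight a \<kappa> T r)"
    by (rule exp_le_low_weight_finite[of ?J "1 / 4" \<theta> \<kappa>]) (use J \<theta> \<kappa> in auto)
  define K where "K = 12 * exp 1 * M"
  have K: "0 < K" using M by (simp add: K_def)
  show ?thesis
  proof (rule that[OF K \<epsilon>(1)])
    fix r t y y' T W
    assume r: "0 < r" "r \<le> \<epsilon>" and t: "0 \<le> t"
      and ode: "damped_ode (r powr (2 * \<delta>)) (r powr (2 * \<sigma>)) y y'"
      and T_eq: "T = (1 + t) powr (1 / \<theta>)" and W_eq: "W = low_weight (2 * \<delta>) \<kappa> T r"
    define p q where "p = r powr (2 * \<delta>)" and "q = r powr (2 * \<sigma>)"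
    have r1: "r \<le> 1" using r \<epsilon> by simp
    have T: "0 < T" using t by (simp add: T_eq)
    have W: "0 \<le> W" by (simp add: W_eq)
    have p: "0 < p" "p \<le> 1" using r r1 \<sigma> powr_mono2[of "2 * \<delta>" r 1] by (auto simp: p_def)
    have q: "0 < q" using r by (simp add: q_def)
    have pq: "16 * q \<le> p\<^sup>2"
    proof -
      have "r powr g \<le> \<epsilon> powr g" using r g by (intro powr_mono2) auto
      also have "\<epsilon> powr g = 1 / 16" using g by (simp add: \<epsilon>_def powr_powr)
      finally have "16 * r powr g \<le> 1" by simp
      then have "p\<^sup>2 * (16 * r powr g) \<le> p\<^sup>2 * 1" by (intro mult_left_mono) auto
      moreover have "p\<^sup>2 * r powr g = q"
        by (simp add: p_def q_def g_def power2_eq_square powr_add[symmetric])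
      ultimately show ?thesis by (simp add: mult.left_commute)
    qed
    have qp: "q / p = r powr \<theta>" by (simp add: q_def p_def \<theta>_def powr_diff[symmetric] algebra_simps)
    have T\<theta>: "T powr \<theta> = 1 + t" using \<theta> t by (simp add: T_eq powr_powr)
    have v: "(T * r) powr \<theta> = (1 + t) * r powr \<theta>" using T r by (simp add: powr_mult T\<theta>)
    define e0 where "e0 = exp (- (1 / 4 * (T * r) powr \<theta>))"
    \<comment> \<open>Passing from t to 1 + t costs \<open>exp 1\<close> because r^\<theta> <= 1.
      The rate is lowered to 1 / 4 to agree with what is left of the fast mode in
      \<open>b7\<close>.\<close>
    have e0: "exp (- (q / p * t)) \<le> exp 1 * e0"
    proof -
      have "r powr \<theta> \<le> 1" using r r1 \<theta> powr_mono2[of \<theta> r 1] by auto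
      then have "- (q / p * t) \<le> 1 + - ((T * r) powr \<theta>)" unfolding qp v by (simp add: algebra_simps)
      also have "\<dots> \<le> 1 + - (1 / 4 * (T * r) powr \<theta>)" by simp
      finally have "- (q / p * t) \<le> 1 + - (1 / 4 * (T * r) powr \<theta>)" .
      then show ?thesis unfolding e0_def exp_add[symmetric] by simp
    qed
    have e00: "0 < e0" by (simp add: e0_def)
    have ip: "1 / p = r powr - (2 * \<delta>)" by (simp add: p_def powr_minus_divide)
    define a b where "a = norm (y 0)" and "b = norm (y' 0)"
    have ab: "0 \<le> a" "0 \<le> b" by (auto simp: a_def b_def)
    have ode': "(y has_vector_derivative y' s) (at s within {0..})"
      "(y' has_vector_derivative - (p *\<^sub>R y' s) - q *\<^sub>R y s) (at s within {0..})" if "0 \<le> s" for s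
      using ode that by (auto simp: damped_ode_def p_def q_def)
    have y_le: "norm (y t) \<le> exp 1 * e0 * (2 * a + 4 / p * b)"
    proof -
      have "norm (y t) \<le> exp (- (q / p * t)) * (2 * a + 4 / p * b)"
        unfolding a_def b_def by (rule overdamped_bound(1)[OF p(1) q pq ode' t])
      also have "\<dots> \<le> exp 1 * e0 * (2 * a + 4 / p * b)"
        using e0 ab p by (intro mult_right_mono) auto
      finally show ?thesis .
    qed
    note Mj = M(2)[OF _ T r(1), of _ "2 * \<delta>", folded e0_def W_eq]
    have b1: "e0 \<le> M * (T powr - (2 * \<delta>) * W)"
      using Mj[of "2 * \<delta>"] r by (simp add: powr_add[symmetric])
    have b2: "e0 * (1 / p) \<le> M * W"
      using Mj[of 0] r T by (simp add: ip mult.commute)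
    have b3: "r powr \<sigma> * e0 \<le> M * (T powr - (\<sigma> + 2 * \<delta>) * W)"
      using Mj[of "\<sigma> + 2 * \<delta>"] r by (simp add: powr_add[symmetric])
    have b4: "r powr \<sigma> * (e0 * (1 / p)) \<le> M * (T powr - \<sigma> * W)"
      using Mj[of \<sigma>] by (simp add: ip mult_ac)
    have b5: "r powr \<theta> * e0 \<le> M * (T powr - (\<theta> + 2 * \<delta>) * W)"
      using Mj[of "\<theta> + 2 * \<delta>"] r by (simp add: powr_add[symmetric])
    have b6: "r powr \<theta> * (e0 * (1 / p)) \<le> M * (T powr - \<theta> * W)"
      using Mj[of \<theta>] by (simp add: ip mult_ac)
    \<comment> \<open>The fast mode decays in x = p (1 + t), and x >= (T r)^\<theta> since \<theta>
      >= 2 \<delta> and r <= 1. One factor \<open>exp (- (x / 4))\<close> is traded for 4 / x, which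
      is exactly 4 T^(-\<theta>) r^(-2 \<delta>); the other provides the decay in T r.\<close>
    have b7: "exp (- (p / 2 * t)) \<le> 4 * exp 1 * (M * (T powr - \<theta> * W))"
    proof -
      define x where "x = p * (1 + t)"
      have x: "0 < x" using p t by (simp add: x_def)
      have "r powr \<theta> \<le> p" unfolding p_def using r r1 \<theta> by (intro powr_mono') auto
      then have vx: "(T * r) powr \<theta> \<le> x" unfolding v x_def using t by (simp add: mult.commute mult_right_mono)
      have "exp (- (p / 2 * t)) \<le> exp (1 + (- (x / 2)))" using p by (simp add: x_def field_simps)
      also have "\<dots> = exp 1 * (exp (- (x / 4)) * exp (- (x / 4)))" by (simp only: mult_exp_exp) simp
      also have "\<dots> \<le> exp 1 * (4 / x * exp (- (1 / 4 * (T * r) powr \<theta>)))"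
      proof (intro mult_left_mono mult_mono)
        have "x / 4 \<le> exp (x / 4)" using exp_ge_add_one_self[of "x / 4"] by linarith
        then show "exp (- (x / 4)) \<le> 4 / x" using x by (simp add: exp_minus field_simps)
        show "exp (- (x / 4)) \<le> exp (- (1 / 4 * (T * r) powr \<theta>))" using vx by simp
      qed (use x in auto)
      also have "4 / x = 4 * (T powr - \<theta> * r powr - (2 * \<delta>))"
        using p t by (simp add: x_def powr_minus_divide T\<theta> p_def)
      also have "exp 1 * (4 * (T powr - \<theta> * r powr - (2 * \<delta>)) * exp (- (1 / 4 * (T * r) powr \<theta>))) =
          4 * exp 1 * T powr - \<theta> * (r powr 0 * r powr - (2 * \<delta>) * exp (- (1 / 4 * (T * r) powr \<theta>)))"
        using r by simp
      also have "\<dots> \<le> 4 * exp 1 * T powr - \<theta> * (M * (T powr - 0 * low_weight (2 * \<delta>) \<kappa> T r))"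
        by (intro mult_left_mono M(2) T r) auto
      also have "\<dots> = 4 * exp 1 * (M * (T powr - \<theta> * W))" using T by (simp add: W_eq)
      finally show ?thesis .
    qed
    have up: "c * (X * z) \<le> 12 * exp 1 * (Y * z)" if "X \<le> Y" "0 \<le> X" "0 \<le> z" "0 \<le> c" "c \<le> 12 * exp 1" for c X Y z :: real
      using that by (intro mult_mono) auto
    have "norm (y t) \<le> K * (T powr - (2 * \<delta>) * W * a + W * b)"
    proof -
      have "exp 1 * e0 * (2 * a + 4 / p * b) = 2 * exp 1 * (e0 * a) + 4 * exp 1 * (e0 * (1 / p) * b)"
        by (simp add: algebra_simps)
      also have "\<dots> \<le> 12 * exp 1 * (M * (T powr - (2 * \<delta>) * W) * a) + 12 * exp 1 * (M * W * b)"
        using ab e00 p by (intro add_mono up b1 b2) auto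
      also have "\<dots> = K * (T powr - (2 * \<delta>) * W * a + W * b)" by (simp add: K_def algebra_simps)
      finally show ?thesis using y_le by linarith
    qed
    moreover have "r powr \<sigma> * norm (y t) \<le> K * (T powr - (\<sigma> + 2 * \<delta>) * W * a + T powr - \<sigma> * W * b)"
    proof -
      have "r powr \<sigma> * norm (y t) \<le> r powr \<sigma> * (exp 1 * e0 * (2 * a + 4 / p * b))"
        by (intro mult_left_mono y_le) auto
      also have "\<dots> = 2 * exp 1 * (r powr \<sigma> * e0 * a) + 4 * exp 1 * (r powr \<sigma> * (e0 * (1 / p)) * b)"
        by (simp add: algebra_simps)
      also have "\<dots> \<le> 12 * exp 1 * (M * (T powr - (\<sigma> + 2 * \<delta>) * W) * a) + 12 * exp 1 * (M * (T powr - \<sigma> * W) * b)"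
        using ab e00 p by (intro add_mono up b3 b4) auto
      also have "\<dots> = K * (T powr - (\<sigma> + 2 * \<delta>) * W * a + T powr - \<sigma> * W * b)" by (simp add: K_def algebra_simps)
      finally show ?thesis .
    qed
    moreover have "norm (y' t) \<le> K * (T powr - (\<theta> + 2 * \<delta>) * W * a + T powr - \<theta> * W * b)"
    proof -
      have "norm (y' t) \<le> 4 * (q / p) * exp (- (q / p * t)) * a + (4 * (q / p) / p * exp (- (q / p * t)) + 2 * exp (- (p / 2 * t))) * b"
        unfolding a_def b_def by (rule overdamped_bound(2)[OF p(1) q pq ode' t])
      also have "\<dots> \<le> 4 * (q / p) * (exp 1 * e0) * a + (4 * (q / p) / p * (exp 1 * e0) + 2 * (4 * exp 1 * (M * (T powr - \<theta> * W)))) * b"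
        using e0 b7 p q ab by (intro add_mono mult_right_mono mult_left_mono) auto
      also have "\<dots> = 4 * exp 1 * (r powr \<theta> * e0 * a) + (4 * exp 1 * (r powr \<theta> * (e0 * (1 / p))) + 8 * exp 1 * (M * (T powr - \<theta> * W))) * b"
        unfolding qp by (simp add: algebra_simps)
      also have "\<dots> \<le> 12 * exp 1 * (M * (T powr - (\<theta> + 2 * \<delta>) * W) * a) +
          (4 * exp 1 * (M * (T powr - \<theta> * W)) + 8 * exp 1 * (M * (T powr - \<theta> * W))) * b"
        using ab e00 p by (intro add_mono[OF up[OF b5]] mult_right_mono add_right_mono mult_left_mono b6) auto
      also have "\<dots> = K * (T powr - (\<theta> + 2 * \<delta>) * W * a + T powr - \<theta> * W * b)" by (simp add: K_def algebra_simps)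
      finally show ?thesis .
    qed
    ultimately show "norm (y t) \<le> K * (T powr - (2 * \<delta>) * W * norm (y 0) + W * norm (y' 0)) \<and>
      r powr \<sigma> * norm (y t) \<le> K * (T powr - (\<sigma> + 2 * \<delta>) * W * norm (y 0) + T powr - \<sigma> * W * norm (y' 0)) \<and>
      norm (y' t) \<le> K * (T powr - (\<theta> + 2 * \<delta>) * W * norm (y 0) + T powr - \<theta> * W * norm (y' 0))"
      by (simp add: a_def b_def)
  qed
qed

text \<open>For r >= \<epsilon> the ratio p^2 / q is bounded above, while p and
  \<open>sqrt q\<close> are bounded below, so one \<eta> satisfies the conditions of
  \<open>damped_energy_bound\<close> at all these frequencies. That bound concerns squares, hence
  the rate \<eta> / 4 for norms.\<close>

lemma high_frequency_multiplier:
  fixes \<sigma> \<delta> \<epsilon> :: real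
  assumes \<sigma>: "0 < 2 * \<delta>" "2 * \<delta> < \<sigma>" and \<epsilon>: "0 < \<epsilon>"
  obtains K c where "0 < K" "0 < c" "\<And>r t y y'. \<epsilon> \<le> r \<Longrightarrow> 0 \<le> t \<Longrightarrow>
    damped_ode (r powr (2 * \<delta>)) (r powr (2 * \<sigma>)) y y' \<Longrightarrow>
    norm (y t) \<le> K * (exp (- (c * t)) * (norm (y 0) + norm (y' 0))) \<and>
    r powr \<sigma> * norm (y t) \<le> K * (exp (- (c * t)) * (r powr \<sigma> * norm (y 0) + norm (y' 0))) \<and>
    norm (y' t) \<le> K * (exp (- (c * t)) * (r powr \<sigma> * norm (y 0) + norm (y' 0)))"
proof -
  define K0 where "K0 = \<epsilon> powr (4 * \<delta> - 2 * \<sigma>) / 2"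
  define \<eta> where "\<eta> = min (\<epsilon> powr (2 * \<delta>) / (2 * (1 + K0))) (\<epsilon> powr \<sigma> / 2)"
  \<comment> \<open>The 2 exceeds the square root of the energy constant 3. Dividing by r^\<sigma>
    to isolate y costs at most \<open>\<epsilon> powr - \<sigma>\<close> on the y'(0) term.\<close>
  define K where "K = 2 * (1 + \<epsilon> powr - \<sigma>)"
  have K0: "0 < K0" using \<epsilon> by (simp add: K0_def)
  have \<eta>: "0 < \<eta>" using \<epsilon> K0 by (simp add: \<eta>_def)
  have K: "2 \<le> K" "0 < K" by (auto simp: K_def intro: add_pos_nonneg)
  show ?thesis
  proof (rule that[of K "\<eta> / 4"])
    fix r t :: real and y y' :: "real \<Rightarrow> complex"
    assume r: "\<epsilon> \<le> r" and t: "0 \<le> t" and ode: "damped_ode (r powr (2 * \<delta>)) (r powr (2 * \<sigma>)) y y'"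
    define p q where "p = r powr (2 * \<delta>)" and "q = r powr (2 * \<sigma>)"
    define a b where "a = norm (y 0)" and "b = norm (y' 0)"
    define s where "s = r powr \<sigma>"
    have ab: "0 \<le> a" "0 \<le> b" by (auto simp: a_def b_def)
    have r0: "0 < r" using r \<epsilon> by simp
    have p: "0 < p" and q: "0 < q" and s: "0 < s" using r0 by (auto simp: p_def q_def s_def)
    have qs: "q = s\<^sup>2" by (simp add: q_def s_def power2_eq_square powr_add[symmetric])
    have ode': "(y has_vector_derivative y' x) (at x within {0..})"
      "(y' has_vector_derivative - (p *\<^sub>R y' x) - q *\<^sub>R y x) (at x within {0..})" if "0 \<le> x" for x
      using ode that by (auto simp: damped_ode_def p_def q_def)
    have \<eta>1: "\<eta> * (1 + p\<^sup>2 / (2 * q)) \<le> p / 2"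
    proof -
      have "p\<^sup>2 / q = r powr (4 * \<delta> - 2 * \<sigma>)"
        by (simp add: p_def q_def power2_eq_square powr_add[symmetric] powr_diff)
      also have "\<dots> \<le> \<epsilon> powr (4 * \<delta> - 2 * \<sigma>)" using r \<epsilon> \<sigma> by (intro powr_mono2') auto
      finally have "p\<^sup>2 / (2 * q) \<le> K0" by (simp add: K0_def)
      then have "\<eta> * (1 + p\<^sup>2 / (2 * q)) \<le> \<eta> * (1 + K0)" using \<eta> by (intro mult_left_mono) auto
      also have "\<dots> \<le> \<epsilon> powr (2 * \<delta>) / (2 * (1 + K0)) * (1 + K0)" using K0 by (intro mult_right_mono) (auto simp: \<eta>_def)
      also have "\<dots> = \<epsilon> powr (2 * \<delta>) / 2" using K0 by (simp add: divide_simps)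
      also have "\<dots> \<le> p / 2" unfolding p_def using r \<epsilon> \<sigma> by (intro divide_right_mono powr_mono2) auto
      finally show ?thesis .
    qed
    have es: "\<epsilon> powr \<sigma> \<le> s" unfolding s_def using r \<epsilon> \<sigma> by (intro powr_mono2) auto
    have \<eta>2: "2 * \<eta> \<le> sqrt q" using es s by (simp add: \<eta>_def qs)
    define E where "E = exp (- (\<eta> / 4 * t))"
    have E: "0 < E" "exp (- (\<eta> / 2 * t)) = E\<^sup>2"
      by (auto simp: E_def power2_eq_square mult_exp_exp field_simps)
    have "(norm (y' t))\<^sup>2 + q * (norm (y t))\<^sup>2 \<le> 3 * E\<^sup>2 * (b\<^sup>2 + q * a\<^sup>2)"
      unfolding E(2)[symmetric] a_def b_def
      by (rule damped_energy_bound[OF p q less_imp_le[OF \<eta>] \<eta>1 \<eta>2 ode' t])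
    also have "\<dots> \<le> (2 * E * (s * a + b))\<^sup>2"
    proof -
      have "3 * (b\<^sup>2 + q * a\<^sup>2) \<le> (2 * (s * a + b))\<^sup>2"
        using ab s by (simp add: qs power2_eq_square algebra_simps)
      then have "E\<^sup>2 * (3 * (b\<^sup>2 + q * a\<^sup>2)) \<le> E\<^sup>2 * (2 * (s * a + b))\<^sup>2" by (rule mult_left_mono) simp
      moreover have "E\<^sup>2 * (2 * (s * a + b))\<^sup>2 = (2 * E * (s * a + b))\<^sup>2" by (simp only: power_mult_distrib mult_ac)
      moreover have "E\<^sup>2 * (3 * (b\<^sup>2 + q * a\<^sup>2)) = 3 * E\<^sup>2 * (b\<^sup>2 + q * a\<^sup>2)" by simp
      ultimately show ?thesis by (simp only:)
    qed
    finally have en: "(norm (y' t))\<^sup>2 + (s * norm (y t))\<^sup>2 \<le> (2 * E * (s * a + b))\<^sup>2"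
      by (simp add: qs power_mult_distrib)
    have nn: "0 \<le> 2 * E * (s * a + b)" using E s ab by simp
    have y': "norm (y' t) \<le> 2 * E * (s * a + b)"
      by (rule power2_le_imp_le[OF _ nn]) (use en zero_le_power2[of "s * norm (y t)"] in linarith)
    have sy: "s * norm (y t) \<le> 2 * E * (s * a + b)"
      by (rule power2_le_imp_le[OF _ nn]) (use en zero_le_power2[of "norm (y' t)"] in linarith)
    have up: "2 * E * (s * a + b) \<le> K * (E * (s * a + b))"
      using mult_right_mono[OF K(1), of "E * (s * a + b)"] E s ab by simp
    have "norm (y t) = s * norm (y t) / s" using s by simp
    also have "\<dots> \<le> 2 * E * (s * a + b) / s" using sy s by (intro divide_right_mono) auto
    also have "\<dots> = 2 * E * (a + b * (1 / s))" using s by (simp add: field_simps)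
    also have "\<dots> \<le> 2 * E * (a + b * \<epsilon> powr - \<sigma>)"
    proof -
      have "1 / s \<le> 1 / \<epsilon> powr \<sigma>" using es \<epsilon> s by (intro divide_left_mono) auto
      then have "1 / s \<le> \<epsilon> powr - \<sigma>" by (simp add: powr_minus_divide)
      then show ?thesis using E ab by (intro mult_left_mono add_left_mono) auto
    qed
    also have "\<dots> \<le> K * (E * (a + b))"
    proof -
      have "a + b * \<epsilon> powr - \<sigma> \<le> (1 + \<epsilon> powr - \<sigma>) * (a + b)" using ab by (simp add: algebra_simps)
      from mult_left_mono[OF this, of "2 * E"] show ?thesis using E by (simp add: K_def mult_ac)
    qed
    finally have yb: "norm (y t) \<le> K * (E * (a + b))" .
    show "norm (y t) \<le> K * (exp (- (\<eta> / 4 * t)) * (norm (y 0) + norm (y' 0))) \<and>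
      r powr \<sigma> * norm (y t) \<le> K * (exp (- (\<eta> / 4 * t)) * (r powr \<sigma> * norm (y 0) + norm (y' 0))) \<and>
      norm (y' t) \<le> K * (exp (- (\<eta> / 4 * t)) * (r powr \<sigma> * norm (y 0) + norm (y' 0)))"
      using yb order_trans[OF sy up] order_trans[OF y' up] by (simp add: E_def s_def a_def b_def)
  qed (use K \<eta> in auto)
qed

text \<open>All terms are nonnegative, so the sum of the low and the high bound holds at every
  frequency and no cut-off appears later. The power r^\<sigma> is enlarged to the symbol of the
  Sobolev norm.\<close>

lemma multiplier_bound:
  fixes \<sigma> \<delta> \<kappa> :: real
  assumes \<sigma>: "0 < 2 * \<delta>" "2 * \<delta> < \<sigma>" and \<kappa>: "0 \<le> \<kappa>"
  defines "\<theta> \<equiv> 2 * (\<sigma> - \<delta>)"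
  obtains K c where "0 < K" "0 < c" "\<And>r t y y' T W. 0 < r \<Longrightarrow> 0 \<le> t \<Longrightarrow>
    damped_ode (r powr (2 * \<delta>)) (r powr (2 * \<sigma>)) y y' \<Longrightarrow>
    T = (1 + t) powr (1 / \<theta>) \<Longrightarrow> W = low_weight (2 * \<delta>) \<kappa> T r \<Longrightarrow>
    norm (y t) \<le> K * (T powr - (2 * \<delta>) * W * norm (y 0) + W * norm (y' 0) +
      exp (- (c * t)) * (norm (y 0) + norm (y' 0))) \<and>
    r powr \<sigma> * norm (y t) \<le> K * (T powr - (\<sigma> + 2 * \<delta>) * W * norm (y 0) + T powr - \<sigma> * W * norm (y' 0) +
      exp (- (c * t)) * ((1 + r\<^sup>2) powr (\<sigma> / 2) * norm (y 0) + norm (y' 0))) \<and>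
    norm (y' t) \<le> K * (T powr - (\<theta> + 2 * \<delta>) * W * norm (y 0) + T powr - \<theta> * W * norm (y' 0) +
      exp (- (c * t)) * ((1 + r\<^sup>2) powr (\<sigma> / 2) * norm (y 0) + norm (y' 0)))"
proof -
  obtain K1 \<epsilon> where K1: "0 < K1" and \<epsilon>: "0 < \<epsilon>" and low: "\<And>r t y y' T W. 0 < r \<Longrightarrow> r \<le> \<epsilon> \<Longrightarrow> 0 \<le> t \<Longrightarrow>
    damped_ode (r powr (2 * \<delta>)) (r powr (2 * \<sigma>)) y y' \<Longrightarrow>
    T = (1 + t) powr (1 / (2 * (\<sigma> - \<delta>))) \<Longrightarrow> W = low_weight (2 * \<delta>) \<kappa> T r \<Longrightarrow>
    norm (y t) \<le> K1 * (T powr - (2 * \<delta>) * W * norm (y 0) + W * norm (y' 0)) \<and>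
    r powr \<sigma> * norm (y t) \<le> K1 * (T powr - (\<sigma> + 2 * \<delta>) * W * norm (y 0) + T powr - \<sigma> * W * norm (y' 0)) \<and>
    norm (y' t) \<le> K1 * (T powr - (2 * (\<sigma> - \<delta>) + 2 * \<delta>) * W * norm (y 0) + T powr - (2 * (\<sigma> - \<delta>)) * W * norm (y' 0))"
    using low_frequency_multiplier[OF \<sigma> \<kappa>] by blast
  obtain K2 c where K2: "0 < K2" and c: "0 < c" and high: "\<And>r t y y'. \<epsilon> \<le> r \<Longrightarrow> 0 \<le> t \<Longrightarrow>
    damped_ode (r powr (2 * \<delta>)) (r powr (2 * \<sigma>)) y y' \<Longrightarrow>
    norm (y t) \<le> K2 * (exp (- (c * t)) * (norm (y 0) + norm (y' 0))) \<and>
    r powr \<sigma> * norm (y t) \<le> K2 * (exp (- (c * t)) * (r powr \<sigma> * norm (y 0) + norm (y' 0))) \<and>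
    norm (y' t) \<le> K2 * (exp (- (c * t)) * (r powr \<sigma> * norm (y 0) + norm (y' 0)))"
    using high_frequency_multiplier[OF \<sigma> \<epsilon>] by blast
  show ?thesis
  proof (rule that[of "max K1 K2" c])
    show "0 < max K1 K2" using K1 by simp
    fix r t :: real and y y' :: "real \<Rightarrow> complex" and T W :: real
    assume r: "0 < r" and t: "0 \<le> t" and ode: "damped_ode (r powr (2 * \<delta>)) (r powr (2 * \<sigma>)) y y'"
      and T: "T = (1 + t) powr (1 / \<theta>)" and W_eq: "W = low_weight (2 * \<delta>) \<kappa> T r"
    define a b H where "a = norm (y 0)" and "b = norm (y' 0)" and "H = (1 + r\<^sup>2) powr (\<sigma> / 2) * a"
    have W: "0 \<le> W" by (simp add: W_eq)
    have ab: "0 \<le> a" "0 \<le> b" by (auto simp: a_def b_def)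
    have rH: "r powr \<sigma> * a \<le> H"
    proof -
      have "r powr \<sigma> = (r\<^sup>2) powr (\<sigma> / 2)" using r by (simp add: power2_powr)
      also have "\<dots> \<le> (1 + r\<^sup>2) powr (\<sigma> / 2)" using \<sigma> by (intro powr_mono2) auto
      finally show ?thesis using ab by (simp add: H_def mult_right_mono)
    qed
    have H: "0 \<le> H" using ab by (simp add: H_def)
    have comb: "X \<le> max K1 K2 * (P + Q + E)"
      if "r \<le> \<epsilon> \<Longrightarrow> X \<le> K1 * (P + Q)" "\<epsilon> \<le> r \<Longrightarrow> X \<le> K2 * E'" "E' \<le> E" "0 \<le> P" "0 \<le> Q" "0 \<le> E" for X P Q E E'
    proof (cases "r \<le> \<epsilon>")
      case True
      have "X \<le> K1 * (P + Q)" by (rule that(1)[OF True])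
      also have "\<dots> \<le> max K1 K2 * (P + Q + E)" using that K1 by (intro mult_mono) auto
      finally show ?thesis .
    next
      case False
      then have "X \<le> K2 * E'" using that(2) by simp
      also have "\<dots> \<le> K2 * E" using that(3) K2 by (intro mult_left_mono) auto
      also have "\<dots> \<le> max K1 K2 * (P + Q + E)" using that K2 by (intro mult_mono) auto
      finally show ?thesis .
    qed
    note lo = low[OF r _ t ode T[unfolded \<theta>_def] W_eq, folded a_def b_def \<theta>_def]
    note hi = high[OF _ t ode, folded a_def b_def]
    have e: "exp (- (c * t)) * (r powr \<sigma> * a + b) \<le> exp (- (c * t)) * (H + b)" using rH by simp
    have "norm (y t) \<le> max K1 K2 * (T powr - (2 * \<delta>) * W * a + W * b + exp (- (c * t)) * (a + b))"
      by (rule comb[OF _ _ order_refl]) (use lo hi ab W in auto)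
    moreover have "r powr \<sigma> * norm (y t) \<le> max K1 K2 * (T powr - (\<sigma> + 2 * \<delta>) * W * a + T powr - \<sigma> * W * b + exp (- (c * t)) * (H + b))"
      by (rule comb[OF _ _ e]) (use lo hi ab W H in auto)
    moreover have "norm (y' t) \<le> max K1 K2 * (T powr - (\<theta> + 2 * \<delta>) * W * a + T powr - \<theta> * W * b + exp (- (c * t)) * (H + b))"
      by (rule comb[OF _ _ e]) (use lo hi ab W H in auto)
    ultimately show "norm (y t) \<le> max K1 K2 * (T powr - (2 * \<delta>) * W * norm (y 0) + W * norm (y' 0) +
      exp (- (c * t)) * (norm (y 0) + norm (y' 0))) \<and>
    r powr \<sigma> * norm (y t) \<le> max K1 K2 * (T powr - (\<sigma> + 2 * \<delta>) * W * norm (y 0) + T powr - \<sigma> * W * norm (y' 0) +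
      exp (- (c * t)) * ((1 + r\<^sup>2) powr (\<sigma> / 2) * norm (y 0) + norm (y' 0))) \<and>
    norm (y' t) \<le> max K1 K2 * (T powr - (\<theta> + 2 * \<delta>) * W * norm (y 0) + T powr - \<theta> * W * norm (y' 0) +
      exp (- (c * t)) * ((1 + r\<^sup>2) powr (\<sigma> / 2) * norm (y 0) + norm (y' 0)))"
      by (simp add: a_def b_def H_def)
  qed (rule c)
qed

lemma exp_le_powr_decay:
  assumes "0 \<le> (\<beta>::real)" "0 < c"
  obtains K where "0 < K" "\<And>t. 0 \<le> t \<Longrightarrow> exp (- (c * t)) \<le> K * (1 + t) powr - \<beta>"
proof -
  obtain K where K: "0 < K" "\<And>u. 0 < u \<Longrightarrow> u powr \<beta> * exp (- (c * u)) \<le> K"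
    using powr_exp_bound[OF assms] by blast
  show ?thesis
  proof (rule that[of "K * exp c"])
    fix t :: real assume t: "0 \<le> t"
    have "exp (- (c * t)) = exp c * ((1 + t) powr - \<beta> * ((1 + t) powr \<beta> * exp (- (c * (1 + t)))))"
    proof -
      have "exp (- (c * t)) = exp c * exp (- (c * (1 + t)))" by (simp add: mult_exp_exp algebra_simps)
      moreover have "(1 + t) powr - \<beta> * (1 + t) powr \<beta> = 1" using t by (simp flip: powr_add)
      ultimately show ?thesis by (simp only: mult.assoc[symmetric] mult_1_right) 
    qed
    also have "\<dots> \<le> exp c * ((1 + t) powr - \<beta> * K)" using K(2)[of "1 + t"] t by (intro mult_left_mono) auto
    finally show "exp (- (c * t)) \<le> K * exp c * (1 + t) powr - \<beta>" by (simp add: mult_ac)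
  qed (use K in simp)
qed

section \<open>Explicit solutions and existence\<close>

lemma explicit_damped_ode:
  fixes p q :: real and a b D :: complex
  assumes D: "D \<noteq> 0" "D\<^sup>2 = of_real (p\<^sup>2 - 4 * q)"
  defines "l1 \<equiv> (- of_real p + D) / 2" and "l2 \<equiv> (- of_real p - D) / 2"
  defines "y \<equiv> \<lambda>t::real. (exp (l1 * of_real t) * (b - l2 * a) - exp (l2 * of_real t) * (b - l1 * a)) / D"
    and "y' \<equiv> \<lambda>t::real. (l1 * exp (l1 * of_real t) * (b - l2 * a) - l2 * exp (l2 * of_real t) * (b - l1 * a)) / D"
  shows "damped_ode p q y y'" "y 0 = a" "y' 0 = b"
proof -
  \<comment> \<open>\<open>D\<close> is any complex square root of the discriminant, which treats
    real and conjugate roots at once; the double root is excluded by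
    \<open>D \<noteq> 0\<close>.\<close>
  have ll: "l1 - l2 = D" "l1 + l2 = - of_real p" by (auto simp: l1_def l2_def field_simps)
  have prod: "l1 * l2 = of_real q"
  proof -
    have "4 * (l1 * l2) = (of_real p)\<^sup>2 - D\<^sup>2" by (simp add: l1_def l2_def power2_eq_square field_simps)
    then show ?thesis by (simp add: D(2))
  qed
  have sq: "l1 * l1 = - of_real p * l1 - of_real q" "l2 * l2 = - of_real p * l2 - of_real q"
    unfolding prod[symmetric] ll(2)[symmetric] by (auto simp: algebra_simps)
  have e: "((\<lambda>t::real. exp (l * of_real t)) has_vector_derivative l * exp (l * of_real t)) (at t within S)" for l :: complex and t S
    by (rule has_vector_derivative_real_field) (auto intro!: derivative_eq_intros)
  have d1: "(y has_vector_derivative y' t) (at t within {0..})" for t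
    unfolding y_def y'_def
    by (intro has_vector_derivative_divide has_vector_derivative_diff has_vector_derivative_mult_left e)
  have "(y' has_vector_derivative (l1 * (l1 * exp (l1 * of_real t)) * (b - l2 * a) - l2 * (l2 * exp (l2 * of_real t)) * (b - l1 * a)) / D) (at t within {0..})" for t
    unfolding y'_def
    by (intro has_vector_derivative_divide has_vector_derivative_diff has_vector_derivative_mult_left has_vector_derivative_mult_right e)
  moreover have "(l1 * (l1 * exp (l1 * of_real t)) * (b - l2 * a) - l2 * (l2 * exp (l2 * of_real t)) * (b - l1 * a)) / D =
      - (p *\<^sub>R y' t) - q *\<^sub>R y t" for t
    unfolding mult.assoc[symmetric] sq y_def y'_def using D(1) by (simp add: scaleR_conv_of_real field_simps)
  ultimately show "damped_ode p q y y'" using d1 by (simp add: damped_ode_def)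
  have "y 0 = (l1 - l2) * a / D" by (simp add: y_def algebra_simps)
  then show "y 0 = a" using D(1) by (simp add: ll)
  have "y' 0 = (l1 - l2) * b / D" by (simp add: y'_def algebra_simps)
  then show "y' 0 = b" using D(1) by (simp add: ll)
qed

text \<open>A crude bound, uniform in the frequency, which places the solution in L^2 at each time.
  The undamped energy estimate controls r^\<sigma> y and y'. For r >= 1 the first bounds y; for r <
  1 the second is integrated in time, whence the linear growth.\<close>

lemma damped_ode_growth:
  fixes \<sigma> \<delta> r :: real
  assumes r: "0 < r" and \<sigma>: "0 \<le> \<sigma>" and ode: "damped_ode (r powr (2 * \<delta>)) (r powr (2 * \<sigma>)) y y'" and t: "0 \<le> t"
  shows "norm (y t) \<le> 2 * (1 + t) * (norm (y 0) + norm (y' 0))"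
proof -
  define p q s where "p = r powr (2 * \<delta>)" and "q = r powr (2 * \<sigma>)" and "s = r powr \<sigma>"
  define a b where "a = norm (y 0)" and "b = norm (y' 0)"
  have ab: "0 \<le> a" "0 \<le> b" by (auto simp: a_def b_def)
  have p: "0 < p" and q: "0 < q" and s: "0 < s" using r by (auto simp: p_def q_def s_def)
  have qs: "q = s\<^sup>2" by (simp add: q_def s_def power2_eq_square powr_add[symmetric])
  have ode': "(y has_vector_derivative y' x) (at x within {0..})"
      "(y' has_vector_derivative - (p *\<^sub>R y' x) - q *\<^sub>R y x) (at x within {0..})" if "0 \<le> x" for x
    using ode that by (auto simp: damped_ode_def p_def q_def)
  have en: "(norm (y' x))\<^sup>2 + (s * norm (y x))\<^sup>2 \<le> (2 * (s * a + b))\<^sup>2" if x: "0 \<le> x" for x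
  proof -
    have "(norm (y' x))\<^sup>2 + q * (norm (y x))\<^sup>2 \<le> 3 * exp (- (0 / 2 * x)) * (b\<^sup>2 + q * a\<^sup>2)"
      unfolding a_def b_def using p q by (intro damped_energy_bound[OF p q _ _ _ ode' x]) auto
    also have "\<dots> = 3 * b\<^sup>2 + 3 * (s * a)\<^sup>2" by (simp add: qs power_mult_distrib)
    also have "\<dots> \<le> (2 * (s * a + b))\<^sup>2" using ab s by (simp add: power2_eq_square algebra_simps)
    finally show ?thesis by (simp add: qs power_mult_distrib)
  qed
  have nn: "0 \<le> 2 * (s * a + b)" using s ab by simp
  show ?thesis
  proof (cases "1 \<le> r")
    case True
    then have s1: "1 \<le> s" using \<sigma> by (simp add: s_def ge_one_powr_ge_zero)
    have "s * norm (y t) \<le> 2 * (s * a + b)"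
      by (rule power2_le_imp_le[OF _ nn]) (use en[OF t] zero_le_power2[of "norm (y' t)"] in linarith)
    also have "\<dots> \<le> s * (2 * (a + b))" using s1 ab mult_right_mono[OF s1, of b] by (simp add: algebra_simps)
    finally have "norm (y t) \<le> 2 * (a + b)" using s by simp
    also have "\<dots> \<le> 2 * (1 + t) * (a + b)" using t ab by (intro mult_right_mono) auto
    finally show ?thesis by (simp add: a_def b_def)
  next
    case False
    then have s1: "s \<le> 1" using r \<sigma> powr_mono2[of \<sigma> r 1] by (simp add: s_def)
    have y'_le: "norm (y' x) \<le> 2 * (a + b)" if x: "x \<in> {0..}" for x
    proof -
      have x0: "0 \<le> x" using x by simp
      have "norm (y' x) \<le> 2 * (s * a + b)"
        by (rule power2_le_imp_le[OF _ nn]) (use en[OF x0] zero_le_power2[of "s * norm (y x)"] in linarith)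
      then show ?thesis using mult_right_mono[OF s1, of a] ab by simp
    qed
    have "norm (y t - y 0) \<le> 2 * (a + b) * norm (t - 0)"
    proof (rule differentiable_bound[where S = "{0..}" and f' = "\<lambda>x h. h *\<^sub>R y' x"])
      fix x :: real assume x: "x \<in> {0..}"
      then show "(y has_derivative (\<lambda>h. h *\<^sub>R y' x)) (at x within {0..})"
        using ode'(1)[of x] by (simp add: has_vector_derivative_def)
      show "onorm (\<lambda>h. h *\<^sub>R y' x) \<le> 2 * (a + b)"
        using y'_le[OF x] by (intro onorm_bound) (auto simp: ab mult.commute intro!: mult_left_mono)
    qed (use t in auto)
    then have "norm (y t) \<le> a + 2 * (a + b) * t"
      using norm_triangle_ineq2[of "y t" "y 0"] t by (simp add: a_def)
    also have "\<dots> \<le> 2 * (1 + t) * (a + b)" using ab by (simp add: algebra_simps)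
    finally show ?thesis by (simp add: a_def b_def)
  qed
qed

lemma AE_norm_neq: "AE x in lborel. norm (x::'a::euclidean_space) \<noteq> c"
proof -
  have "sphere (0::'a) c \<in> null_sets lborel"
    using negligible_sphere[of "0::'a" c] by (auto simp: null_sets_completion_iff negligible_iff_null_sets)
  from AE_not_in[OF this] show ?thesis by (auto elim!: eventually_mono)
qed

lemma ex_Cauchy_solution:
  fixes u0 u1 :: "'a::euclidean_space \<Rightarrow> complex" and \<sigma> \<delta> :: real
  assumes u0: "u0 \<in> Lp_space 2" and u1: "u1 \<in> Lp_space 2" and \<sigma>: "0 < 2 * \<delta>" "2 * \<delta> < \<sigma>"
  shows "\<exists>u. is_Cauchy_solution \<sigma> \<delta> u0 u1 u"
proof -
  let ?A = "fourier_transform u0" and ?B = "fourier_transform u1"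
  have [measurable]: "?A \<in> borel_measurable borel" "?B \<in> borel_measurable borel"
    using u0 u1 by (auto intro: fourier_transform_measurable)
  define p q where "p \<xi> = norm \<xi> powr (2 * \<delta>)" and "q \<xi> = norm \<xi> powr (2 * \<sigma>)" for \<xi> :: 'a
  define d where "d \<xi> = (p \<xi>)\<^sup>2 - 4 * q \<xi>" for \<xi>
  \<comment> \<open>A measurable square root of the discriminant: real where it is nonnegative,
    imaginary where it is negative.\<close>
  define D where "D \<xi> = complex_of_real (sqrt (max 0 (d \<xi>))) + \<i> * of_real (sqrt (max 0 (- d \<xi>)))" for \<xi>
  define l1 l2 where "l1 \<xi> = (- of_real (p \<xi>) + D \<xi>) / 2" and "l2 \<xi> = (- of_real (p \<xi>) - D \<xi>) / 2" for \<xi>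
  define U where "U t \<xi> = (exp (l1 \<xi> * of_real t) * (?B \<xi> - l2 \<xi> * ?A \<xi>) - exp (l2 \<xi> * of_real t) * (?B \<xi> - l1 \<xi> * ?A \<xi>)) / D \<xi>"
    for t :: real and \<xi>
  define U' where "U' t \<xi> = (l1 \<xi> * exp (l1 \<xi> * of_real t) * (?B \<xi> - l2 \<xi> * ?A \<xi>) - l2 \<xi> * exp (l2 \<xi> * of_real t) * (?B \<xi> - l1 \<xi> * ?A \<xi>)) / D \<xi>"
    for t :: real and \<xi>
  have [measurable]: "p \<in> borel_measurable borel" "q \<in> borel_measurable borel"
    unfolding p_def[abs_def] q_def[abs_def] by measurable
  have [measurable]: "D \<in> borel_measurable borel" unfolding D_def[abs_def] d_def by measurable
  have [measurable]: "l1 \<in> borel_measurable borel" "l2 \<in> borel_measurable borel"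
    unfolding l1_def[abs_def] l2_def[abs_def] by measurable
  have [measurable]: "U t \<in> borel_measurable borel" for t unfolding U_def[abs_def] by measurable
  define g where "g = 2 * \<sigma> - 4 * \<delta>"
  have g: "0 < g" using \<sigma> by (simp add: g_def)
  \<comment> \<open>Away from the origin the discriminant vanishes only where |\<xi>|^g = 1 / 4, a
    sphere and therefore a null set.\<close>
  have sol: "AE \<xi> in lborel. damped_ode (p \<xi>) (q \<xi>) (\<lambda>t. U t \<xi>) (\<lambda>t. U' t \<xi>) \<and> U 0 \<xi> = ?A \<xi> \<and> U' 0 \<xi> = ?B \<xi>"
    using AE_norm_neq[of "(1 / 4) powr (1 / g)", where 'a='a] AE_nonzero[where 'a='a]
  proof eventually_elim
    case (elim \<xi>)
    define r where "r = norm \<xi>"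
    have r: "0 < r" using elim by (simp add: r_def)
    have d0: "d \<xi> \<noteq> 0"
    proof
      assume "d \<xi> = 0"
      then have "r powr (4 * \<delta>) = 4 * r powr (2 * \<sigma>)"
        by (simp add: d_def p_def q_def r_def power2_eq_square powr_add[symmetric])
      also have "r powr (2 * \<sigma>) = r powr (4 * \<delta>) * r powr g" by (simp add: g_def powr_add[symmetric])
      finally have "r powr g = 1 / 4" using r by simp
      then have "r = (1 / 4) powr (1 / g)" using r g by (metis powr_powr powr_one less_imp_le nonzero_mult_div_cancel_left times_divide_eq_right mult.right_neutral less_irrefl)
      then show False using elim by (simp add: r_def)
    qed
    have D2: "(D \<xi>)\<^sup>2 = of_real (d \<xi>)"
      by (cases "0 \<le> d \<xi>") (auto simp: D_def max_def power_mult_distrib simp flip: of_real_power)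
    have "D \<xi> \<noteq> 0" using D2 d0 by auto
    from explicit_damped_ode[OF this D2[unfolded d_def], of "?B \<xi>" "?A \<xi>"] show ?case
      unfolding U_def U'_def l1_def l2_def by simp
  qed
  have L2: "U t \<in> Lp_space 2" if t: "0 \<le> t" for t
  proof (rule Lp_space_2_dominated(1))
    have n: "(\<lambda>\<xi>. of_real (norm (f \<xi>))) \<in> Lp_space 2" if "f \<in> Lp_space 2" for f :: "'a \<Rightarrow> complex"
      by (rule Lp_space_2_dominated(1)[OF that]) (use that in auto)
    show "(\<lambda>\<xi>. (2 * (1 + t)) *\<^sub>R (complex_of_real (norm (?A \<xi>)) + of_real (norm (?B \<xi>)))) \<in> Lp_space 2"
      by (rule Lp_space_2_scaleR[OF Lp_space_2_add[OF n[OF fourier_transform_L2[OF u0]] n[OF fourier_transform_L2[OF u1]]]])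
    show "AE \<xi> in lborel. norm (U t \<xi>) \<le> norm ((2 * (1 + t)) *\<^sub>R (complex_of_real (norm (?A \<xi>)) + of_real (norm (?B \<xi>))))"
      using sol AE_nonzero[where 'a='a]
    proof eventually_elim
      case (elim \<xi>)
      then have "norm (U t \<xi>) \<le> 2 * (1 + t) * (norm (?A \<xi>) + norm (?B \<xi>))"
        using damped_ode_growth[of "norm \<xi>" \<sigma> \<delta> "\<lambda>t. U t \<xi>" "\<lambda>t. U' t \<xi>" t] \<sigma> t by (simp add: p_def q_def)
      also have "\<dots> = norm ((2 * (1 + t)) *\<^sub>R (complex_of_real (norm (?A \<xi>)) + of_real (norm (?B \<xi>))))"
        using t by (simp only: norm_scaleR of_real_add[symmetric] norm_of_real) simp
      finally show ?case .
    qed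
  qed measurable
  define u where "u t = (SOME f. f \<in> Lp_space 2 \<and> (AE \<xi> in lborel. fourier_transform f \<xi> = U t \<xi>))" for t
  have u: "u t \<in> Lp_space 2 \<and> (AE \<xi> in lborel. fourier_transform (u t) \<xi> = U t \<xi>)" if t: "0 \<le> t" for t
  proof -
    obtain f where "f \<in> Lp_space 2" "AE \<xi> in lborel. fourier_transform f \<xi> = U t \<xi>"
      by (rule ex_fourier_preimage[OF L2[OF t]])
    then have "\<exists>f. f \<in> Lp_space 2 \<and> (AE \<xi> in lborel. fourier_transform f \<xi> = U t \<xi>)" by blast
    then show ?thesis unfolding u_def by (rule someI_ex)
  qed
  have "is_Cauchy_solution \<sigma> \<delta> u0 u1 u"
    unfolding is_Cauchy_solution_def
  proof (intro conjI u0 u1 exI[of _ U])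
    show "is_partial_fourier u U" using u by (simp add: is_partial_fourier_def)
    show "AE \<xi> in lborel. solves_damped_ode \<sigma> \<delta> (norm \<xi>) (?A \<xi>) (?B \<xi>) (\<lambda>t. U t \<xi>)"
      using sol by eventually_elim (auto simp: solves_damped_ode_iff p_def q_def)
  qed
  then show ?thesis by (intro exI[of _ u])
qed

section \<open>Decay estimates\<close>

lemma Lp_norm_2_le_of_sqint:
  assumes "f \<in> Lp_space 2" "F \<in> Lp_space 2" "sqint f \<le> 2 * sqint F"
  shows "Lp_norm 2 f \<le> 2 * Lp_norm 2 F"
proof (rule power2_le_imp_le)
  have "ennreal ((Lp_norm 2 f)\<^sup>2) \<le> 2 * ennreal ((Lp_norm 2 F)\<^sup>2)"
    using assms by (simp add: sqint_Lp_norm)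
  also have "\<dots> = ennreal (2 * (Lp_norm 2 F)\<^sup>2)" by (simp add: ennreal_mult')
  finally have "(Lp_norm 2 f)\<^sup>2 \<le> 2 * (Lp_norm 2 F)\<^sup>2" by (subst (asm) ennreal_le_iff) auto
  moreover have "(2 * Lp_norm 2 F)\<^sup>2 = 4 * (Lp_norm 2 F)\<^sup>2" by (simp add: power_mult_distrib)
  ultimately show "(Lp_norm 2 f)\<^sup>2 \<le> (2 * Lp_norm 2 F)\<^sup>2"
    using zero_le_power2[of "Lp_norm 2 F"] by linarith
qed simp

lemma Lp_norm_2_cong_AE:
  assumes "f \<in> borel_measurable borel" "g \<in> borel_measurable borel" "AE x in lborel. f x = g x"
  shows "Lp_norm 2 f = Lp_norm 2 g"
  unfolding Lp_norm_def using assms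
  by (intro arg_cong[where f = "\<lambda>x. x powr _"] integral_cong_AE) (auto elim!: eventually_mono)

text \<open>The four terms will be the low- and high-frequency contributions of the two data.
  Cauchy-Schwarz for four summands gives the factor 4 for squares and so 2 for norms.\<close>

lemma Lp_norm_2_le_sum:
  fixes V f1 f2 f3 f4 :: "'a::euclidean_space \<Rightarrow> complex" and k1 k2 k3 k4 :: real
  assumes V[measurable]: "V \<in> borel_measurable borel"
    and f: "f1 \<in> Lp_space 2" "f2 \<in> Lp_space 2" "f3 \<in> Lp_space 2" "f4 \<in> Lp_space 2"
    and k: "0 \<le> k1" "0 \<le> k2" "0 \<le> k3" "0 \<le> k4"
    and le: "AE x in lborel. norm (V x) \<le> k1 * norm (f1 x) + k2 * norm (f2 x) + k3 * norm (f3 x) + k4 * norm (f4 x)"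
  shows "V \<in> Lp_space 2"
    and "Lp_norm 2 V \<le> 2 * (k1 * Lp_norm 2 f1 + k2 * Lp_norm 2 f2 + k3 * Lp_norm 2 f3 + k4 * Lp_norm 2 f4)"
proof -
  have [measurable]: "f1 \<in> borel_measurable borel" "f2 \<in> borel_measurable borel" "f3 \<in> borel_measurable borel" "f4 \<in> borel_measurable borel"
    using f by auto
  have sq: "(a + b + c + d)\<^sup>2 \<le> 4 * a\<^sup>2 + 4 * b\<^sup>2 + 4 * c\<^sup>2 + 4 * d\<^sup>2" for a b c d :: real
  proof -
    have "0 \<le> (a - b)\<^sup>2 + (a - c)\<^sup>2 + (a - d)\<^sup>2 + (b - c)\<^sup>2 + (b - d)\<^sup>2 + (c - d)\<^sup>2" by simp
    then show ?thesis by (simp add: power2_eq_square algebra_simps)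
  qed
  have "sqint V \<le> (\<integral>\<^sup>+x. ennreal (4 * k1\<^sup>2) * ennsq (f1 x) + ennreal (4 * k2\<^sup>2) * ennsq (f2 x) +
      ennreal (4 * k3\<^sup>2) * ennsq (f3 x) + ennreal (4 * k4\<^sup>2) * ennsq (f4 x) \<partial>lborel)"
    unfolding sqint_def
  proof (rule nn_integral_mono_AE, use le in eventually_elim)
    case (elim x)
    have "(norm (V x))\<^sup>2 \<le> (k1 * norm (f1 x) + k2 * norm (f2 x) + k3 * norm (f3 x) + k4 * norm (f4 x))\<^sup>2"
      using elim by (intro power_mono) auto
    also have "\<dots> \<le> 4 * k1\<^sup>2 * (norm (f1 x))\<^sup>2 + 4 * k2\<^sup>2 * (norm (f2 x))\<^sup>2 + 4 * k3\<^sup>2 * (norm (f3 x))\<^sup>2 + 4 * k4\<^sup>2 * (norm (f4 x))\<^sup>2"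
      using sq[of "k1 * norm (f1 x)" "k2 * norm (f2 x)" "k3 * norm (f3 x)" "k4 * norm (f4 x)"]
      by (simp add: power_mult_distrib mult.assoc)
    finally show ?case
      by (simp add: ennreal_mult'[symmetric] ennreal_plus[symmetric] ennreal_leI del: ennreal_plus)
  qed
  also have "\<dots> = ennreal (4 * k1\<^sup>2) * sqint f1 + ennreal (4 * k2\<^sup>2) * sqint f2 + ennreal (4 * k3\<^sup>2) * sqint f3 + ennreal (4 * k4\<^sup>2) * sqint f4"
    by (simp add: nn_integral_add nn_integral_cmult sqint_def)
  also have "\<dots> = ennreal (4 * k1\<^sup>2 * (Lp_norm 2 f1)\<^sup>2 + 4 * k2\<^sup>2 * (Lp_norm 2 f2)\<^sup>2 + 4 * k3\<^sup>2 * (Lp_norm 2 f3)\<^sup>2 + 4 * k4\<^sup>2 * (Lp_norm 2 f4)\<^sup>2)"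
    by (simp add: sqint_Lp_norm f ennreal_mult'[symmetric] ennreal_plus[symmetric] del: ennreal_plus)
  finally have bd: "sqint V \<le> ennreal (4 * k1\<^sup>2 * (Lp_norm 2 f1)\<^sup>2 + 4 * k2\<^sup>2 * (Lp_norm 2 f2)\<^sup>2 + 4 * k3\<^sup>2 * (Lp_norm 2 f3)\<^sup>2 + 4 * k4\<^sup>2 * (Lp_norm 2 f4)\<^sup>2)" .
  also have "\<dots> < \<infinity>" by simp
  finally show V2: "V \<in> Lp_space 2" by (simp add: Lp_space_2_iff)
  define a b c d where "a = k1 * Lp_norm 2 f1" and "b = k2 * Lp_norm 2 f2" and "c = k3 * Lp_norm 2 f3" and "d = k4 * Lp_norm 2 f4"
  have nn: "0 \<le> a" "0 \<le> b" "0 \<le> c" "0 \<le> d" using k by (auto simp: a_def b_def c_def d_def)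
  have "(Lp_norm 2 V)\<^sup>2 \<le> 4 * a\<^sup>2 + 4 * b\<^sup>2 + 4 * c\<^sup>2 + 4 * d\<^sup>2"
    using bd unfolding sqint_Lp_norm[OF V2] by (subst (asm) ennreal_le_iff) (auto simp: a_def b_def c_def d_def power_mult_distrib)
  also have "\<dots> \<le> (2 * (a + b + c + d))\<^sup>2"
    using nn by (simp add: power2_eq_square algebra_simps)
  finally have "Lp_norm 2 V \<le> 2 * (a + b + c + d)" by (rule power2_le_imp_le) (use nn in auto)
  then show "Lp_norm 2 V \<le> 2 * (k1 * Lp_norm 2 f1 + k2 * Lp_norm 2 f2 + k3 * Lp_norm 2 f3 + k4 * Lp_norm 2 f4)"
    by (simp add: a_def b_def c_def d_def)
qed

text \<open>The points t + 1 / (k + 1) stay in the half line, also for t = 0, and there are only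
  countably many, so almost everywhere statements at all these times can be combined.\<close>

lemma has_vector_derivative_LIMSEQ:
  fixes f :: "real \<Rightarrow> complex"
  assumes "(f has_vector_derivative D) (at t within {0..})" "0 \<le> t"
  shows "(\<lambda>k. real (Suc k) *\<^sub>R (f (t + 1 / real (Suc k)) - f t)) \<longlonglongrightarrow> D"
proof -
  have "((\<lambda>y. (1 / norm (y - t)) *\<^sub>R (f y - (f t + (y - t) *\<^sub>R D))) \<longlongrightarrow> 0) (at t within {0..})"
    using assms(1) by (simp add: has_vector_derivative_def has_derivative_within)
  moreover have "filterlim (\<lambda>k. t + 1 / real (Suc k)) (at t within {0..}) sequentially"
    unfolding filterlim_at
  proof (intro conjI always_eventually allI)
    show "(\<lambda>k. t + 1 / real (Suc k)) \<longlonglongrightarrow> t"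
      using tendsto_add[OF tendsto_const LIMSEQ_Suc[OF lim_1_over_n], of t] by simp
  qed (use assms(2) in auto)
  ultimately have "(\<lambda>k. (1 / norm (t + 1 / real (Suc k) - t)) *\<^sub>R
      (f (t + 1 / real (Suc k)) - (f t + (t + 1 / real (Suc k) - t) *\<^sub>R D))) \<longlonglongrightarrow> 0"
    by (rule filterlim_compose)
  also have "(\<lambda>k. (1 / norm (t + 1 / real (Suc k) - t)) *\<^sub>R (f (t + 1 / real (Suc k)) - (f t + (t + 1 / real (Suc k) - t) *\<^sub>R D))) =
      (\<lambda>k. real (Suc k) *\<^sub>R (f (t + 1 / real (Suc k)) - f t) - D)"
  proof
    fix k
    have 1: "1 / norm (t + 1 / real (Suc k) - t) = real (Suc k)" by simp
    show "(1 / norm (t + 1 / real (Suc k) - t)) *\<^sub>R (f (t + 1 / real (Suc k)) - (f t + (t + 1 / real (Suc k) - t) *\<^sub>R D)) =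
      real (Suc k) *\<^sub>R (f (t + 1 / real (Suc k)) - f t) - D"
      unfolding 1 diff_diff_eq[symmetric] scaleR_diff_right scaleR_scaleR by simp
  qed
  finally show ?thesis by (simp add: LIM_zero_iff)
qed

text \<open>The exponent e is a parameter, so that the estimates for m and for 2, where e = 0, are
  instances of one predicate.\<close>

definition decay_estimates ::
    "real \<Rightarrow> real \<Rightarrow> real \<Rightarrow> real \<Rightarrow> real \<Rightarrow> ('a::euclidean_space \<Rightarrow> complex) \<Rightarrow> ('a \<Rightarrow> complex) \<Rightarrow>
      (real \<Rightarrow> 'a \<Rightarrow> complex) \<Rightarrow> real \<Rightarrow> bool" where
  "decay_estimates \<sigma> \<delta> m e C u0 u1 u t \<longleftrightarrow>
    (let N0 = weighted_Lp_norm (2 * \<delta>) m u0; N1 = weighted_Lp_norm (2 * \<delta>) m u1 + Lp_norm 2 u1 in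
    Lp_norm 2 (u t) \<le> C * (1 + t) powr (e - \<delta> / (\<sigma> - \<delta>)) * (N0 + Lp_norm 2 u0) + C * (1 + t) powr e * N1 \<and>
    (u0 \<in> Sobolev_space \<sigma> \<longrightarrow>
      (\<exists>v. is_fractional_Laplacian (\<sigma> / 2) (u t) v \<and> Lp_norm 2 v \<le>
        C * (1 + t) powr (e - (\<sigma> + 2 * \<delta>) / (2 * (\<sigma> - \<delta>))) * (N0 + Sobolev_norm \<sigma> u0) +
        C * (1 + t) powr (e - \<sigma> / (2 * (\<sigma> - \<delta>))) * N1) \<and>
      (\<exists>w. is_time_derivative u t w \<and> Lp_norm 2 w \<le>
        C * (1 + t) powr (e - 1 - \<delta> / (\<sigma> - \<delta>)) * (N0 + Sobolev_norm \<sigma> u0) +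
        C * (1 + t) powr (e - 1) * N1)))"

lemma decay_estimates_mono:
  assumes "decay_estimates \<sigma> \<delta> m e D u0 u1 u t" "D \<le> C"
  shows "decay_estimates \<sigma> \<delta> m e C u0 u1 u t"
proof -
  have "0 \<le> weighted_Lp_norm r p f + Lp_norm 2 f" "0 \<le> weighted_Lp_norm r p f + Sobolev_norm \<sigma> f"
    for r p and f :: "'a \<Rightarrow> complex"
    by (simp_all add: weighted_Lp_norm_def Sobolev_norm_def)
  moreover have "x \<le> C * P * X + C * Q * Y" if "x \<le> D * P * X + D * Q * Y" "0 \<le> P" "0 \<le> Q" "0 \<le> X" "0 \<le> Y" for x P Q X Y :: real
    using that(1) by (rule order_trans) (intro add_mono mult_right_mono that assms(2))
  ultimately show ?thesis
    using assms(1) unfolding decay_estimates_def Let_def by (meson powr_ge_zero)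
qed

text \<open>In the pointwise bounds of \<open>multiplier_bound\<close> the terms with the
  low-frequency weight are measured by \<open>low_frequency_bound\<close> and the exponential ones
  by the L^2 bound for the transform. The endpoint m = 2 is included.\<close>

lemma weighted_decay_estimates:
  fixes \<sigma> \<delta> m :: real
  assumes \<sigma>: "0 < 2 * \<delta>" "2 * \<delta> < \<sigma>" and m: "1 < m" "m \<le> 2"
    and n: "2 * m * \<delta> / (m - 1) < real DIM('a::euclidean_space)"
  defines "e \<equiv> - (real DIM('a) / (2 * (\<sigma> - \<delta>))) * (1 / m - 1 / 2)"
  obtains C where "0 < C" "\<And>(u0::'a \<Rightarrow> complex) u1 u t. u0 \<in> Lp_space 2 \<Longrightarrow> u1 \<in> Lp_space 2 \<Longrightarrow>
    u0 \<in> weighted_Lp_space (2 * \<delta>) m \<Longrightarrow> u1 \<in> weighted_Lp_space (2 * \<delta>) m \<Longrightarrow>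
    is_Cauchy_solution \<sigma> \<delta> u0 u1 u \<Longrightarrow> 0 \<le> t \<Longrightarrow>
    decay_estimates \<sigma> \<delta> m e C u0 u1 u t"
proof -
  define \<theta> where "\<theta> = 2 * (\<sigma> - \<delta>)"
  define \<nu> where "\<nu> = DIM('a) * (1 / m - 1 / 2)"
  \<comment> \<open>Any exponent above \<nu> would do; the exponential provides every power.\<close>
  define \<kappa> where "\<kappa> = \<nu> + 1"
  have \<theta>: "0 < \<theta>" using \<sigma> by (simp add: \<theta>_def)
  have \<nu>: "0 \<le> \<nu>" using m by (simp add: \<nu>_def field_simps)
  have \<kappa>: "0 \<le> \<kappa>" "DIM('a) * (1 / m - 1 / 2) < \<kappa>" using \<nu> by (auto simp: \<kappa>_def \<nu>_def)
  have e_eq: "e = - (\<nu> / \<theta>)" by (simp add: e_def \<nu>_def \<theta>_def)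
  have a: "0 < 2 * \<delta>" "2 * \<delta> * (m / (m - 1)) < real DIM('a)" using \<sigma> n by (auto simp: mult_ac)
  obtain K c where K: "0 < K" and c: "0 < c" and mult: "\<And>r t y y' T W. 0 < r \<Longrightarrow> 0 \<le> t \<Longrightarrow>
    damped_ode (r powr (2 * \<delta>)) (r powr (2 * \<sigma>)) y y' \<Longrightarrow>
    T = (1 + t) powr (1 / (2 * (\<sigma> - \<delta>))) \<Longrightarrow> W = low_weight (2 * \<delta>) \<kappa> T r \<Longrightarrow>
    norm (y t) \<le> K * (T powr - (2 * \<delta>) * W * norm (y 0) + W * norm (y' 0) +
      exp (- (c * t)) * (norm (y 0) + norm (y' 0))) \<and>
    r powr \<sigma> * norm (y t) \<le> K * (T powr - (\<sigma> + 2 * \<delta>) * W * norm (y 0) + T powr - \<sigma> * W * norm (y' 0) +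
      exp (- (c * t)) * ((1 + r\<^sup>2) powr (\<sigma> / 2) * norm (y 0) + norm (y' 0))) \<and>
    norm (y' t) \<le> K * (T powr - (2 * (\<sigma> - \<delta>) + 2 * \<delta>) * W * norm (y 0) + T powr - (2 * (\<sigma> - \<delta>)) * W * norm (y' 0) +
      exp (- (c * t)) * ((1 + r\<^sup>2) powr (\<sigma> / 2) * norm (y 0) + norm (y' 0)))"
    using multiplier_bound[OF \<sigma> \<kappa>(1)] by blast
  obtain C1 where C1: "0 < C1" and pitt: "\<And>(f::'a \<Rightarrow> complex) T. f \<in> Lp_space 2 \<Longrightarrow> f \<in> weighted_Lp_space (2 * \<delta>) m \<Longrightarrow> 0 < T \<Longrightarrow>
    sqint (\<lambda>\<xi>. low_weight (2 * \<delta>) \<kappa> T (norm \<xi>) *\<^sub>R fourier_transform f \<xi>) \<le>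
      ennreal ((C1 * T powr - (DIM('a) * (1 / m - 1 / 2)) * weighted_Lp_norm (2 * \<delta>) m f)\<^sup>2)"
    using low_frequency_bound[OF m a \<kappa>(2)] by blast
  \<comment> \<open>At least as fast as every rate in the three estimates, so the high-frequency
    terms can be put under each of them.\<close>
  define \<beta> where "\<beta> = (\<nu> + \<theta> + \<sigma> + 2 * \<delta>) / \<theta>"
  have "0 \<le> \<beta>" using \<nu> \<theta> \<sigma> by (simp add: \<beta>_def)
  then obtain K3 where K3: "0 < K3" and expo: "\<And>t. 0 \<le> t \<Longrightarrow> exp (- (c * t)) \<le> K3 * (1 + t) powr - \<beta>"
    using exp_le_powr_decay[OF _ c] by blast
  \<comment> \<open>The 2 is that of \<open>Lp_norm_2_le_sum\<close>, and 2 \<open>K3\<close> comes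
    from bounding the norm of the transform of \<open>u1\<close> by twice that of \<open>u1\<close>.
    In \<open>C\<close> the 4 has a factor 2 for returning from the transform of the solution and a
    factor 2 for the transform of \<open>u0\<close>.\<close>
  define C2 where "C2 = 2 * K * (C1 + 2 * K3)"
  have C2: "0 < C2" using K C1 K3 by (simp add: C2_def)
  define C where "C = 4 * C2"
  have C: "0 < C" using C2 by (simp add: C_def)
  \<comment> \<open>The three estimates differ in the multiplied transform \<open>V\<close>, in the
    gains \<open>\<beta>0\<close> and \<open>\<beta>1\<close>, and in \<open>H\<close>: the
    transform of \<open>u0\<close> for the first, and the Sobolev-weighted one for the other
    two.\<close>
  have est: "V \<in> Lp_space 2 \<and> Lp_norm 2 V \<le> C2 * ((1 + t) powr (- ((\<nu> + \<beta>0) / \<theta>)) * (weighted_Lp_norm (2 * \<delta>) m u0 + Lp_norm 2 H) +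
      (1 + t) powr (- ((\<nu> + \<beta>1) / \<theta>)) * (weighted_Lp_norm (2 * \<delta>) m u1 + Lp_norm 2 u1))"
    if u: "u0 \<in> Lp_space 2" "u1 \<in> Lp_space 2" "u0 \<in> weighted_Lp_space (2 * \<delta>) m" "u1 \<in> weighted_Lp_space (2 * \<delta>) m"
      and t: "0 \<le> t" and V: "V \<in> borel_measurable borel" and H: "H \<in> Lp_space 2"
      and \<beta>01: "\<beta>0 \<le> \<theta> + \<sigma> + 2 * \<delta>" "\<beta>1 \<le> \<theta> + \<sigma> + 2 * \<delta>" and T: "T = (1 + t) powr (1 / \<theta>)"
      and le: "AE \<xi> in lborel. norm (V \<xi>) \<le> K * (T powr - \<beta>0 * low_weight (2 * \<delta>) \<kappa> T (norm \<xi>) * norm (fourier_transform u0 \<xi>) +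
        T powr - \<beta>1 * low_weight (2 * \<delta>) \<kappa> T (norm \<xi>) * norm (fourier_transform u1 \<xi>) +
        exp (- (c * t)) * (norm (H \<xi>) + norm (fourier_transform u1 \<xi>)))"
    for u0 u1 V H :: "'a \<Rightarrow> complex" and t \<beta>0 \<beta>1 T
  proof -
    have T0: "0 < T" using t by (simp add: T)
    let ?W = "\<lambda>f \<xi>. low_weight (2 * \<delta>) \<kappa> T (norm \<xi>) *\<^sub>R fourier_transform f \<xi>"
    let ?N = "weighted_Lp_norm (2 * \<delta>) m"
    let ?E = "exp (- (c * t))"
    have N0: "0 \<le> ?N f" for f :: "'a \<Rightarrow> complex" by (simp add: weighted_Lp_norm_def)
    have WL: "?W f \<in> Lp_space 2" "Lp_norm 2 (?W f) \<le> C1 * T powr - \<nu> * ?N f"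
      if f: "f \<in> Lp_space 2" "f \<in> weighted_Lp_space (2 * \<delta>) m" for f :: "'a \<Rightarrow> complex"
    proof -
      have [measurable]: "fourier_transform f \<in> borel_measurable borel" using f(1) by (rule fourier_transform_measurable)
      note p = pitt[OF f T0, folded \<nu>_def]
      then show W2: "?W f \<in> Lp_space 2"
        using le_less_trans[OF p ennreal_less_top] by (simp add: Lp_space_2_iff)
      have "(Lp_norm 2 (?W f))\<^sup>2 \<le> (C1 * T powr - \<nu> * ?N f)\<^sup>2"
        using p unfolding sqint_Lp_norm[OF W2] by (subst (asm) ennreal_le_iff) auto
      then show "Lp_norm 2 (?W f) \<le> C1 * T powr - \<nu> * ?N f"
        by (rule power2_le_imp_le) (use C1 N0 in auto)
    qed
    have B2: "fourier_transform u1 \<in> Lp_space 2" using u(2) by (rule fourier_transform_L2)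
    have Bn: "Lp_norm 2 (fourier_transform u1) \<le> 2 * Lp_norm 2 u1"
      by (intro Lp_norm_2_le_of_sqint B2 u sqint_fourier_transform_le)
    have "AE \<xi> in lborel. norm (V \<xi>) \<le> (K * T powr - \<beta>0) * norm (?W u0 \<xi>) + (K * T powr - \<beta>1) * norm (?W u1 \<xi>) +
        (K * ?E) * norm (H \<xi>) + (K * ?E) * norm (fourier_transform u1 \<xi>)"
      using le by eventually_elim (simp add: algebra_simps)
    note four = Lp_norm_2_le_sum[OF V WL(1)[OF u(1,3)] WL(1)[OF u(2,4)] H B2 _ _ _ _ this]
    have V2: "V \<in> Lp_space 2" using K by (intro four(1)) auto
    have Tp: "T powr - x = (1 + t) powr (- (x / \<theta>))" for x using t by (simp add: T powr_powr)
    have TT: "T powr - x * T powr - \<nu> = (1 + t) powr (- ((\<nu> + x) / \<theta>))" for x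
      unfolding powr_add[symmetric] Tp[symmetric] by (simp add: algebra_simps)
    have E0: "?E \<le> K3 * (1 + t) powr (- ((\<nu> + x) / \<theta>))" if x: "x \<le> \<theta> + \<sigma> + 2 * \<delta>" for x
    proof -
      have "(\<nu> + x) / \<theta> \<le> \<beta>" unfolding \<beta>_def using x \<theta> by (intro divide_right_mono) auto
      then have "(1 + t) powr - \<beta> \<le> (1 + t) powr (- ((\<nu> + x) / \<theta>))" using t by (intro powr_mono) auto
      then show ?thesis using order_trans[OF expo[OF t] mult_left_mono] K3 by auto
    qed
    define P0 P1 where "P0 = (1 + t) powr (- ((\<nu> + \<beta>0) / \<theta>))" and "P1 = (1 + t) powr (- ((\<nu> + \<beta>1) / \<theta>))"
    have P: "0 \<le> P0" "0 \<le> P1" by (auto simp: P0_def P1_def)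
    have "Lp_norm 2 V \<le> 2 * ((K * T powr - \<beta>0) * Lp_norm 2 (?W u0) + (K * T powr - \<beta>1) * Lp_norm 2 (?W u1) +
        (K * ?E) * Lp_norm 2 H + (K * ?E) * Lp_norm 2 (fourier_transform u1))"
      using K by (intro four(2)) auto
    also have "\<dots> \<le> 2 * ((K * T powr - \<beta>0) * (C1 * T powr - \<nu> * ?N u0) + (K * T powr - \<beta>1) * (C1 * T powr - \<nu> * ?N u1) +
        (K * (K3 * P0)) * Lp_norm 2 H + (K * (K3 * P1)) * (2 * Lp_norm 2 u1))"
    proof (intro mult_left_mono add_mono)
      show "Lp_norm 2 (?W u0) \<le> C1 * T powr - \<nu> * ?N u0" by (rule WL(2)[OF u(1,3)])
      show "Lp_norm 2 (?W u1) \<le> C1 * T powr - \<nu> * ?N u1" by (rule WL(2)[OF u(2,4)])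
      show "K * ?E * Lp_norm 2 H \<le> K * (K3 * P0) * Lp_norm 2 H"
        using E0[OF \<beta>01(1)] K unfolding P0_def by (intro mult_right_mono mult_left_mono) auto
      show "K * ?E * Lp_norm 2 (fourier_transform u1) \<le> K * (K3 * P1) * (2 * Lp_norm 2 u1)"
        using E0[OF \<beta>01(2)] K K3 Bn unfolding P1_def by (intro mult_mono mult_left_mono) auto
    qed (use K in auto)
    also have "\<dots> = 2 * K * (C1 * (P0 * ?N u0) + K3 * (P0 * Lp_norm 2 H) + (C1 * (P1 * ?N u1) + 2 * K3 * (P1 * Lp_norm 2 u1)))"
    proof -
      have "(K * T powr - x) * (C1 * T powr - \<nu> * z) = K * (C1 * ((1 + t) powr (- ((\<nu> + x) / \<theta>)) * z))" for x z
        unfolding TT[symmetric] by simp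
      note k = this[of \<beta>0, folded P0_def] this[of \<beta>1, folded P1_def]
      show ?thesis unfolding k by (simp add: algebra_simps)
    qed
    also have "\<dots> \<le> 2 * K * ((C1 + 2 * K3) * (P0 * ?N u0) + (C1 + 2 * K3) * (P0 * Lp_norm 2 H) +
        ((C1 + 2 * K3) * (P1 * ?N u1) + (C1 + 2 * K3) * (P1 * Lp_norm 2 u1)))"
      using K C1 K3 P N0 by (intro mult_left_mono add_mono mult_right_mono) auto
    also have "\<dots> = C2 * (P0 * (?N u0 + Lp_norm 2 H) + P1 * (?N u1 + Lp_norm 2 u1))"
      by (simp add: C2_def algebra_simps)
    finally show ?thesis using V2 by (simp add: P0_def P1_def)
  qed
  have x: "- ((\<nu> + 2 * \<delta>) / \<theta>) = e - \<delta> / (\<sigma> - \<delta>)" "- ((\<nu> + 0) / \<theta>) = e"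
    "- ((\<nu> + (\<sigma> + 2 * \<delta>)) / \<theta>) = e - (\<sigma> + 2 * \<delta>) / (2 * (\<sigma> - \<delta>))" "- ((\<nu> + \<sigma>) / \<theta>) = e - \<sigma> / (2 * (\<sigma> - \<delta>))"
    "- ((\<nu> + (\<theta> + 2 * \<delta>)) / \<theta>) = e - 1 - \<delta> / (\<sigma> - \<delta>)" "- ((\<nu> + \<theta>) / \<theta>) = e - 1"
  proof -
    have d: "2 * \<delta> / \<theta> = \<delta> / (\<sigma> - \<delta>)" unfolding \<theta>_def by (rule mult_divide_mult_cancel_left) simp
    have o: "\<theta> / \<theta> = 1" using \<theta> by simp
    show "- ((\<nu> + 2 * \<delta>) / \<theta>) = e - \<delta> / (\<sigma> - \<delta>)" unfolding e_eq add_divide_distrib d by simp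
    show "- ((\<nu> + 0) / \<theta>) = e" unfolding e_eq by simp
    show "- ((\<nu> + (\<sigma> + 2 * \<delta>)) / \<theta>) = e - (\<sigma> + 2 * \<delta>) / (2 * (\<sigma> - \<delta>))"
      unfolding e_eq add_divide_distrib[of \<nu>] \<theta>_def[symmetric] by simp
    show "- ((\<nu> + \<sigma>) / \<theta>) = e - \<sigma> / (2 * (\<sigma> - \<delta>))"
      unfolding e_eq add_divide_distrib \<theta>_def[symmetric] by simp
    show "- ((\<nu> + (\<theta> + 2 * \<delta>)) / \<theta>) = e - 1 - \<delta> / (\<sigma> - \<delta>)" unfolding e_eq add_divide_distrib d o by simp
    show "- ((\<nu> + \<theta>) / \<theta>) = e - 1" unfolding e_eq add_divide_distrib o by simp
  qed
  have fin: "X \<le> C * P * (N0 + h) + C * Q * R"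
    if "X \<le> 2 * (C2 * (P * (N0 + h') + Q * R))" "h' \<le> 2 * h" "0 \<le> P" "0 \<le> Q" "0 \<le> N0" "0 \<le> R" for X P Q R N0 h h' :: real
  proof -
    have "P * (N0 + h') + Q * R \<le> P * (2 * (N0 + h)) + 2 * (Q * R)"
      using that by (intro add_mono mult_left_mono) auto
    then have "C2 * (P * (N0 + h') + Q * R) \<le> C2 * (P * (2 * (N0 + h)) + 2 * (Q * R))"
      using C2 by (intro mult_left_mono) auto
    then show ?thesis using that(1) by (simp add: C_def algebra_simps)
  qed
  show ?thesis
  proof (rule that[OF C])
    fix u0 u1 :: "'a \<Rightarrow> complex" and u :: "real \<Rightarrow> 'a \<Rightarrow> complex" and t :: real
    assume u: "u0 \<in> Lp_space 2" "u1 \<in> Lp_space 2" "u0 \<in> weighted_Lp_space (2 * \<delta>) m" "u1 \<in> weighted_Lp_space (2 * \<delta>) m"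
      and sol: "is_Cauchy_solution \<sigma> \<delta> u0 u1 u" and t: "0 \<le> t"
    let ?A = "fourier_transform u0" and ?B = "fourier_transform u1" and ?N = "weighted_Lp_norm (2 * \<delta>) m"
    have N0: "0 \<le> ?N f" for f :: "'a \<Rightarrow> complex" by (simp add: weighted_Lp_norm_def)
    define T where "T = (1 + t) powr (1 / \<theta>)"
    have T0: "T \<noteq> 0" using t by (simp add: T_def)
    have A2: "?A \<in> Lp_space 2" and B2: "?B \<in> Lp_space 2" using u by (auto intro: fourier_transform_L2)
    obtain U where U: "is_partial_fourier u U"
      and Usol: "AE \<xi> in lborel. solves_damped_ode \<sigma> \<delta> (norm \<xi>) (?A \<xi>) (?B \<xi>) (\<lambda>t. U t \<xi>)"
      using sol by (auto simp: is_Cauchy_solution_def)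
    have ut: "u s \<in> Lp_space 2" and FU: "AE \<xi> in lborel. fourier_transform (u s) \<xi> = U s \<xi>" if "0 \<le> s" for s
      using U that by (auto simp: is_partial_fourier_def)
    have Fu2: "fourier_transform (u s) \<in> Lp_space 2" if "0 \<le> s" for s using ut[OF that] by (rule fourier_transform_L2)
    have Fum: "fourier_transform (u s) \<in> borel_measurable borel" if "0 \<le> s" for s using Fu2[OF that] by auto
    define Y' where "Y' \<xi> = (SOME y'. U 0 \<xi> = ?A \<xi> \<and> y' 0 = ?B \<xi> \<and>
        damped_ode (norm \<xi> powr (2 * \<delta>)) (norm \<xi> powr (2 * \<sigma>)) (\<lambda>t. U t \<xi>) y')" for \<xi>
    have ode: "AE \<xi> in lborel. U 0 \<xi> = ?A \<xi> \<and> Y' \<xi> 0 = ?B \<xi> \<and>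
        damped_ode (norm \<xi> powr (2 * \<delta>)) (norm \<xi> powr (2 * \<sigma>)) (\<lambda>t. U t \<xi>) (Y' \<xi>)"
      using Usol unfolding solves_damped_ode_iff
    proof eventually_elim
      case (elim \<xi>)
      then show ?case unfolding Y'_def by (rule someI_ex)
    qed
    define W where "W \<xi> = low_weight (2 * \<delta>) \<kappa> T (norm \<xi>)" for \<xi> :: 'a
    define H where "H \<xi> = ((1 + (norm \<xi>)\<^sup>2) powr (\<sigma> / 2)) *\<^sub>R ?A \<xi>" for \<xi>
    have bounds: "AE \<xi> in lborel.
        norm (U t \<xi>) \<le> K * (T powr - (2 * \<delta>) * W \<xi> * norm (?A \<xi>) + W \<xi> * norm (?B \<xi>) + exp (- (c * t)) * (norm (?A \<xi>) + norm (?B \<xi>))) \<and>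
        norm \<xi> powr \<sigma> * norm (U t \<xi>) \<le> K * (T powr - (\<sigma> + 2 * \<delta>) * W \<xi> * norm (?A \<xi>) + T powr - \<sigma> * W \<xi> * norm (?B \<xi>) +
          exp (- (c * t)) * (norm (H \<xi>) + norm (?B \<xi>))) \<and>
        norm (Y' \<xi> t) \<le> K * (T powr - (\<theta> + 2 * \<delta>) * W \<xi> * norm (?A \<xi>) + T powr - \<theta> * W \<xi> * norm (?B \<xi>) +
          exp (- (c * t)) * (norm (H \<xi>) + norm (?B \<xi>)))"
      using ode AE_nonzero[where 'a='a]
    proof eventually_elim
      case (elim \<xi>)
      have "norm (H \<xi>) = (1 + (norm \<xi>)\<^sup>2) powr (\<sigma> / 2) * norm (?A \<xi>)" by (simp add: H_def)
      then show ?case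
        using mult[of "norm \<xi>" t "\<lambda>t. U t \<xi>" "Y' \<xi>" T "W \<xi>"] elim t by (simp add: W_def T_def \<theta>_def)
    qed
    have "Lp_norm 2 (u t) \<le> C * (1 + t) powr (e - \<delta> / (\<sigma> - \<delta>)) * (?N u0 + Lp_norm 2 u0) +
        C * (1 + t) powr e * (?N u1 + Lp_norm 2 u1)"
    proof -
      have "AE \<xi> in lborel. norm (fourier_transform (u t) \<xi>) \<le> K * (T powr - (2 * \<delta>) * low_weight (2 * \<delta>) \<kappa> T (norm \<xi>) * norm (?A \<xi>) +
          T powr - 0 * low_weight (2 * \<delta>) \<kappa> T (norm \<xi>) * norm (?B \<xi>) + exp (- (c * t)) * (norm (?A \<xi>) + norm (?B \<xi>)))"
        using bounds FU[OF t] by eventually_elim (simp add: W_def T0)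
      from est[OF u t Fum[OF t] A2 _ _ T_def this]
      have "Lp_norm 2 (fourier_transform (u t)) \<le> C2 * ((1 + t) powr (e - \<delta> / (\<sigma> - \<delta>)) * (?N u0 + Lp_norm 2 ?A) +
          (1 + t) powr e * (?N u1 + Lp_norm 2 u1))"
        using \<theta> \<sigma> unfolding x(1,2) by simp
      moreover have "Lp_norm 2 (u t) \<le> 2 * Lp_norm 2 (fourier_transform (u t))"
        by (intro Lp_norm_2_le_of_sqint ut Fu2 t sqint_le_fourier_transform)
      moreover have "Lp_norm 2 ?A \<le> 2 * Lp_norm 2 u0"
        by (intro Lp_norm_2_le_of_sqint A2 u sqint_fourier_transform_le)
      ultimately show ?thesis by (intro fin[where h' = "Lp_norm 2 ?A"]) (auto simp: N0 add_nonneg_nonneg)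
    qed
    moreover have "(\<exists>v. is_fractional_Laplacian (\<sigma> / 2) (u t) v \<and> Lp_norm 2 v \<le>
        C * (1 + t) powr (e - (\<sigma> + 2 * \<delta>) / (2 * (\<sigma> - \<delta>))) * (?N u0 + Sobolev_norm \<sigma> u0) +
        C * (1 + t) powr (e - \<sigma> / (2 * (\<sigma> - \<delta>))) * (?N u1 + Lp_norm 2 u1)) \<and>
      (\<exists>w. is_time_derivative u t w \<and> Lp_norm 2 w \<le>
        C * (1 + t) powr (e - 1 - \<delta> / (\<sigma> - \<delta>)) * (?N u0 + Sobolev_norm \<sigma> u0) +
        C * (1 + t) powr (e - 1) * (?N u1 + Lp_norm 2 u1))"
      if Sob: "u0 \<in> Sobolev_space \<sigma>"
    proof
      have H2: "H \<in> Lp_space 2" using Sob by (simp add: Sobolev_space_def H_def[abs_def])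
      have HS: "Lp_norm 2 H = Sobolev_norm \<sigma> u0" by (simp add: Sobolev_norm_def H_def[abs_def])
      have S0: "0 \<le> Sobolev_norm \<sigma> u0" by (simp add: Sobolev_norm_def)
      define V where "V \<xi> = (norm \<xi> powr \<sigma>) *\<^sub>R fourier_transform (u t) \<xi>" for \<xi>
      have Vm: "V \<in> borel_measurable borel" unfolding V_def[abs_def] using Fum[OF t] by measurable
      have "AE \<xi> in lborel. norm (V \<xi>) \<le> K * (T powr - (\<sigma> + 2 * \<delta>) * low_weight (2 * \<delta>) \<kappa> T (norm \<xi>) * norm (?A \<xi>) +
          T powr - \<sigma> * low_weight (2 * \<delta>) \<kappa> T (norm \<xi>) * norm (?B \<xi>) + exp (- (c * t)) * (norm (H \<xi>) + norm (?B \<xi>)))"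
        using bounds FU[OF t] by eventually_elim (simp add: W_def V_def)
      from est[OF u t Vm H2 _ _ T_def this]
      have V2: "V \<in> Lp_space 2" and Vn: "Lp_norm 2 V \<le> C2 * ((1 + t) powr (e - (\<sigma> + 2 * \<delta>) / (2 * (\<sigma> - \<delta>))) * (?N u0 + Sobolev_norm \<sigma> u0) +
          (1 + t) powr (e - \<sigma> / (2 * (\<sigma> - \<delta>))) * (?N u1 + Lp_norm 2 u1))"
        using \<theta> \<sigma> unfolding x(3,4) HS by simp_all
      obtain v where v: "v \<in> Lp_space 2" "AE \<xi> in lborel. fourier_transform v \<xi> = V \<xi>"
        by (rule ex_fourier_preimage[OF V2])
      have "is_fractional_Laplacian (\<sigma> / 2) (u t) v"
        using v ut[OF t] by (simp add: is_fractional_Laplacian_def V_def)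
      moreover have "Lp_norm 2 v \<le> 2 * Lp_norm 2 (fourier_transform v)"
        by (intro Lp_norm_2_le_of_sqint fourier_transform_L2 v sqint_le_fourier_transform)
      moreover have "Lp_norm 2 (fourier_transform v) = Lp_norm 2 V"
        by (rule Lp_norm_2_cong_AE[OF fourier_transform_measurable[OF v(1)] Vm v(2)])
      ultimately show "\<exists>v. is_fractional_Laplacian (\<sigma> / 2) (u t) v \<and> Lp_norm 2 v \<le>
          C * (1 + t) powr (e - (\<sigma> + 2 * \<delta>) / (2 * (\<sigma> - \<delta>))) * (?N u0 + Sobolev_norm \<sigma> u0) +
          C * (1 + t) powr (e - \<sigma> / (2 * (\<sigma> - \<delta>))) * (?N u1 + Lp_norm 2 u1)"
        using Vn S0 by (intro exI[of _ v] conjI fin[where h' = "Sobolev_norm \<sigma> u0"]) (auto simp: N0 add_nonneg_nonneg)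
      \<comment> \<open>\<open>Y'\<close> is chosen for each \<open>\<xi>\<close> separately; difference quotients provide a measurable version.\<close>
      define F where "F k \<xi> = real (Suc k) *\<^sub>R (fourier_transform (u (t + 1 / real (Suc k))) \<xi> - fourier_transform (u t) \<xi>)" for k \<xi>
      have tk: "0 \<le> t + 1 / real (Suc k)" for k using t by simp
      have [measurable]: "F k \<in> borel_measurable borel" for k
        unfolding F_def[abs_def] using Fum[OF tk[of k]] Fum[OF t] by measurable
      define G where "G \<xi> = lim (\<lambda>k. F k \<xi>)" for \<xi>
      have Gm: "G \<in> borel_measurable borel" unfolding G_def[abs_def] by (rule borel_measurable_lim_metric) measurable
      \<comment> \<open>The representative \<open>U\<close> agrees with the transform off a null set
        that depends on the time; the difference quotients use countably many times, so one null set
        serves them all.\<close>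
      have "AE \<xi> in lborel. \<forall>k. fourier_transform (u (t + 1 / real (Suc k))) \<xi> = U (t + 1 / real (Suc k)) \<xi>"
        using FU[OF tk] by (simp add: AE_all_countable)
      with ode FU[OF t] have GY: "AE \<xi> in lborel. G \<xi> = Y' \<xi> t"
      proof eventually_elim
        case (elim \<xi>)
        then have "((\<lambda>r. U r \<xi>) has_vector_derivative Y' \<xi> t) (at t within {0..})"
          using t by (simp add: damped_ode_def)
        from has_vector_derivative_LIMSEQ[OF this t] have "(\<lambda>k. F k \<xi>) \<longlonglongrightarrow> Y' \<xi> t"
          using elim by (simp add: F_def)
        then show ?case by (simp add: G_def limI)
      qed
      have "AE \<xi> in lborel. norm (G \<xi>) \<le> K * (T powr - (\<theta> + 2 * \<delta>) * low_weight (2 * \<delta>) \<kappa> T (norm \<xi>) * norm (?A \<xi>) +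
          T powr - \<theta> * low_weight (2 * \<delta>) \<kappa> T (norm \<xi>) * norm (?B \<xi>) + exp (- (c * t)) * (norm (H \<xi>) + norm (?B \<xi>)))"
        using bounds GY by eventually_elim (simp add: W_def)
      from est[OF u t Gm H2 _ _ T_def this]
      have G2: "G \<in> Lp_space 2" and Gn: "Lp_norm 2 G \<le> C2 * ((1 + t) powr (e - 1 - \<delta> / (\<sigma> - \<delta>)) * (?N u0 + Sobolev_norm \<sigma> u0) +
          (1 + t) powr (e - 1) * (?N u1 + Lp_norm 2 u1))"
        using \<theta> \<sigma> unfolding x(5,6) HS by simp_all
      obtain w where w: "w \<in> Lp_space 2" "AE \<xi> in lborel. fourier_transform w \<xi> = G \<xi>"
        by (rule ex_fourier_preimage[OF G2])
      have "is_time_derivative u t w"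
        unfolding is_time_derivative_def
      proof (intro conjI w(1) exI[of _ U] U)
        show "AE \<xi> in lborel. \<forall>s\<ge>0. (\<lambda>r. U r \<xi>) differentiable at s within {0..}"
          using ode
        proof eventually_elim
          case (elim \<xi>)
          then show ?case by (auto simp: damped_ode_def intro!: differentiableI_vector)
        qed
        show "AE \<xi> in lborel. ((\<lambda>r. U r \<xi>) has_vector_derivative fourier_transform w \<xi>) (at t within {0..})"
          using ode w(2) GY by eventually_elim (use t in \<open>simp add: damped_ode_def\<close>)
      qed
      moreover have "Lp_norm 2 w \<le> 2 * Lp_norm 2 (fourier_transform w)"
        by (intro Lp_norm_2_le_of_sqint fourier_transform_L2 w sqint_le_fourier_transform)
      moreover have "Lp_norm 2 (fourier_transform w) = Lp_norm 2 G"
        by (rule Lp_norm_2_cong_AE[OF fourier_transform_measurable[OF w(1)] Gm w(2)])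
      ultimately show "\<exists>w. is_time_derivative u t w \<and> Lp_norm 2 w \<le>
          C * (1 + t) powr (e - 1 - \<delta> / (\<sigma> - \<delta>)) * (?N u0 + Sobolev_norm \<sigma> u0) +
          C * (1 + t) powr (e - 1) * (?N u1 + Lp_norm 2 u1)"
        using Gn S0 by (intro exI[of _ w] conjI fin[where h' = "Sobolev_norm \<sigma> u0"]) (auto simp: N0 add_nonneg_nonneg)
    qed
    ultimately show "decay_estimates \<sigma> \<delta> m e C u0 u1 u t"
      unfolding decay_estimates_def Let_def by blast
  qed
qed

theorem mainTheorem2:
  fixes \<sigma> \<delta> m :: real
  assumes "\<sigma> \<ge> 1"
    and "0 < 2 * \<delta>" and "2 * \<delta> < \<sigma>"
    and "1 < m" and "m < 2"
    and "real CARD('n::finite) > 2 * m * \<delta> / (m - 1)"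
  shows "\<exists>C>0. \<forall>u0 u1 :: real ^ 'n \<Rightarrow> complex. u0 \<in> Lp_space 2 \<and> u1 \<in> Lp_space 2 \<longrightarrow>
      (\<exists>u. is_Cauchy_solution \<sigma> \<delta> u0 u1 u) \<and>
      (\<forall>u. is_Cauchy_solution \<sigma> \<delta> u0 u1 u \<longrightarrow>
         (\<forall>t\<ge>0.
             (u0 \<in> weighted_Lp_space (2 * \<delta>) m \<inter> Lp_space 2 \<and>
              u1 \<in> weighted_Lp_space (2 * \<delta>) m \<inter> Lp_space 2 \<longrightarrow>
              Lp_norm 2 (u t) \<le>
                C * (1 + t) powr (- (real CARD('n) / (2 * (\<sigma> - \<delta>))) * (1 / m - 1 / 2) - \<delta> / (\<sigma> - \<delta>))
                  * (weighted_Lp_norm (2 * \<delta>) m u0 + Lp_norm 2 u0)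
                + C * (1 + t) powr (- (real CARD('n) / (2 * (\<sigma> - \<delta>))) * (1 / m - 1 / 2))
                  * (weighted_Lp_norm (2 * \<delta>) m u1 + Lp_norm 2 u1)) \<and>
             (u0 \<in> weighted_Lp_space (2 * \<delta>) m \<inter> Sobolev_space \<sigma> \<and>
              u1 \<in> weighted_Lp_space (2 * \<delta>) m \<inter> Lp_space 2 \<longrightarrow>
              (\<exists>v. is_fractional_Laplacian (\<sigma> / 2) (u t) v \<and> Lp_norm 2 v \<le>
                C * (1 + t) powr (- (real CARD('n) / (2 * (\<sigma> - \<delta>))) * (1 / m - 1 / 2) - (\<sigma> + 2 * \<delta>) / (2 * (\<sigma> - \<delta>)))
                  * (weighted_Lp_norm (2 * \<delta>) m u0 + Sobolev_norm \<sigma> u0)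
                + C * (1 + t) powr (- (real CARD('n) / (2 * (\<sigma> - \<delta>))) * (1 / m - 1 / 2) - \<sigma> / (2 * (\<sigma> - \<delta>)))
                  * (weighted_Lp_norm (2 * \<delta>) m u1 + Lp_norm 2 u1))) \<and>
             (u0 \<in> weighted_Lp_space (2 * \<delta>) m \<inter> Sobolev_space \<sigma> \<and>
              u1 \<in> weighted_Lp_space (2 * \<delta>) m \<inter> Lp_space 2 \<longrightarrow>
              (\<exists>w. is_time_derivative u t w \<and> Lp_norm 2 w \<le>
                C * (1 + t) powr (- (real CARD('n) / (2 * (\<sigma> - \<delta>))) * (1 / m - 1 / 2) - 1 - \<delta> / (\<sigma> - \<delta>))
                  * (weighted_Lp_norm (2 * \<delta>) m u0 + Sobolev_norm \<sigma> u0)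
                + C * (1 + t) powr (- (real CARD('n) / (2 * (\<sigma> - \<delta>))) * (1 / m - 1 / 2) - 1)
                  * (weighted_Lp_norm (2 * \<delta>) m u1 + Lp_norm 2 u1))) \<and>
             (u0 \<in> weighted_Lp_space (2 * \<delta>) 2 \<inter> Lp_space 2 \<and>
              u1 \<in> weighted_Lp_space (2 * \<delta>) 2 \<inter> Lp_space 2 \<longrightarrow>
              Lp_norm 2 (u t) \<le>
                C * (1 + t) powr (- \<delta> / (\<sigma> - \<delta>))
                  * (weighted_Lp_norm (2 * \<delta>) 2 u0 + Lp_norm 2 u0)
                + C
                  * (weighted_Lp_norm (2 * \<delta>) 2 u1 + Lp_norm 2 u1)) \<and>
             (u0 \<in> weighted_Lp_space (2 * \<delta>) 2 \<inter> Sobolev_space \<sigma> \<and>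
              u1 \<in> weighted_Lp_space (2 * \<delta>) 2 \<inter> Lp_space 2 \<longrightarrow>
              (\<exists>v. is_fractional_Laplacian (\<sigma> / 2) (u t) v \<and> Lp_norm 2 v \<le>
                C * (1 + t) powr (- (\<sigma> + 2 * \<delta>) / (2 * (\<sigma> - \<delta>)))
                  * (weighted_Lp_norm (2 * \<delta>) 2 u0 + Sobolev_norm \<sigma> u0)
                + C * (1 + t) powr (- \<sigma> / (2 * (\<sigma> - \<delta>)))
                  * (weighted_Lp_norm (2 * \<delta>) 2 u1 + Lp_norm 2 u1))) \<and>
             (u0 \<in> weighted_Lp_space (2 * \<delta>) 2 \<inter> Sobolev_space \<sigma> \<and>
              u1 \<in> weighted_Lp_space (2 * \<delta>) 2 \<inter> Lp_space 2 \<longrightarrow>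
              (\<exists>w. is_time_derivative u t w \<and> Lp_norm 2 w \<le>
                C * (1 + t) powr (- 1 - \<delta> / (\<sigma> - \<delta>))
                  * (weighted_Lp_norm (2 * \<delta>) 2 u0 + Sobolev_norm \<sigma> u0)
                + C * (1 + t) powr (- 1)
                  * (weighted_Lp_norm (2 * \<delta>) 2 u1 + Lp_norm 2 u1)))))"
proof -
  define e where "e p = - (real CARD('n) / (2 * (\<sigma> - \<delta>))) * (1 / p - 1 / 2)" for p :: real
  \<comment> \<open>For m < 2 the conjugate exponent exceeds 2, so the dimension hypothesis for m
    contains the one needed for the L^2 estimates.\<close>
  have "2 \<le> m / (m - 1)" using assms(4,5) by (simp add: field_simps)
  then have "2 * \<delta> * 2 \<le> 2 * \<delta> * (m / (m - 1))" using assms(2) by (intro mult_left_mono) auto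
  also have "\<dots> = 2 * m * \<delta> / (m - 1)" by simp
  also note assms(6)
  finally have n2: "2 * 2 * \<delta> / (2 - 1) < real CARD('n)" by simp
  define P where "P p C \<longleftrightarrow> (\<forall>(u0 :: real ^ 'n \<Rightarrow> complex) u1 u t. u0 \<in> Lp_space 2 \<and> u1 \<in> Lp_space 2 \<and>
      u0 \<in> weighted_Lp_space (2 * \<delta>) p \<and> u1 \<in> weighted_Lp_space (2 * \<delta>) p \<and> is_Cauchy_solution \<sigma> \<delta> u0 u1 u \<and> 0 \<le> t \<longrightarrow>
      decay_estimates \<sigma> \<delta> p (e p) C u0 u1 u t)" for p C
  have ex: "\<exists>C>0. P p C" if p: "1 < p" "p \<le> 2" "2 * p * \<delta> / (p - 1) < real DIM(real ^ 'n)" for p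
  proof -
    obtain C where "0 < C" "\<And>(u0 :: real ^ 'n \<Rightarrow> complex) u1 u t. u0 \<in> Lp_space 2 \<Longrightarrow> u1 \<in> Lp_space 2 \<Longrightarrow>
      u0 \<in> weighted_Lp_space (2 * \<delta>) p \<Longrightarrow> u1 \<in> weighted_Lp_space (2 * \<delta>) p \<Longrightarrow>
      is_Cauchy_solution \<sigma> \<delta> u0 u1 u \<Longrightarrow> 0 \<le> t \<Longrightarrow> decay_estimates \<sigma> \<delta> p (e p) C u0 u1 u t"
      using weighted_decay_estimates[OF assms(2,3) p] by (auto simp: e_def)
    then show ?thesis unfolding P_def by blast
  qed
  obtain C1 C2 where C1: "0 < C1" "P m C1" and C2: "0 < C2" "P 2 C2"
    using ex[of m] ex[of 2] assms(4,5,6) n2 by auto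
  define C where "C = max C1 C2"
  have C: "0 < C" using C1 by (simp add: C_def)
  have e2: "e 2 = 0" by (simp add: e_def)
  show ?thesis
  proof (intro exI[of _ C] conjI C allI impI)
    fix u0 u1 :: "real ^ 'n \<Rightarrow> complex"
    assume "u0 \<in> Lp_space 2 \<and> u1 \<in> Lp_space 2"
    then show "\<exists>u. is_Cauchy_solution \<sigma> \<delta> u0 u1 u"
      using ex_Cauchy_solution assms(2,3) by blast
  next
    fix u0 u1 :: "real ^ 'n \<Rightarrow> complex" and u and t :: real
    assume u01: "u0 \<in> Lp_space 2 \<and> u1 \<in> Lp_space 2" and sol: "is_Cauchy_solution \<sigma> \<delta> u0 u1 u" and t: "0 \<le> t"
    have p0: "(1 + t) powr 0 = 1" using t by simp
    have E: "decay_estimates \<sigma> \<delta> p (e p) C u0 u1 u t"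
      if "p \<in> {m, 2}" "u0 \<in> weighted_Lp_space (2 * \<delta>) p" "u1 \<in> weighted_Lp_space (2 * \<delta>) p" for p
    proof -
      obtain D where "P p D" "D \<le> C" using \<open>p \<in> {m, 2}\<close> C1 C2 by (auto simp: C_def)
      then show ?thesis
        using that(2,3) u01 sol t unfolding P_def by (blast intro: decay_estimates_mono)
    qed
    note E1 = E[of m, unfolded decay_estimates_def Let_def e_def]
    note E2 = E[of 2, unfolded decay_estimates_def Let_def e2, unfolded diff_0 p0 mult_1_right minus_divide_left]
    {
      assume a: "u0 \<in> weighted_Lp_space (2 * \<delta>) m \<inter> Lp_space 2 \<and> u1 \<in> weighted_Lp_space (2 * \<delta>) m \<inter> Lp_space 2"
      show "Lp_norm 2 (u t) \<le>
                C * (1 + t) powr (- (real CARD('n) / (2 * (\<sigma> - \<delta>))) * (1 / m - 1 / 2) - \<delta> / (\<sigma> - \<delta>))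
                  * (weighted_Lp_norm (2 * \<delta>) m u0 + Lp_norm 2 u0)
                + C * (1 + t) powr (- (real CARD('n) / (2 * (\<sigma> - \<delta>))) * (1 / m - 1 / 2))
                  * (weighted_Lp_norm (2 * \<delta>) m u1 + Lp_norm 2 u1)"
        using E1 a by blast
    next
      assume a: "u0 \<in> weighted_Lp_space (2 * \<delta>) m \<inter> Sobolev_space \<sigma> \<and> u1 \<in> weighted_Lp_space (2 * \<delta>) m \<inter> Lp_space 2"
      show "\<exists>v. is_fractional_Laplacian (\<sigma> / 2) (u t) v \<and> Lp_norm 2 v \<le>
                C * (1 + t) powr (- (real CARD('n) / (2 * (\<sigma> - \<delta>))) * (1 / m - 1 / 2) - (\<sigma> + 2 * \<delta>) / (2 * (\<sigma> - \<delta>)))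
                  * (weighted_Lp_norm (2 * \<delta>) m u0 + Sobolev_norm \<sigma> u0)
                + C * (1 + t) powr (- (real CARD('n) / (2 * (\<sigma> - \<delta>))) * (1 / m - 1 / 2) - \<sigma> / (2 * (\<sigma> - \<delta>)))
                  * (weighted_Lp_norm (2 * \<delta>) m u1 + Lp_norm 2 u1)"
        using E1 a by blast
      show "\<exists>w. is_time_derivative u t w \<and> Lp_norm 2 w \<le>
                C * (1 + t) powr (- (real CARD('n) / (2 * (\<sigma> - \<delta>))) * (1 / m - 1 / 2) - 1 - \<delta> / (\<sigma> - \<delta>))
                  * (weighted_Lp_norm (2 * \<delta>) m u0 + Sobolev_norm \<sigma> u0)
                + C * (1 + t) powr (- (real CARD('n) / (2 * (\<sigma> - \<delta>))) * (1 / m - 1 / 2) - 1)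
                  * (weighted_Lp_norm (2 * \<delta>) m u1 + Lp_norm 2 u1)"
        using E1 a by blast
    next
      assume a: "u0 \<in> weighted_Lp_space (2 * \<delta>) 2 \<inter> Lp_space 2 \<and> u1 \<in> weighted_Lp_space (2 * \<delta>) 2 \<inter> Lp_space 2"
      show "Lp_norm 2 (u t) \<le>
                C * (1 + t) powr (- \<delta> / (\<sigma> - \<delta>)) * (weighted_Lp_norm (2 * \<delta>) 2 u0 + Lp_norm 2 u0)
                + C * (weighted_Lp_norm (2 * \<delta>) 2 u1 + Lp_norm 2 u1)"
        using E2 a by blast
    next
      assume a: "u0 \<in> weighted_Lp_space (2 * \<delta>) 2 \<inter> Sobolev_space \<sigma> \<and> u1 \<in> weighted_Lp_space (2 * \<delta>) 2 \<inter> Lp_space 2"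
      show "\<exists>v. is_fractional_Laplacian (\<sigma> / 2) (u t) v \<and> Lp_norm 2 v \<le>
                C * (1 + t) powr (- (\<sigma> + 2 * \<delta>) / (2 * (\<sigma> - \<delta>)))
                  * (weighted_Lp_norm (2 * \<delta>) 2 u0 + Sobolev_norm \<sigma> u0)
                + C * (1 + t) powr (- \<sigma> / (2 * (\<sigma> - \<delta>)))
                  * (weighted_Lp_norm (2 * \<delta>) 2 u1 + Lp_norm 2 u1)"
        using E2 a by blast
      show "\<exists>w. is_time_derivative u t w \<and> Lp_norm 2 w \<le>
                C * (1 + t) powr (- 1 - \<delta> / (\<sigma> - \<delta>))
                  * (weighted_Lp_norm (2 * \<delta>) 2 u0 + Sobolev_norm \<sigma> u0)
                + C * (1 + t) powr (- 1)
                  * (weighted_Lp_norm (2 * \<delta>) 2 u1 + Lp_norm 2 u1)"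
        using E2 a by blast
    }
  qed
qed

end
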